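(* Let $V\subset\mathbb C^n$ be an irreducible algebraic variety of dimension $k$. Then $V$ is defined over $\mathbb R$ and has a smooth real point if and only if, for a generic linear projection $\pi:\mathbb C^n\to\mathbb C^{k+1}$ defined over $\mathbb R$, the Zariski closure $\overline{\pi(V)}$ is defined over $\mathbb R$ and has a smooth real point.
   Context: A variety $W\subset\mathbb C^m$ is defined over $\mathbb R$ if its vanishing ideal $\mathcal I(W)\subset\mathbb C[y]$ is generated by polynomials with real coefficients. A smooth real point of an irreducible variety $W\subset\mathbb C^m$ (with generators $f_1,\dots,f_r$ of $\mathcal I(W)$) is a point $\xi\in W\cap\mathbb R^m$ with $\operatorname{rank}\operatorname{Jac}(f_1,\dots,f_r)(\xi)=m-\dim W$. Linear maps $\mathbb C^n\to\mathbb C^{k+1}$ are identified with their matrices in $\mathbb C^{n(k+1)}$; "defined over $\mathbb R$" means the matrix is real. A property holds for a generic such projection if there exist finitely many nonzero polynomials $\phi_1,\dots,\phi_l$ in the $n(k+1)$ matrix entries such that the property holds for every projection whose matrix $A$ satisfies $\phi_i(A)\ne0$ for all $i$. *)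

theory Defs
  imports Complex_Main "HOL-Library.Poly_Mapping" "HOL-Combinatorics.Permutations"
begin

text \<open>Multivariate complex polynomials in the variables y_0, y_1, ...:
  a monomial is a finitely supported exponent vector, a polynomial a finitely
  supported coefficient function on monomials (product = convolution).
  A point of C^m is a function nat => complex vanishing at indices >= m.\<close>

type_synonym mpoly = "(nat \<Rightarrow>\<^sub>0 nat) \<Rightarrow>\<^sub>0 complex"

definition vars :: "mpoly \<Rightarrow> nat set" where
  "vars p = (\<Union>mo \<in> Poly_Mapping.keys p. Poly_Mapping.keys mo)"

definition poly_in :: "nat \<Rightarrow> mpoly \<Rightarrow> bool" where
  "poly_in m p \<longleftrightarrow> vars p \<subseteq> {..<m}"

definition eval :: "mpoly \<Rightarrow> (nat \<Rightarrow> complex) \<Rightarrow> complex" where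
  "eval p x = (\<Sum>mo \<in> Poly_Mapping.keys p. Poly_Mapping.lookup p mo * (\<Prod>i \<in> Poly_Mapping.keys mo. x i ^ Poly_Mapping.lookup mo i))"

definition real_coeffs :: "mpoly \<Rightarrow> bool" where
  "real_coeffs p \<longleftrightarrow> (\<forall>mo. Poly_Mapping.lookup p mo \<in> \<real>)"

definition pdiff :: "nat \<Rightarrow> mpoly \<Rightarrow> mpoly" where
  "pdiff i p = (\<Sum>mo \<in> Poly_Mapping.keys p.
      Poly_Mapping.single (mo - Poly_Mapping.single i 1) (Poly_Mapping.lookup p mo * of_nat (Poly_Mapping.lookup mo i)))"

definition cspace :: "nat \<Rightarrow> (nat \<Rightarrow> complex) set" where
  "cspace m = {x. \<forall>i\<ge>m. x i = 0}"

definition zero_set :: "nat \<Rightarrow> mpoly set \<Rightarrow> (nat \<Rightarrow> complex) set" where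
  "zero_set m F = {x \<in> cspace m. \<forall>f\<in>F. eval f x = 0}"

definition is_variety :: "nat \<Rightarrow> (nat \<Rightarrow> complex) set \<Rightarrow> bool" where
  "is_variety m W \<longleftrightarrow> (\<exists>F. (\<forall>f\<in>F. poly_in m f) \<and> W = zero_set m F)"

definition vanish :: "nat \<Rightarrow> (nat \<Rightarrow> complex) set \<Rightarrow> mpoly set" where
  "vanish m W = {p. poly_in m p \<and> (\<forall>x\<in>W. eval p x = 0)}"

definition ideal_gen :: "nat \<Rightarrow> mpoly set \<Rightarrow> mpoly set" where
  "ideal_gen m G = {p. \<exists>(l::nat) gs hs. (\<forall>i<l. gs i \<in> G \<and> poly_in m (hs i)) \<and>
                                  p = (\<Sum>i<l. hs i * gs i)}"

definition zariski_closure :: "nat \<Rightarrow> (nat \<Rightarrow> complex) set \<Rightarrow> (nat \<Rightarrow> complex) set" where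
  "zariski_closure m S = zero_set m (vanish m S)"

definition irreducible_variety :: "nat \<Rightarrow> (nat \<Rightarrow> complex) set \<Rightarrow> bool" where
  "irreducible_variety m W \<longleftrightarrow> is_variety m W \<and> W \<noteq> {} \<and>
     (\<forall>W1 W2. is_variety m W1 \<and> is_variety m W2 \<and> W = W1 \<union> W2 \<longrightarrow> W = W1 \<or> W = W2)"

definition var_dim :: "nat \<Rightarrow> (nat \<Rightarrow> complex) set \<Rightarrow> nat" where
  "var_dim m W = (GREATEST d. \<exists>Z. (\<forall>i\<le>d. irreducible_variety m (Z i)) \<and>
                       (\<forall>i<d. Z i \<subset> Z (Suc i)) \<and> Z d \<subseteq> W)"

definition defined_over_R :: "nat \<Rightarrow> (nat \<Rightarrow> complex) set \<Rightarrow> bool" where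
  "defined_over_R m W \<longleftrightarrow> (\<exists>G. (\<forall>g\<in>G. real_coeffs g) \<and> vanish m W = ideal_gen m G)"

definition det_sq :: "nat \<Rightarrow> (nat \<Rightarrow> nat \<Rightarrow> complex) \<Rightarrow> complex" where
  "det_sq r M = (\<Sum>p | p permutes {..<r}. of_int (sign p) * (\<Prod>i<r. M i (p i)))"

definition mat_rank :: "nat \<Rightarrow> nat \<Rightarrow> (nat \<Rightarrow> nat \<Rightarrow> complex) \<Rightarrow> nat" where
  "mat_rank rows cols M = (GREATEST s. \<exists>\<rho> \<kappa>.
      inj_on \<rho> {..<s} \<and> \<rho> ` {..<s} \<subseteq> {..<rows} \<and>
      inj_on \<kappa> {..<s} \<and> \<kappa> ` {..<s} \<subseteq> {..<cols} \<and>
      det_sq s (\<lambda>i j. M (\<rho> i) (\<kappa> j)) \<noteq> 0)"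

definition smooth_real_point :: "nat \<Rightarrow> (nat \<Rightarrow> complex) set \<Rightarrow> (nat \<Rightarrow> complex) \<Rightarrow> bool" where
  "smooth_real_point m W \<xi> \<longleftrightarrow> \<xi> \<in> W \<and> (\<forall>i. \<xi> i \<in> \<real>) \<and>
     (\<exists>fs. vanish m W = ideal_gen m (set fs) \<and>
           mat_rank (length fs) m (\<lambda>i j. eval (pdiff j (fs ! i)) \<xi>) = m - var_dim m W)"

definition has_smooth_real_point :: "nat \<Rightarrow> (nat \<Rightarrow> complex) set \<Rightarrow> bool" where
  "has_smooth_real_point m W \<longleftrightarrow> (\<exists>\<xi>. smooth_real_point m W \<xi>)"

definition lin_proj :: "nat \<Rightarrow> nat \<Rightarrow> (nat \<Rightarrow> nat \<Rightarrow> real) \<Rightarrow> (nat \<Rightarrow> complex) \<Rightarrow> (nat \<Rightarrow> complex)" where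
  "lin_proj n q A x = (\<lambda>i. if i < q then (\<Sum>j<n. complex_of_real (A i j) * x j) else 0)"

text \<open>The matrix A as a point of C^(q*n): entry (i,j) is coordinate i*n+j.\<close>
definition mat_point :: "nat \<Rightarrow> (nat \<Rightarrow> nat \<Rightarrow> real) \<Rightarrow> (nat \<Rightarrow> complex)" where
  "mat_point n A = (\<lambda>v. complex_of_real (A (v div n) (v mod n)))"

definition generic_real_proj :: "nat \<Rightarrow> nat \<Rightarrow> ((nat \<Rightarrow> nat \<Rightarrow> real) \<Rightarrow> bool) \<Rightarrow> bool" where
  "generic_real_proj n q P \<longleftrightarrow> (\<exists>(l::nat) \<phi>. (\<forall>i<l. \<phi> i \<noteq> 0 \<and> poly_in (q * n) (\<phi> i)) \<and>
      (\<forall>A. (\<forall>i<l. eval (\<phi> i) (mat_point n A) \<noteq> 0) \<longrightarrow> P A))"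

end

theory Submission
  imports "HOL-Computational_Algebra.Fundamental_Theorem_Algebra" "Jordan_Normal_Form.Determinant" Defs
begin

text \<open>For an irreducible variety \<open>V\<close>, being defined over \<open>\<real>\<close> with a smooth real point is equivalent to the Zariski
  density of the real points, and it is density that passes between \<open>V\<close> and its projections.

  If the real points are dense, then the real and imaginary parts of a polynomial vanishing on \<open>V\<close> vanish on \<open>V\<close>,
  and a maximal nonzero minor of the Jacobian is nonzero at some real point. Conversely, near a smooth real point
  \<open>\<xi>\<close> a contraction solves \<open>n - dim V\<close> equations of \<open>V\<close> by points \<open>\<xi> + Y a\<close> depending on \<open>dim V\<close> real coordinates \<open>a\<close>.
  The polynomials vanishing on this germ form a prime ideal, and by Krull's intersection theorem they vanish on \<open>V\<close>.
  Comparing dimensions, the germ is dense in \<open>V\<close>; its points are real, since they are determined by \<open>a\<close> and \<open>V\<close> is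
  invariant under conjugation.

  Density is inherited by every real projection. For the way back, let \<open>F\<close> be a relation of least degree between the
  values \<open>w\<^sub>i\<close> on \<open>V\<close> of \<open>k + 1\<close> linear forms with indeterminate coefficients \<open>a\<^sub>i\<^sub>j\<close>. Differentiating
  \<open>F (a, a y) = 0\<close> with respect to the last row gives \<open>y\<^sub>j = - (\<partial>F/\<partial>a\<^sub>k\<^sub>j) / (\<partial>F/\<partial>w\<^sub>k)\<close>. Density of the real points of
  generic projections makes \<open>F\<close> real without loss of generality, and then this formula lifts real points of the
  projection to real points of \<open>V\<close>.\<close>

text \<open>Density is the pivot because a smooth real point of a projection need not be the image
  of a real point of \<open>V\<close>, while a dense set of real points meets the locus where the
  projection has a rational inverse. For this inverse the coefficients of the forms remain variables
  beside their values: a single projection has an equation, but only the family of all projections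
  can be differentiated in the coefficients. Up to a factor free of the last value, \<open>F\<close>
  is the Chow form of \<open>V\<close>. The same relation yields the dimension theory: the chains
  that define \<open>var_dim\<close> are compared with the number of independent generic forms, and
  tangent spaces at generic points are read off from \<open>F\<close>.

  Near a smooth real point, \<open>n - dim V\<close> equations may cut out other components besides
  \<open>V\<close>; Krull's theorem supplies a factor equal to 1 at the point that disposes of them.
  The germ ideal is prime because along real rays each polynomial outside it has an order and a
  nonzero leading polynomial, and these multiply; limits replace power series.\<close>

section \<open>Polynomial functions of finitely many coordinates\<close>

text \<open>Polynomials are handled as functions: identities, substitutions and evaluations become
  pointwise, and \<open>PF_eval\<close> with \<open>eval_inj\<close> translates back without loss
  because the field is infinite. Points keep infinitely many coordinates; membership in
  \<open>PF m\<close> guarantees that only the first \<open>m\<close> matter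
  (\<open>PF_cong\<close>), so no domain has to be carried along.\<close>

inductive_set PF :: "nat \<Rightarrow> ((nat \<Rightarrow> complex) \<Rightarrow> complex) set" for m :: nat where
  PF_const [intro]: "(\<lambda>x. c) \<in> PF m"
| PF_var [intro]: "i < m \<Longrightarrow> (\<lambda>x. x i) \<in> PF m"
| PF_add [intro]: "f \<in> PF m \<Longrightarrow> g \<in> PF m \<Longrightarrow> (\<lambda>x. f x + g x) \<in> PF m"
| PF_mult [intro]: "f \<in> PF m \<Longrightarrow> g \<in> PF m \<Longrightarrow> (\<lambda>x. f x * g x) \<in> PF m"

lemma PF_uminus [intro]: "f \<in> PF m \<Longrightarrow> (\<lambda>x. - f x) \<in> PF m"
  using PF_mult[OF PF_const[of "-1"], of f m] by simp

lemma PF_diff [intro]: "f \<in> PF m \<Longrightarrow> g \<in> PF m \<Longrightarrow> (\<lambda>x. f x - g x) \<in> PF m"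
  using PF_add[OF _ PF_uminus, of f m g] by simp

lemma PF_sum [intro]: "(\<And>i. i \<in> A \<Longrightarrow> f i \<in> PF m) \<Longrightarrow> (\<lambda>x. \<Sum>i\<in>A. f i x) \<in> PF m"
  by (induction A rule: infinite_finite_induct) auto

lemma PF_prod [intro]: "(\<And>i. i \<in> A \<Longrightarrow> f i \<in> PF m) \<Longrightarrow> (\<lambda>x. \<Prod>i\<in>A. f i x) \<in> PF m"
  by (induction A rule: infinite_finite_induct) auto

lemma PF_power [intro]: "f \<in> PF m \<Longrightarrow> (\<lambda>x. f x ^ k) \<in> PF m"
  by (induction k) auto

lemma PF_if [intro]:
  "(P \<Longrightarrow> f \<in> PF m) \<Longrightarrow> (\<not> P \<Longrightarrow> g \<in> PF m) \<Longrightarrow> (\<lambda>x. if P then f x else g x) \<in> PF m"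
  by (cases P) auto

lemma PF_mono: "f \<in> PF m \<Longrightarrow> m \<le> m' \<Longrightarrow> f \<in> PF m'"
  by (induction rule: PF.induct) auto

lemma PF_cong: "f \<in> PF m \<Longrightarrow> (\<And>i. i < m \<Longrightarrow> x i = y i) \<Longrightarrow> f x = f y"
  by (induction rule: PF.induct) auto

lemma PF_subst: "f \<in> PF m \<Longrightarrow> (\<And>i. i < m \<Longrightarrow> (\<lambda>x. \<sigma> x i) \<in> PF m') \<Longrightarrow> (\<lambda>x. f (\<sigma> x)) \<in> PF m'"
  by (induction rule: PF.induct) auto

lemma univ_poly_add:
  fixes c d :: "nat \<Rightarrow> complex"
  shows "(\<Sum>k\<le>N. c k * t ^ k) + (\<Sum>k\<le>M. d k * t ^ k)
    = (\<Sum>k\<le>max N M. ((if k \<le> N then c k else 0) + (if k \<le> M then d k else 0)) * t ^ k)"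
proof -
  have "(\<Sum>k\<le>N. c k * t ^ k) = (\<Sum>k\<le>max N M. (if k \<le> N then c k else 0) * t ^ k)"
    by (rule sum.mono_neutral_cong_left) auto
  moreover have "(\<Sum>k\<le>M. d k * t ^ k) = (\<Sum>k\<le>max N M. (if k \<le> M then d k else 0) * t ^ k)"
    by (rule sum.mono_neutral_cong_left) auto
  ultimately show ?thesis by (simp add: sum.distrib distrib_right)
qed

lemma univ_poly_mult:
  fixes c d :: "nat \<Rightarrow> complex"
  shows "(\<Sum>k\<le>N. c k * t ^ k) * (\<Sum>k\<le>M. d k * t ^ k)
    = (\<Sum>k\<le>N + M. (\<Sum>i\<le>k. (if i \<le> N then c i else 0) * (if k - i \<le> M then d (k - i) else 0)) * t ^ k)"
proof -
  have "(\<Sum>k\<le>N. c k * t ^ k) * (\<Sum>k\<le>M. d k * t ^ k)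
    = (\<Sum>k\<le>N. (if k \<le> N then c k else 0) * t ^ k) * (\<Sum>k\<le>M. (if k \<le> M then d k else 0) * t ^ k)"
    by simp
  also have "\<dots> = (\<Sum>k\<le>N + M. (\<Sum>i\<le>k. (if i \<le> N then c i else 0) * (if k - i \<le> M then d (k - i) else 0)) * t ^ k)"
    by (rule polynomial_product) auto
  finally show ?thesis .
qed

text \<open>Regards a polynomial as univariate in its last variable, as the later divisions and
  degree arguments require. The bound \<open>N\<close> need not be the degree, since top
  coefficients may be zero.\<close>

lemma PF_canonical:
  assumes "f \<in> PF (Suc m)"
  shows "\<exists>N c. (\<forall>k. c k \<in> PF m) \<and> f = (\<lambda>x. \<Sum>k\<le>N. c k x * x m ^ k)"
  using assms
proof (induction rule: PF.induct)
  case (PF_const c)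
  show ?case by (rule exI[of _ 0], rule exI[of _ "\<lambda>k x. c"]) auto
next
  case (PF_var i)
  show ?case
  proof (cases "i = m")
    case True
    then show ?thesis by (intro exI[of _ 1] exI[of _ "\<lambda>k x. of_nat k"]) auto
  next
    case False
    with PF_var show ?thesis by (intro exI[of _ 0] exI[of _ "\<lambda>k x. x i"]) auto
  qed
next
  case (PF_add f g)
  then obtain N c M d where "\<forall>k. c k \<in> PF m" "f = (\<lambda>x. \<Sum>k\<le>N. c k x * x m ^ k)"
    "\<forall>k. d k \<in> PF m" "g = (\<lambda>x. \<Sum>k\<le>M. d k x * x m ^ k)" by blast
  note fg = this
  have C: "(\<lambda>x. (if k \<le> N then c k x else 0) + (if k \<le> M then d k x else 0)) \<in> PF m" for k
    using fg by (cases "k \<le> N"; cases "k \<le> M") auto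
  show ?case
    by (rule exI[of _ "max N M"], rule exI[of _ "\<lambda>k x. (if k \<le> N then c k x else 0) + (if k \<le> M then d k x else 0)"])
       (simp add: C, simp add: fg univ_poly_add)
next
  case (PF_mult f g)
  then obtain N c M d where "\<forall>k. c k \<in> PF m" "f = (\<lambda>x. \<Sum>k\<le>N. c k x * x m ^ k)"
    "\<forall>k. d k \<in> PF m" "g = (\<lambda>x. \<Sum>k\<le>M. d k x * x m ^ k)" by blast
  then show ?case
    by (intro exI[of _ "N + M"] exI[of _ "\<lambda>k x. \<Sum>i\<le>k. (if i \<le> N then c i x else 0) * (if k - i \<le> M then d (k - i) x else 0)"])
       (simp only: univ_poly_mult, auto intro!: PF_sum PF.PF_mult PF_if PF.PF_const)
qed

lemma PF_line:
  assumes "f \<in> PF m"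
  shows "\<exists>N c. \<forall>t. f (\<lambda>i. x i + t * u i) = (\<Sum>k\<le>N. c k * t ^ k)"
  using assms
proof (induction rule: PF.induct)
  case (PF_const c)
  show ?case by (rule exI[of _ 0], rule exI[of _ "\<lambda>k. c"]) auto
next
  case (PF_var i)
  show ?case by (rule exI[of _ 1], rule exI[of _ "\<lambda>k. if k = 0 then x i else u i"]) (auto simp: mult.commute)
next
  case (PF_add f g)
  then obtain N c M d where "\<forall>t. f (\<lambda>i. x i + t * u i) = (\<Sum>k\<le>N. c k * t ^ k)"
    "\<forall>t. g (\<lambda>i. x i + t * u i) = (\<Sum>k\<le>M. d k * t ^ k)" by blast
  then show ?case
    by (intro exI[of _ "max N M"] exI[of _ "\<lambda>k. (if k \<le> N then c k else 0) + (if k \<le> M then d k else 0)"]) (simp only: univ_poly_add, simp)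
next
  case (PF_mult f g)
  then obtain N c M d where "\<forall>t. f (\<lambda>i. x i + t * u i) = (\<Sum>k\<le>N. c k * t ^ k)"
    "\<forall>t. g (\<lambda>i. x i + t * u i) = (\<Sum>k\<le>M. d k * t ^ k)" by blast
  then show ?case
    by (intro exI[of _ "N + M"] exI[of _ "\<lambda>k. \<Sum>i\<le>k. (if i \<le> N then c i else 0) * (if k - i \<le> M then d (k - i) else 0)"]) (simp only: univ_poly_mult, simp)
qed

lemma univ_poly_finite_roots:
  fixes c :: "nat \<Rightarrow> complex"
  assumes "(\<Sum>k\<le>N. c k * t ^ k) \<noteq> 0"
  shows "finite {s. (\<Sum>k\<le>N. c k * s ^ k) = 0}"
proof -
  have "\<exists>k\<le>N. c k \<noteq> 0"
    using assms by (metis (no_types, lifting) atMost_iff mult_zero_left sum.neutral)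
  then show ?thesis by (simp add: polyfun_finite_roots)
qed

lemma PF_line_finite:
  assumes "f \<in> PF m" "f (\<lambda>i. x i + t * u i) \<noteq> 0"
  shows "finite {s. f (\<lambda>i. x i + s * u i) = 0}"
  using PF_line[OF assms(1), of x u] assms(2) univ_poly_finite_roots by auto

text \<open>On the line joining \<open>x\<close> and \<open>y\<close> both functions are nonzero
  univariate polynomials, and their finitely many roots cannot exhaust the complex numbers. Choices
  of points that are generic for two conditions rest on this.\<close>

lemma PF_mult_nonzero:
  assumes "f \<in> PF m" "g \<in> PF m'" "f x \<noteq> 0" "g y \<noteq> 0"
  shows "\<exists>z. f z \<noteq> 0 \<and> g z \<noteq> 0"
proof -
  have "finite {s. f (\<lambda>i. x i + s * (y i - x i)) = 0}"
    using assms by (intro PF_line_finite[where t = 0]) auto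
  moreover have "finite {s. g (\<lambda>i. x i + s * (y i - x i)) = 0}"
    using assms by (intro PF_line_finite[where t = 1]) auto
  ultimately have "finite ({s. f (\<lambda>i. x i + s * (y i - x i)) = 0} \<union> {s. g (\<lambda>i. x i + s * (y i - x i)) = 0})"
    by blast
  then obtain s where "s \<notin> {s. f (\<lambda>i. x i + s * (y i - x i)) = 0} \<union> {s. g (\<lambda>i. x i + s * (y i - x i)) = 0}"
    using ex_new_if_finite infinite_UNIV_char_0 by blast
  then show ?thesis by auto
qed

lemma ex_real_near:
  assumes "finite (S :: complex set)" "e > 0"
  shows "\<exists>t. complex_of_real t \<notin> S \<and> \<bar>t - r\<bar> < e"
proof -
  have "infinite {r<..<r+e}" using assms(2) by (simp add: infinite_Ioo)
  moreover have "finite {t. complex_of_real t \<in> S}"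
    using finite_vimageI[OF assms(1) inj_of_real] by (simp add: vimage_def)
  ultimately obtain t where "t \<in> {r<..<r+e}" "t \<notin> {t. complex_of_real t \<in> S}"
    by (meson finite_subset subsetI)
  then show ?thesis by (intro exI[of _ t]) auto
qed

text \<open>The coordinates of \<open>x0\<close> are exchanged one at a time for real ones; in each
  coordinate only finitely many values are forbidden. So real points are Zariski dense in affine
  space.\<close>

lemma PF_nonzero_real:
  assumes "f \<in> PF m" "f x0 \<noteq> 0" "e > 0"
  shows "\<exists>a. f (\<lambda>i. complex_of_real (a i)) \<noteq> 0 \<and> (\<forall>i. \<bar>a i - r i\<bar> < e)"
proof -
  have "\<exists>a. f (\<lambda>i. if i < k then complex_of_real (a i) else x0 i) \<noteq> 0 \<and> (\<forall>i. \<bar>a i - r i\<bar> < e)" for k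
  proof (induction k)
    case 0
    then show ?case using assms by (intro exI[of _ r]) auto
  next
    case (Suc k)
    then obtain a where a: "f (\<lambda>i. if i < k then complex_of_real (a i) else x0 i) \<noteq> 0" "\<forall>i. \<bar>a i - r i\<bar> < e"
      by blast
    \<comment> \<open>The line through \<open>?z\<close> in direction \<open>k\<close> meets the
      current point at parameter \<open>x0 k\<close>, so it is not contained in the zero set of
      \<open>f\<close>.\<close>
    let ?z = "\<lambda>i. if i < k then complex_of_real (a i) else if i = k then 0 else x0 i"
    have "(\<lambda>i. if i < k then complex_of_real (a i) else x0 i) = (\<lambda>i. ?z i + x0 k * (if i = k then 1 else 0))"
      by auto
    then have "finite {s. f (\<lambda>i. ?z i + s * (if i = k then 1 else 0)) = 0}"
      using a(1) by (intro PF_line_finite[OF assms(1), where t = "x0 k"]) simp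
    then obtain t where t: "f (\<lambda>i. ?z i + complex_of_real t * (if i = k then 1 else 0)) \<noteq> 0" "\<bar>t - r k\<bar> < e"
      using ex_real_near[OF _ assms(3), of _ "r k"] by blast
    moreover have "(\<lambda>i. ?z i + complex_of_real t * (if i = k then 1 else 0))
      = (\<lambda>i. if i < Suc k then complex_of_real ((a(k := t)) i) else x0 i)"
      by (auto simp: fun_eq_iff less_Suc_eq)
    ultimately show ?case using a(2) by (intro exI[of _ "a(k := t)"]) auto
  qed
  then obtain a where a: "f (\<lambda>i. if i < m then complex_of_real (a i) else x0 i) \<noteq> 0" "\<forall>i. \<bar>a i - r i\<bar> < e"
    by blast
  have "f (\<lambda>i. complex_of_real (a i)) = f (\<lambda>i. if i < m then complex_of_real (a i) else x0 i)"
    by (rule PF_cong[OF assms(1)]) auto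
  with a show ?thesis by metis
qed

lemma univ_root:
  fixes c :: "nat \<Rightarrow> complex"
  assumes "c N \<noteq> 0" "N > 0"
  shows "\<exists>t. (\<Sum>k\<le>N. c k * t ^ k) = 0"
proof -
  let ?p = "\<Sum>k\<le>N. monom (c k) k"
  have p: "poly ?p t = (\<Sum>k\<le>N. c k * t ^ k)" for t by (simp add: poly_sum poly_monom)
  have "poly.coeff ?p N = c N" by (simp add: coeff_sum)
  then have "Polynomial.degree ?p \<ge> N" using assms le_degree by metis
  then have "\<not> constant (poly ?p)" using assms constant_degree[of ?p] by linarith
  from fundamental_theorem_of_algebra[OF this] show ?thesis using p by auto
qed

subsection \<open>Partial derivatives\<close>

text \<open>An analytic definition, so that the chain rule \<open>PF_chain\<close> can be applied
  along curves; \<open>eval_pdiff\<close> identifies it with the formal derivative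
  \<open>pdiff\<close>.\<close>

definition pd :: "nat \<Rightarrow> ((nat \<Rightarrow> complex) \<Rightarrow> complex) \<Rightarrow> (nat \<Rightarrow> complex) \<Rightarrow> complex" where
  "pd j f x = (THE D. ((\<lambda>t. f (x(j := t))) has_field_derivative D) (at (x j)))"

lemma pd_eqI: "((\<lambda>t. f (x(j := t))) has_field_derivative D) (at (x j)) \<Longrightarrow> pd j f x = D"
  unfolding pd_def by (rule the_equality) (auto intro: DERIV_unique)

lemma PF_has_pd:
  "f \<in> PF m \<Longrightarrow> ((\<lambda>t. f (x(j := t))) has_field_derivative pd j f x) (at (x j))"
proof -
  assume "f \<in> PF m"
  then have "\<exists>D. ((\<lambda>t. f (x(j := t))) has_field_derivative D) (at (x j))"
  proof (induction rule: PF.induct)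
    case (PF_var i)
    show ?case by (cases "i = j") (auto intro: DERIV_ident exI[of _ 0])
  qed (auto intro: DERIV_const DERIV_add DERIV_mult)
  then show ?thesis using pd_eqI by metis
qed

lemma pd_const [simp]: "pd j (\<lambda>x. c) = (\<lambda>x. 0)"
  by (rule ext, rule pd_eqI) simp

lemma pd_var: "pd j (\<lambda>x. x i) = (\<lambda>x. if i = j then 1 else 0)"
  by (rule ext, rule pd_eqI) (auto intro: DERIV_ident)

lemma pd_add: "f \<in> PF m \<Longrightarrow> g \<in> PF m \<Longrightarrow> pd j (\<lambda>x. f x + g x) = (\<lambda>x. pd j f x + pd j g x)"
  by (rule ext, rule pd_eqI) (auto intro: DERIV_add PF_has_pd)

lemma pd_mult:
  assumes "f \<in> PF m" "g \<in> PF m"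
  shows "pd j (\<lambda>x. f x * g x) = (\<lambda>x. pd j f x * g x + f x * pd j g x)"
proof (rule ext, rule pd_eqI)
  fix x
  show "((\<lambda>t. f (x(j := t)) * g (x(j := t))) has_field_derivative pd j f x * g x + f x * pd j g x) (at (x j))"
    using DERIV_mult[OF PF_has_pd[OF assms(1), of x j] PF_has_pd[OF assms(2), of x j]] by (simp add: algebra_simps)
qed

lemma pd_PF [intro]: "f \<in> PF m \<Longrightarrow> pd j f \<in> PF m"
  by (induction rule: PF.induct) (auto simp: pd_var pd_add pd_mult)

lemma PF_chain:
  assumes "f \<in> PF m" "\<And>i. i < m \<Longrightarrow> ((\<lambda>t. z t i) has_field_derivative z' i) (at t0)"
  shows "((\<lambda>t. f (z t)) has_field_derivative (\<Sum>i<m. z' i * pd i f (z t0))) (at t0)"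
  using assms(1)
proof (induction rule: PF.induct)
  case (PF_const c)
  then show ?case by simp
next
  case (PF_var i)
  have "(\<Sum>k<m. z' k * pd k (\<lambda>x. x i) (z t0)) = (\<Sum>k<m. if i = k then z' k else 0)"
    by (rule sum.cong) (auto simp: pd_var)
  then show ?case using PF_var assms(2) by simp
next
  case (PF_add f g)
  then show ?case using DERIV_add[OF PF_add.IH] by (simp add: pd_add sum.distrib distrib_left)
next
  case (PF_mult f g)
  then show ?case using DERIV_mult[OF PF_mult.IH]
    by (simp add: pd_mult sum.distrib distrib_left sum_distrib_right mult.assoc sum_distrib_left mult.left_commute add.commute)
       (simp add: ac_simps)
qed

section \<open>Formal polynomials and the functions they define\<close>

definition mon :: "(nat \<Rightarrow>\<^sub>0 nat) \<Rightarrow> (nat \<Rightarrow> complex) \<Rightarrow> complex" where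
  "mon mo x = (\<Prod>i\<in>Poly_Mapping.keys mo. x i ^ Poly_Mapping.lookup mo i)"

lemma eval_mon: "eval p x = (\<Sum>mo\<in>Poly_Mapping.keys p. Poly_Mapping.lookup p mo * mon mo x)"
  by (simp add: eval_def mon_def)

lemma mon_superset: "finite A \<Longrightarrow> Poly_Mapping.keys mo \<subseteq> A \<Longrightarrow> mon mo x = (\<Prod>i\<in>A. x i ^ Poly_Mapping.lookup mo i)"
  unfolding mon_def by (rule prod.mono_neutral_left) (auto simp: in_keys_iff)

lemma mon_add: "mon (a + b) x = mon a x * mon b x"
proof -
  let ?A = "Poly_Mapping.keys a \<union> Poly_Mapping.keys b"
  have "mon (a + b) x = (\<Prod>i\<in>?A. x i ^ Poly_Mapping.lookup (a + b) i)"
    by (rule mon_superset) (auto simp: keys_add)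
  also have "\<dots> = (\<Prod>i\<in>?A. x i ^ Poly_Mapping.lookup a i) * (\<Prod>i\<in>?A. x i ^ Poly_Mapping.lookup b i)"
    by (simp add: lookup_add power_add prod.distrib)
  also have "\<dots> = mon a x * mon b x"
    by (subst (1 2) mon_superset[of ?A]) auto
  finally show ?thesis .
qed

lemma eval_superset: "finite A \<Longrightarrow> Poly_Mapping.keys p \<subseteq> A \<Longrightarrow> eval p x = (\<Sum>mo\<in>A. Poly_Mapping.lookup p mo * mon mo x)"
  unfolding eval_mon by (rule sum.mono_neutral_left) (auto simp: in_keys_iff)

lemma eval_zero [simp]: "eval 0 x = 0"
  by (simp add: eval_def)

lemma eval_add: "eval (p + q) x = eval p x + eval q x"
proof -
  let ?A = "Poly_Mapping.keys p \<union> Poly_Mapping.keys q"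
  have "eval (p + q) x = (\<Sum>mo\<in>?A. Poly_Mapping.lookup (p + q) mo * mon mo x)"
    by (rule eval_superset) (auto simp: keys_add)
  also have "\<dots> = (\<Sum>mo\<in>?A. Poly_Mapping.lookup p mo * mon mo x) + (\<Sum>mo\<in>?A. Poly_Mapping.lookup q mo * mon mo x)"
    by (simp add: lookup_add distrib_right sum.distrib)
  also have "\<dots> = eval p x + eval q x"
    by (subst (1 2) eval_superset[of ?A]) auto
  finally show ?thesis .
qed

lemma eval_sum: "eval (\<Sum>i\<in>A. p i) x = (\<Sum>i\<in>A. eval (p i) x)"
  by (induction A rule: infinite_finite_induct) (auto simp: eval_add)

lemma eval_single: "eval (Poly_Mapping.single mo c) x = c * mon mo x"
  by (cases "c = 0") (auto simp: eval_mon)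

lemma poly_as_sum: "(p :: mpoly) = (\<Sum>mo\<in>Poly_Mapping.keys p. Poly_Mapping.single mo (Poly_Mapping.lookup p mo))"
  by (rule poly_mapping_eqI)
     (auto simp: lookup_sum lookup_single when_def in_keys_iff if_distrib cong: if_cong intro!: sum.neutral)

lemma eval_mult: "eval (p * q) x = eval p x * eval q x"
proof -
  have "p * q = (\<Sum>a\<in>Poly_Mapping.keys p. \<Sum>b\<in>Poly_Mapping.keys q. Poly_Mapping.single (a + b) (Poly_Mapping.lookup p a * Poly_Mapping.lookup q b))"
    by (subst poly_as_sum[of p], subst poly_as_sum[of q])
       (simp only: sum_distrib_left sum_distrib_right mult_single, rule sum.swap)
  then have "eval (p * q) x = (\<Sum>a\<in>Poly_Mapping.keys p. \<Sum>b\<in>Poly_Mapping.keys q.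
      (Poly_Mapping.lookup p a * mon a x) * (Poly_Mapping.lookup q b * mon b x))"
    by (simp only: eval_sum eval_single mon_add) (simp add: mult_ac)
  then show ?thesis by (simp only: eval_mon sum_product)
qed

lemma mon_PF: "Poly_Mapping.keys mo \<subseteq> {..<m} \<Longrightarrow> mon mo \<in> PF m"
  unfolding mon_def by (intro PF_prod PF_power PF.PF_var) auto

lemma eval_PF: "poly_in m p \<Longrightarrow> eval p \<in> PF m"
  unfolding eval_mon
  by (intro PF_sum PF.PF_mult PF.PF_const mon_PF) (auto simp: poly_in_def vars_def)

lemma poly_in_zero [simp]: "poly_in m 0"
  by (simp add: poly_in_def vars_def)

lemma poly_in_add: "poly_in m p \<Longrightarrow> poly_in m q \<Longrightarrow> poly_in m (p + q)"
  using keys_add[of p q] by (fastforce simp: poly_in_def vars_def)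

lemma poly_in_sum: "(\<And>i. i \<in> A \<Longrightarrow> poly_in m (p i)) \<Longrightarrow> poly_in m (\<Sum>i\<in>A. p i)"
  by (induction A rule: infinite_finite_induct) (auto simp: poly_in_add)

lemma poly_in_mult: "poly_in m p \<Longrightarrow> poly_in m q \<Longrightarrow> poly_in m (p * q)"
  unfolding poly_in_def vars_def
proof safe
  fix i mo assume *: "(\<Union>mo\<in>Poly_Mapping.keys p. Poly_Mapping.keys mo) \<subseteq> {..<m}" "(\<Union>mo\<in>Poly_Mapping.keys q. Poly_Mapping.keys mo) \<subseteq> {..<m}"
    and "mo \<in> Poly_Mapping.keys (p * q)" "i \<in> Poly_Mapping.keys mo"
  then obtain a b where "mo = a + b" "a \<in> Poly_Mapping.keys p" "b \<in> Poly_Mapping.keys q"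
    using keys_mult[of p q] by auto
  with * \<open>i \<in> Poly_Mapping.keys mo\<close> keys_add[of a b] show "i < m" by blast
qed

lemma PF_eval: "f \<in> PF m \<Longrightarrow> \<exists>p. poly_in m p \<and> eval p = f"
proof (induction rule: PF.induct)
  case (PF_const c)
  show ?case
    by (rule exI[of _ "Poly_Mapping.single 0 c"])
       (auto simp: fun_eq_iff eval_single mon_def poly_in_def vars_def)
next
  case (PF_var i)
  then show ?case
    by (intro exI[of _ "Poly_Mapping.single (Poly_Mapping.single i 1) 1"])
       (auto simp: fun_eq_iff eval_single mon_def poly_in_def vars_def)
next
  case (PF_add f g)
  then obtain p q where "poly_in m p" "eval p = f" "poly_in m q" "eval q = g" by blast
  then show ?case by (intro exI[of _ "p + q"]) (auto simp: poly_in_add eval_add fun_eq_iff)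
next
  case (PF_mult f g)
  then obtain p q where "poly_in m p" "eval p = f" "poly_in m q" "eval q = g" by blast
  then show ?case by (intro exI[of _ "p * q"]) (auto simp: poly_in_mult eval_mult fun_eq_iff)
qed

text \<open>Induction on the number of variables: grouping the monomials by the exponent of the last
  variable turns the sum into a univariate polynomial, whose coefficients must vanish for all values
  of the other variables. Inside a group the last exponent is constant, so its monomials are still
  distinguished by the remaining exponents.\<close>

lemma monomials_independent:
  fixes c :: "(nat \<Rightarrow>\<^sub>0 nat) \<Rightarrow> complex"
  assumes "finite K" "\<And>a b. a \<in> K \<Longrightarrow> b \<in> K \<Longrightarrow> (\<forall>i<m. Poly_Mapping.lookup a i = Poly_Mapping.lookup b i) \<Longrightarrow> a = b"
    and "\<And>x. (\<Sum>a\<in>K. c a * (\<Prod>i<m. x i ^ Poly_Mapping.lookup a i)) = 0" and "a \<in> K"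
  shows "c a = 0"
  using assms
proof (induction m arbitrary: K a)
  case 0
  then have "K = {a}" by auto
  then show ?case using "0.prems"(3) by simp
next
  case (Suc m)
  obtain E where E: "\<forall>a\<in>K. Poly_Mapping.lookup a m \<le> E"
    using Suc.prems(1) by (meson finite_nat_set_iff_bounded_le finite_imageI imageI)
  let ?K = "\<lambda>e. {b\<in>K. Poly_Mapping.lookup b m = e}"
  have "(\<Sum>b\<in>?K e. c b * (\<Prod>i<m. x i ^ Poly_Mapping.lookup b i)) = 0" if "e \<le> E" for e x
  proof -
    let ?C = "\<lambda>e. \<Sum>b\<in>?K e. c b * (\<Prod>i<m. x i ^ Poly_Mapping.lookup b i)"
    have "(\<Sum>e\<le>E. ?C e * t ^ e) = 0" for t
    proof -
      have "(\<Sum>e\<le>E. ?C e * t ^ e) = (\<Sum>e\<le>E. \<Sum>b\<in>?K e. c b * (\<Prod>i<Suc m. (x(m := t)) i ^ Poly_Mapping.lookup b i))"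
        by (simp add: sum_distrib_right mult.assoc)
      also have "\<dots> = (\<Sum>b\<in>K. c b * (\<Prod>i<Suc m. (x(m := t)) i ^ Poly_Mapping.lookup b i))"
        using Suc.prems(1) E by (intro sum.group) auto
      also have "\<dots> = 0" by (rule Suc.prems(3))
      finally show ?thesis .
    qed
    then show ?thesis using polyfun_eq_0[of ?C E] that by blast
  qed
  then have "(\<Sum>b\<in>?K (Poly_Mapping.lookup a m). c b * (\<Prod>i<m. x i ^ Poly_Mapping.lookup b i)) = 0" for x
    using E Suc.prems(4) by blast
  then show ?case
    using Suc.prems by (intro Suc.IH[of "?K (Poly_Mapping.lookup a m)"]) (auto simp: less_Suc_eq)
qed

lemma eval_eq_zero:
  assumes "poly_in m p" "\<And>x. eval p x = 0"
  shows "p = 0"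
proof -
  have k: "Poly_Mapping.keys a \<subseteq> {..<m}" if "a \<in> Poly_Mapping.keys p" for a
    using assms(1) that by (auto simp: poly_in_def vars_def)
  have "Poly_Mapping.lookup p a = 0" if "a \<in> Poly_Mapping.keys p" for a
  proof (rule monomials_independent[of "Poly_Mapping.keys p" m "Poly_Mapping.lookup p"])
    fix a b assume ab: "a \<in> Poly_Mapping.keys p" "b \<in> Poly_Mapping.keys p" "\<forall>i<m. Poly_Mapping.lookup a i = Poly_Mapping.lookup b i"
    show "a = b"
    proof (rule poly_mapping_eqI)
      fix i show "Poly_Mapping.lookup a i = Poly_Mapping.lookup b i"
      proof (cases "i < m")
        case False
        then have "i \<notin> Poly_Mapping.keys a" "i \<notin> Poly_Mapping.keys b"
          using k[OF ab(1)] k[OF ab(2)] by auto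
        then show ?thesis by (simp add: not_in_keys_iff_lookup_eq_zero)
      qed (use ab in auto)
    qed
  next
    fix x
    have "eval p x = (\<Sum>a\<in>Poly_Mapping.keys p. Poly_Mapping.lookup p a * (\<Prod>i<m. x i ^ Poly_Mapping.lookup a i))"
      unfolding eval_mon by (rule sum.cong) (auto simp: mon_superset[OF _ k])
    then show "(\<Sum>a\<in>Poly_Mapping.keys p. Poly_Mapping.lookup p a * (\<Prod>i<m. x i ^ Poly_Mapping.lookup a i)) = 0"
      using assms(2) by simp
  qed (use that in auto)
  then show ?thesis by (intro poly_mapping_eqI) (auto simp: in_keys_iff)
qed

lemma poly_in_uminus: "poly_in m p \<Longrightarrow> poly_in m (- p)"
  by (simp add: poly_in_def vars_def in_keys_iff)

lemma eval_inj:
  assumes "poly_in m p" "poly_in m q" "eval p = eval q"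
  shows "p = q"
proof -
  have "p + (-1) * q = 0"
  proof (rule eval_eq_zero[of m])
    have "poly_in m (-q)" using assms(2) by (rule poly_in_uminus)
    from poly_in_add[OF assms(1) this] show "poly_in m (p + (-1) * q)" by simp
    have "eval (-1) x = -1" for x
    proof -
      have "(-1 :: mpoly) = Poly_Mapping.single 0 (-1)" by (simp add: single_uminus)
      then show ?thesis by (simp only: eval_single) (simp add: mon_def)
    qed
    then show "eval (p + (-1) * q) x = 0" for x using assms(3) by (simp only: eval_add eval_mult) simp
  qed
  then show ?thesis by simp
qed

lemma eval_pdiff:
  "eval (pdiff i p) x = pd i (eval p) x"
proof -
  have "((\<lambda>t. mon mo (x(i := t))) has_field_derivative of_nat (Poly_Mapping.lookup mo i) * mon (mo - Poly_Mapping.single i 1) x) (at (x i))" for mo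
  proof -
    let ?A = "insert i (Poly_Mapping.keys mo)" and ?B = "Poly_Mapping.keys mo - {i}"
    have fin: "finite ?A" "finite ?B" by auto
    have A: "?A = insert i ?B" by auto
    have 1: "mon mo (x(i := t)) = t ^ Poly_Mapping.lookup mo i * (\<Prod>k\<in>?B. x k ^ Poly_Mapping.lookup mo k)" for t
    proof -
      have "mon mo (x(i := t)) = (\<Prod>k\<in>insert i ?B. (x(i := t)) k ^ Poly_Mapping.lookup mo k)"
        by (rule mon_superset) auto
      also have "\<dots> = t ^ Poly_Mapping.lookup mo i * (\<Prod>k\<in>?B. (x(i := t)) k ^ Poly_Mapping.lookup mo k)"
        by (subst prod.insert) auto
      also have "(\<Prod>k\<in>?B. (x(i := t)) k ^ Poly_Mapping.lookup mo k) = (\<Prod>k\<in>?B. x k ^ Poly_Mapping.lookup mo k)"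
        by (rule prod.cong) auto
      finally show ?thesis .
    qed
    have 2: "mon (mo - Poly_Mapping.single i 1) x = x i ^ (Poly_Mapping.lookup mo i - 1) * (\<Prod>k\<in>?B. x k ^ Poly_Mapping.lookup mo k)"
    proof -
      have "mon (mo - Poly_Mapping.single i 1) x = (\<Prod>k\<in>insert i ?B. x k ^ Poly_Mapping.lookup (mo - Poly_Mapping.single i 1) k)"
        by (rule mon_superset) (auto simp: in_keys_iff lookup_minus)
      also have "\<dots> = x i ^ (Poly_Mapping.lookup mo i - 1) * (\<Prod>k\<in>?B. x k ^ Poly_Mapping.lookup (mo - Poly_Mapping.single i 1) k)"
        by (subst prod.insert) (auto simp: lookup_minus)
      also have "(\<Prod>k\<in>?B. x k ^ Poly_Mapping.lookup (mo - Poly_Mapping.single i 1) k) = (\<Prod>k\<in>?B. x k ^ Poly_Mapping.lookup mo k)"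
        by (rule prod.cong) (auto simp: lookup_minus lookup_single_not_eq)
      finally show ?thesis .
    qed
    show ?thesis unfolding 1 2 by (auto intro!: derivative_eq_intros)
  qed
  then have "((\<lambda>t. eval p (x(i := t))) has_field_derivative
      (\<Sum>mo\<in>Poly_Mapping.keys p. Poly_Mapping.lookup p mo * (of_nat (Poly_Mapping.lookup mo i) * mon (mo - Poly_Mapping.single i 1) x))) (at (x i))"
    unfolding eval_mon by (intro DERIV_sum DERIV_cmult)
  then have "pd i (eval p) x = (\<Sum>mo\<in>Poly_Mapping.keys p. Poly_Mapping.lookup p mo * (of_nat (Poly_Mapping.lookup mo i) * mon (mo - Poly_Mapping.single i 1) x))"
    by (rule pd_eqI)
  also have "\<dots> = eval (pdiff i p) x"
    unfolding pdiff_def eval_sum eval_single by (simp add: mult.assoc)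
  finally show ?thesis by simp
qed

subsection \<open>Complex conjugation of polynomials\<close>

text \<open>Conjugates the coefficients, as the two conjugations cancel on the variables. The fixed
  points are the polynomials with real coefficients (\<open>real_coeffs_cjf\<close>,
  \<open>cjf_real_coeffs\<close>).\<close>

definition cjf :: "((nat \<Rightarrow> complex) \<Rightarrow> complex) \<Rightarrow> (nat \<Rightarrow> complex) \<Rightarrow> complex" where
  "cjf f x = cnj (f (\<lambda>i. cnj (x i)))"

lemma cjf_PF [intro]: "f \<in> PF m \<Longrightarrow> cjf f \<in> PF m"
proof (induction rule: PF.induct)
  case (PF_add f g)
  then show ?case using PF.PF_add[of "cjf f" m "cjf g"] by (simp add: cjf_def[abs_def])
next
  case (PF_mult f g)
  then show ?case using PF.PF_mult[of "cjf f" m "cjf g"] by (simp add: cjf_def[abs_def])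
qed (auto simp: cjf_def[abs_def])

lemma real_fun_decomp:
  assumes "f \<in> PF m"
  shows "\<exists>g\<in>PF m. \<exists>h\<in>PF m. cjf g = g \<and> cjf h = h \<and> f = (\<lambda>x. g x + \<i> * h x)"
proof -
  have *: "cjf f \<in> PF m" using assms by (rule cjf_PF)
  show ?thesis
  proof (intro bexI conjI)
    show "f = (\<lambda>x. (1/2) * (f x + cjf f x) + \<i> * ((1 / (2 * \<i>)) * (f x - cjf f x)))"
      by (auto simp: fun_eq_iff field_simps)
    show "(\<lambda>x. (1/2) * (f x + cjf f x)) \<in> PF m" "(\<lambda>x. (1 / (2 * \<i>)) * (f x - cjf f x)) \<in> PF m"
      by (intro PF.PF_mult PF.PF_const PF.PF_add PF_diff assms *)+
  qed (auto simp: cjf_def fun_eq_iff field_simps)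
qed

lemma real_fun_real_point: "cjf f = f \<Longrightarrow> (\<And>i. x i \<in> \<real>) \<Longrightarrow> f x \<in> \<real>"
proof -
  assume a: "cjf f = f" "\<And>i. x i \<in> \<real>"
  then have "(\<lambda>i. cnj (x i)) = x" by (simp add: Reals_cnj_iff)
  then have "cnj (f x) = f x" using a(1) by (metis cjf_def)
  then show ?thesis by (simp add: Reals_cnj_iff)
qed

lemma cnj_mon: "cnj (mon mo x) = mon mo (\<lambda>i. cnj (x i))"
  by (simp add: mon_def)

lemma real_coeffs_cjf: "real_coeffs p \<Longrightarrow> cjf (eval p) = eval p"
  by (auto simp: fun_eq_iff cjf_def eval_mon cnj_mon real_coeffs_def Reals_cnj_iff)

lemma cjf_real_coeffs:
  assumes "poly_in m p" "cjf (eval p) = eval p"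
  shows "real_coeffs p"
proof -
  \<comment> \<open>\<open>q\<close> has the conjugate coefficients and evaluates to
    \<open>cjf (eval p)\<close>, so injectivity of evaluation gives \<open>q = p\<close>.\<close>
  define q where "q = (\<Sum>mo\<in>Poly_Mapping.keys p. Poly_Mapping.single mo (cnj (Poly_Mapping.lookup p mo)))"
  have lq: "Poly_Mapping.lookup q mo = cnj (Poly_Mapping.lookup p mo)" for mo
    unfolding q_def
    by (auto simp: lookup_sum lookup_single when_def in_keys_iff if_distrib cong: if_cong intro!: sum.neutral)
  have "Poly_Mapping.keys q = Poly_Mapping.keys p" using lq by (auto simp: in_keys_iff)
  then have "poly_in m q" using assms(1) by (simp add: poly_in_def vars_def)
  moreover have "eval q = eval p"
    using assms(2) by (auto simp: fun_eq_iff cjf_def q_def eval_sum eval_single eval_mon[of p] cnj_mon)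
  ultimately have "q = p" using eval_inj assms(1) by blast
  then show ?thesis using lq by (simp add: real_coeffs_def Reals_cnj_iff)
qed

subsection \<open>The Hilbert basis theorem\<close>

definition pideal :: "nat \<Rightarrow> ((nat \<Rightarrow> complex) \<Rightarrow> complex) set \<Rightarrow> bool" where
  "pideal n I \<longleftrightarrow> I \<subseteq> PF n \<and> (\<lambda>x. 0) \<in> I \<and> (\<forall>f\<in>I. \<forall>g\<in>I. (\<lambda>x. f x + g x) \<in> I)
     \<and> (\<forall>h\<in>PF n. \<forall>f\<in>I. (\<lambda>x. h x * f x) \<in> I)"

inductive_set pspan :: "nat \<Rightarrow> ((nat \<Rightarrow> complex) \<Rightarrow> complex) set \<Rightarrow> ((nat \<Rightarrow> complex) \<Rightarrow> complex) set"
  for n :: nat and B :: "((nat \<Rightarrow> complex) \<Rightarrow> complex) set" where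
  pspan_zero: "(\<lambda>x. 0) \<in> pspan n B"
| pspan_step: "f \<in> pspan n B \<Longrightarrow> b \<in> B \<Longrightarrow> h \<in> PF n \<Longrightarrow> (\<lambda>x. f x + h x * b x) \<in> pspan n B"

lemma pspan_base: "b \<in> B \<Longrightarrow> b \<in> pspan n B"
  using pspan_step[OF pspan_zero, of b B "\<lambda>x. 1" n] by auto

lemma pspan_add: "g \<in> pspan n B \<Longrightarrow> f \<in> pspan n B \<Longrightarrow> (\<lambda>x. f x + g x) \<in> pspan n B"
proof (induction rule: pspan.induct)
  case (pspan_step g b h)
  then show ?case using pspan.pspan_step[of "\<lambda>x. f x + g x" n B b h] by (simp add: add.assoc)
qed simp

lemma pspan_mult: "f \<in> pspan n B \<Longrightarrow> g \<in> PF n \<Longrightarrow> (\<lambda>x. g x * f x) \<in> pspan n B"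
proof (induction rule: pspan.induct)
  case (pspan_step f b h)
  then show ?case using pspan.pspan_step[of "\<lambda>x. g x * f x" n B b "\<lambda>x. g x * h x"]
    by (simp add: PF.PF_mult distrib_left mult.assoc)
qed (simp add: pspan.pspan_zero)

lemma pspan_diff: "f \<in> pspan n B \<Longrightarrow> g \<in> pspan n B \<Longrightarrow> (\<lambda>x. f x - g x) \<in> pspan n B"
  using pspan_add[OF pspan_mult[OF _ PF_const[of "-1"]], of g n B f] by simp

lemma pspan_sum: "(\<And>i. i \<in> A \<Longrightarrow> f i \<in> pspan n B) \<Longrightarrow> (\<lambda>x. \<Sum>i\<in>A. f i x) \<in> pspan n B"
  by (induction A rule: infinite_finite_induct) (auto simp: pspan_zero pspan_add)

lemma pspan_PF: "f \<in> pspan n B \<Longrightarrow> B \<subseteq> PF n \<Longrightarrow> f \<in> PF n"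
  by (induction rule: pspan.induct) (auto intro!: PF.PF_add PF.PF_mult)

lemma pideal_pspan: "B \<subseteq> PF n \<Longrightarrow> pideal n (pspan n B)"
  by (auto simp: pideal_def pspan_zero pspan_add pspan_mult pspan_PF)

lemma pspan_subset_ideal: "pideal n I \<Longrightarrow> B \<subseteq> I \<Longrightarrow> pspan n B \<subseteq> I"
proof
  fix f assume "pideal n I" "B \<subseteq> I" "f \<in> pspan n B"
  from this(3,1,2) show "f \<in> I"
    by (induction rule: pspan.induct) (auto simp: pideal_def subset_iff)
qed

lemma pspan_vanish: "f \<in> pspan n B \<Longrightarrow> (\<And>b. b \<in> B \<Longrightarrow> b x = 0) \<Longrightarrow> f x = 0"
  by (induction rule: pspan.induct) auto

lemma pspan_explicit:
  "f \<in> pspan n B \<Longrightarrow> \<exists>l b h. (\<forall>i<l. b i \<in> B \<and> h i \<in> PF n) \<and> f = (\<lambda>x. \<Sum>i<(l::nat). h i x * b i x)"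
proof (induction rule: pspan.induct)
  case pspan_zero
  show ?case by (rule exI[of _ 0]) auto
next
  case (pspan_step f b h)
  from pspan_step.IH obtain l b' h' where *: "(\<forall>i<(l::nat). b' i \<in> B \<and> h' i \<in> PF n) \<and> f = (\<lambda>x. \<Sum>i<l. h' i x * b' i x)"
    by (elim exE) (erule that)
  show ?case
    by (rule exI[of _ "Suc l"], rule exI[of _ "b'(l := b)"], rule exI[of _ "h'(l := h)"])
       (use * pspan_step(2,3) in \<open>auto simp: less_Suc_eq\<close>)
qed

text \<open>Degree less than \<open>i\<close> in the variable \<open>x m\<close>. The strict bound
  makes \<open>i = 0\<close> the zero polynomial, a convenient base for inductions on the
  degree.\<close>

definition lowdeg :: "nat \<Rightarrow> nat \<Rightarrow> ((nat \<Rightarrow> complex) \<Rightarrow> complex) \<Rightarrow> bool" where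
  "lowdeg m i f \<longleftrightarrow> (\<exists>d. (\<forall>k. d k \<in> PF m) \<and> f = (\<lambda>x. \<Sum>k<i. d k x * x m ^ k))"

lemma lowdeg_PF: "lowdeg m i f \<Longrightarrow> f \<in> PF (Suc m)"
  unfolding lowdeg_def by (auto intro!: PF_sum PF.PF_mult PF_power PF.PF_var intro: PF_mono)

lemma PF_lowdeg: "f \<in> PF (Suc m) \<Longrightarrow> \<exists>i. lowdeg m i f"
proof -
  assume "f \<in> PF (Suc m)"
  then obtain N c where "\<forall>k. c k \<in> PF m" "f = (\<lambda>x. \<Sum>k\<le>N. c k x * x m ^ k)"
    using PF_canonical by blast
  then have "lowdeg m (Suc N) f" unfolding lowdeg_def lessThan_Suc_atMost by blast
  then show ?thesis by blast
qed

lemma lowdeg_zero: "lowdeg m i (\<lambda>x. 0)"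
  unfolding lowdeg_def by (rule exI[of _ "\<lambda>k x. 0"]) auto

lemma lowdeg_0: "lowdeg m 0 f \<longleftrightarrow> f = (\<lambda>x. 0)"
  unfolding lowdeg_def by auto

lemma lowdeg_Suc: "lowdeg m (Suc i) f \<longleftrightarrow> (\<exists>c g. c \<in> PF m \<and> lowdeg m i g \<and> f = (\<lambda>x. c x * x m ^ i + g x))"
proof
  assume "lowdeg m (Suc i) f"
  then obtain d where d: "\<forall>k. d k \<in> PF m" "f = (\<lambda>x. \<Sum>k<Suc i. d k x * x m ^ k)"
    unfolding lowdeg_def by blast
  have "lowdeg m i (\<lambda>x. \<Sum>k<i. d k x * x m ^ k)" unfolding lowdeg_def using d(1) by blast
  moreover have "f = (\<lambda>x. d i x * x m ^ i + (\<Sum>k<i. d k x * x m ^ k))"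
    using d(2) by (simp add: add.commute)
  ultimately show "\<exists>c g. c \<in> PF m \<and> lowdeg m i g \<and> f = (\<lambda>x. c x * x m ^ i + g x)" using d(1) by blast
next
  assume "\<exists>c g. c \<in> PF m \<and> lowdeg m i g \<and> f = (\<lambda>x. c x * x m ^ i + g x)"
  then obtain c d where "c \<in> PF m" "\<forall>k. d k \<in> PF m" "f = (\<lambda>x. c x * x m ^ i + (\<Sum>k<i. d k x * x m ^ k))"
    unfolding lowdeg_def by blast
  then show "lowdeg m (Suc i) f" unfolding lowdeg_def
    by (intro exI[of _ "d(i := c)"]) (auto simp: add.commute fun_eq_iff)
qed

lemma lowdeg_mono: "lowdeg m i f \<Longrightarrow> i \<le> j \<Longrightarrow> lowdeg m j f"
proof (induction j)
  case (Suc j)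
  show ?case
  proof (cases "i = Suc j")
    case False
    with Suc have "lowdeg m j f" by simp
    then show ?thesis unfolding lowdeg_Suc by (intro exI[of _ "\<lambda>x. 0"] exI[of _ f]) auto
  qed (use Suc in simp)
qed simp

lemma lowdeg_add: "lowdeg m i f \<Longrightarrow> lowdeg m i g \<Longrightarrow> lowdeg m i (\<lambda>x. f x + g x)"
proof -
  assume "lowdeg m i f" "lowdeg m i g"
  then obtain d e where "\<forall>k. d k \<in> PF m" "f = (\<lambda>x. \<Sum>k<i. d k x * x m ^ k)"
     "\<forall>k. e k \<in> PF m" "g = (\<lambda>x. \<Sum>k<i. e k x * x m ^ k)" unfolding lowdeg_def by blast
  then show ?thesis unfolding lowdeg_def
    by (intro exI[of _ "\<lambda>k x. d k x + e k x"]) (auto simp: sum.distrib distrib_right)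
qed

lemma lowdeg_mult: "lowdeg m i f \<Longrightarrow> c \<in> PF m \<Longrightarrow> lowdeg m i (\<lambda>x. c x * f x)"
proof -
  assume "lowdeg m i f" "c \<in> PF m"
  then obtain d where "\<forall>k. d k \<in> PF m" "f = (\<lambda>x. \<Sum>k<i. d k x * x m ^ k)" unfolding lowdeg_def by blast
  with \<open>c \<in> PF m\<close> show ?thesis unfolding lowdeg_def
    by (intro exI[of _ "\<lambda>k x. c x * d k x"]) (auto simp: sum_distrib_left mult.assoc)
qed

lemma lowdeg_diff: "lowdeg m i f \<Longrightarrow> lowdeg m i g \<Longrightarrow> lowdeg m i (\<lambda>x. f x - g x)"
  using lowdeg_add[OF _ lowdeg_mult[OF _ PF_const[of "-1"]], of m i f g] by simp

lemma lowdeg_shift: "lowdeg m i f \<Longrightarrow> lowdeg m (i + s) (\<lambda>x. x m ^ s * f x)"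
proof (induction s)
  case (Suc s)
  then obtain d where d: "\<forall>k. d k \<in> PF m" "(\<lambda>x. x m ^ s * f x) = (\<lambda>x. \<Sum>k<i + s. d k x * x m ^ k)"
    unfolding lowdeg_def by blast
  have "(\<Sum>k<Suc (i + s). (case k of 0 \<Rightarrow> 0 | Suc k \<Rightarrow> d k x) * x m ^ k) = x m ^ Suc s * f x" for x
    using fun_cong[OF d(2), of x]
    by (simp only: sum.lessThan_Suc_shift) (simp add: mult.assoc sum_distrib_left mult.left_commute)
  then have "(\<lambda>x. x m ^ Suc s * f x) = (\<lambda>x. \<Sum>k<i + Suc s. (case k of 0 \<Rightarrow> 0 | Suc k \<Rightarrow> d k x) * x m ^ k)"
    by simp
  also have "\<dots> = (\<lambda>x. \<Sum>k<i + Suc s. (case k of 0 \<Rightarrow> (\<lambda>x. 0) | Suc k \<Rightarrow> d k) x * x m ^ k)"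
    by (intro ext sum.cong refl) (simp split: nat.split)
  finally have "(\<lambda>x. x m ^ Suc s * f x) = (\<lambda>x. \<Sum>k<i + Suc s. (case k of 0 \<Rightarrow> (\<lambda>x. 0) | Suc k \<Rightarrow> d k) x * x m ^ k)" .
  moreover have "\<forall>k. (case k of 0 \<Rightarrow> (\<lambda>x. 0) | Suc k \<Rightarrow> d k) \<in> PF m" using d(1) by (auto split: nat.split)
  ultimately show ?case unfolding lowdeg_def by blast
qed simp

text \<open>The coefficients of \<open>x n ^ i\<close> in members of \<open>I\<close> of degree at
  most \<open>i\<close> form an ideal \<open>L i\<close> in one variable fewer. These ideals
  increase and become stationary, and finitely many members of \<open>I\<close> that realize
  generators of \<open>L 0\<close>, ..., \<open>L N\<close> as leading coefficients generate
  \<open>I\<close>.\<close>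

theorem hilbert_basis:
  "pideal n I \<Longrightarrow> \<exists>B. finite B \<and> B \<subseteq> I \<and> I \<subseteq> pspan n B"
proof (induction n arbitrary: I)
  case 0
  have const: "f x = f y" if "f \<in> PF 0" for f x y by (rule PF_cong[OF that]) auto
  show ?case
  proof (cases "I \<subseteq> {\<lambda>x. 0}")
    case True
    then show ?thesis by (intro exI[of _ "{}"]) (auto simp: pspan_zero)
  next
    case False
    then obtain f where f: "f \<in> I" "f \<noteq> (\<lambda>x. 0)" by blast
    then have fP: "f \<in> PF 0" using 0 by (auto simp: pideal_def)
    then have nz: "f x \<noteq> 0" for x using const[OF fP, of _ x] f(2) by auto
    have "g \<in> pspan 0 {f}" if "g \<in> I" for g
    proof -
      have "g \<in> PF 0" using that 0 by (auto simp: pideal_def)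
      have eq: "(\<lambda>x. (g undefined / f undefined) * f x) = g"
      proof (rule ext)
        fix x show "(g undefined / f undefined) * f x = g x"
          using const[OF fP, of x undefined] const[OF \<open>g \<in> PF 0\<close>, of x undefined] nz[of undefined] by simp
      qed
      have "(\<lambda>x. (g undefined / f undefined) * f x) \<in> pspan 0 {f}"
        by (rule pspan_mult[OF pspan_base PF_const]) simp
      then show ?thesis unfolding eq .
    qed
    with f(1) show ?thesis by (intro exI[of _ "{f}"]) auto
  qed
next
  case (Suc n)
  have I: "I \<subseteq> PF (Suc n)" "(\<lambda>x. 0) \<in> I" "\<And>f g. f \<in> I \<Longrightarrow> g \<in> I \<Longrightarrow> (\<lambda>x. f x + g x) \<in> I"
    "\<And>h f. h \<in> PF (Suc n) \<Longrightarrow> f \<in> I \<Longrightarrow> (\<lambda>x. h x * f x) \<in> I"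
    using Suc.prems by (auto simp: pideal_def)
  note PI = Suc.prems
  define L where "L = (\<lambda>i. {c\<in>PF n. \<exists>g. lowdeg n i g \<and> (\<lambda>x. c x * x n ^ i + g x) \<in> I})"
  have Lideal: "pideal n (L i)" for i
    unfolding pideal_def
  proof (intro conjI ballI)
    show "L i \<subseteq> PF n" by (auto simp: L_def)
    show "(\<lambda>x. 0) \<in> L i" using I(2) by (auto simp: L_def intro!: exI[of _ "\<lambda>x. 0"] lowdeg_zero)
  next
    fix c d assume "c \<in> L i" "d \<in> L i"
    then obtain g h where gh: "c \<in> PF n" "lowdeg n i g" "(\<lambda>x. c x * x n ^ i + g x) \<in> I"
      "d \<in> PF n" "lowdeg n i h" "(\<lambda>x. d x * x n ^ i + h x) \<in> I" by (auto simp: L_def)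
    have "(\<lambda>x. (c x + d x) * x n ^ i + (g x + h x)) \<in> I"
      using I(3)[OF gh(3,6)] by (simp add: algebra_simps)
    then show "(\<lambda>x. c x + d x) \<in> L i" using gh lowdeg_add[OF gh(2,5)] by (auto simp: L_def)
  next
    fix h c assume h: "h \<in> PF n" and "c \<in> L i"
    then obtain g where g: "c \<in> PF n" "lowdeg n i g" "(\<lambda>x. c x * x n ^ i + g x) \<in> I" by (auto simp: L_def)
    have "(\<lambda>x. (h x * c x) * x n ^ i + h x * g x) \<in> I"
      using I(4)[OF PF_mono[OF h] g(3)] by (simp add: algebra_simps)
    then show "(\<lambda>x. h x * c x) \<in> L i" using g h lowdeg_mult[OF g(2) h] by (auto simp: L_def)
  qed
  have Lmono: "L i \<subseteq> L j" if "i \<le> j" for i j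
  proof
    fix c assume "c \<in> L i"
    then obtain g where g: "c \<in> PF n" "lowdeg n i g" "(\<lambda>x. c x * x n ^ i + g x) \<in> I" by (auto simp: L_def)
    have "(\<lambda>x. x n ^ (j - i) * (c x * x n ^ i + g x)) \<in> I"
      by (rule I(4)) (use g in auto)
    moreover have "x n ^ (j - i) * (c x * x n ^ i + g x) = c x * x n ^ j + x n ^ (j - i) * g x" for x
      using that by (simp add: distrib_left mult.left_commute flip: power_add)
    ultimately show "c \<in> L j" using g lowdeg_shift[OF g(2), of "j - i"] that by (auto simp: L_def)
  qed
  \<comment> \<open>The union of the chain is an ideal, so its finitely many generators already lie
    in one \<open>L N\<close>: this is the stationarity of the chain.\<close>
  have "pideal n (\<Union>i. L i)"
    unfolding pideal_def
  proof (intro conjI ballI)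
    show "(\<Union>i. L i) \<subseteq> PF n" unfolding L_def by blast
    show "(\<lambda>x. 0) \<in> (\<Union>i. L i)" using Lideal by (auto simp: pideal_def)
    fix f assume f: "f \<in> (\<Union>i. L i)"
    show "(\<lambda>x. f x + g x) \<in> (\<Union>i. L i)" if g: "g \<in> (\<Union>i. L i)" for g
    proof -
      obtain i j where "f \<in> L i" "g \<in> L j" using f g by blast
      then have "f \<in> L (max i j)" "g \<in> L (max i j)" using Lmono[of i "max i j"] Lmono[of j "max i j"] by auto
      then show ?thesis using Lideal[of "max i j"] by (auto simp: pideal_def)
    qed
    show "(\<lambda>x. h x * f x) \<in> (\<Union>i. L i)" if h: "h \<in> PF n" for h
    proof -
      obtain i where "f \<in> L i" using f by blast
      then have "(\<lambda>x. h x * f x) \<in> L i" using Lideal[of i] h by (simp add: pideal_def)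
      then show ?thesis by blast
    qed
  qed
  from Suc.IH[OF this] obtain B0 where B0: "finite B0" "B0 \<subseteq> (\<Union>i. L i)" "(\<Union>i. L i) \<subseteq> pspan n B0" by blast
  then have "\<forall>b\<in>B0. \<exists>i. b \<in> L i" by blast
  then obtain ix where ix: "\<forall>b\<in>B0. b \<in> L (ix b)" by metis
  obtain N where N: "\<forall>b\<in>B0. ix b \<le> N"
    using B0(1) by (metis (no_types) Max_ge finite_imageI imageI)
  have "B0 \<subseteq> L N" using ix N Lmono by blast
  then have LN: "L i \<subseteq> L N" for i using B0(3) pspan_subset_ideal[OF Lideal] by blast
  have "\<forall>i. \<exists>B. finite B \<and> B \<subseteq> L i \<and> L i \<subseteq> pspan n B" using Suc.IH[OF Lideal] by blast
  then obtain B where B: "\<And>i. finite (B i)" "\<And>i. B i \<subseteq> L i" "\<And>i. L i \<subseteq> pspan n (B i)" by metis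
  define e where "e = (\<lambda>i b. SOME g. lowdeg n i g \<and> (\<lambda>x. b x * x n ^ i + g x) \<in> I)"
  have e: "lowdeg n i (e i b) \<and> (\<lambda>x. b x * x n ^ i + e i b x) \<in> I" if "b \<in> B i" for i b
  proof -
    have "b \<in> L i" using that B(2) by blast
    then have "\<exists>g. lowdeg n i g \<and> (\<lambda>x. b x * x n ^ i + g x) \<in> I" unfolding L_def by simp
    from someI_ex[OF this] show ?thesis unfolding e_def .
  qed
  define G where "G = (\<Union>i\<in>{..N}. (\<lambda>b x. b x * x n ^ i + e i b x) ` B i)"
  have G: "finite G" "G \<subseteq> I" using B(1) e by (auto simp: G_def)
  \<comment> \<open>Multiplication by \<open>x n ^ (i - j)\<close> moves a leading coefficient from
    degree \<open>j\<close> to degree \<open>i\<close>, so generators of \<open>L j\<close> also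
    serve all higher degrees.\<close>
  have lift: "\<exists>g\<in>pspan (Suc n) G. \<exists>r. lowdeg n i r \<and> g = (\<lambda>x. c x * x n ^ i + r x)"
    if "c \<in> pspan n (B j)" "j \<le> N" "j \<le> i" for c i j
    using that(1)
  proof (induction rule: pspan.induct)
    case pspan_zero
    show ?case by (rule bexI[OF _ pspan.pspan_zero]) (auto intro!: exI[of _ "\<lambda>x. 0"] lowdeg_zero)
  next
    case (pspan_step c b h)
    then obtain g r where gr: "g \<in> pspan (Suc n) G" "lowdeg n i r" "g = (\<lambda>x. c x * x n ^ i + r x)" by blast
    have bG: "(\<lambda>x. b x * x n ^ j + e j b x) \<in> G" using pspan_step(2) that(2) by (auto simp: G_def)
    have "(\<lambda>x. h x * x n ^ (i - j)) \<in> PF (Suc n)" using PF_mono[OF pspan_step(3), of "Suc n"] by (intro PF.PF_mult PF_power PF.PF_var) auto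
    from pspan.pspan_step[OF gr(1) bG this]
    have 1: "(\<lambda>x. g x + h x * x n ^ (i - j) * (b x * x n ^ j + e j b x)) \<in> pspan (Suc n) G" .
    have "lowdeg n (j + (i - j)) (\<lambda>x. x n ^ (i - j) * (h x * e j b x))"
      using e[OF pspan_step(2)] pspan_step(3) by (intro lowdeg_shift lowdeg_mult) auto
    then have "lowdeg n i (\<lambda>x. r x + x n ^ (i - j) * (h x * e j b x))"
      using that(3) by (intro lowdeg_add gr) simp
    moreover have "g x + h x * x n ^ (i - j) * (b x * x n ^ j + e j b x)
        = (c x + h x * b x) * x n ^ i + (r x + x n ^ (i - j) * (h x * e j b x))" for x
    proof -
      have "x n ^ (i - j) * x n ^ j = x n ^ i" using that(3) by (simp flip: power_add)
      then have "h x * x n ^ (i - j) * (b x * x n ^ j) = h x * b x * x n ^ i"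
        by (metis (no_types, lifting) mult.assoc mult.left_commute)
      then show ?thesis by (simp add: gr(3) algebra_simps)
    qed
    ultimately show ?case using 1 by (intro bexI[OF _ 1]) auto
  qed
  \<comment> \<open>Subtracting a combination of \<open>G\<close> with the same leading coefficient
    lowers the degree; for degrees above \<open>N\<close> the generators of \<open>L N\<close> are
    used.\<close>
  have main: "f \<in> pspan (Suc n) G" if "f \<in> I" "lowdeg n i f" for f i
    using that
  proof (induction i arbitrary: f)
    case 0
    then show ?case by (simp add: lowdeg_0 pspan_zero)
  next
    case (Suc i)
    then obtain c g where cg: "c \<in> PF n" "lowdeg n i g" "f = (\<lambda>x. c x * x n ^ i + g x)" by (auto simp: lowdeg_Suc)
    then have "c \<in> L i" using Suc.prems(1) by (auto simp: L_def)
    then have "c \<in> L (min i N)" using LN by (auto simp: min_def)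
    then have "c \<in> pspan n (B (min i N))" using B(3) by blast
    from lift[OF this, of i] obtain g' r where g': "g' \<in> pspan (Suc n) G" "lowdeg n i r"
      "g' = (\<lambda>x. c x * x n ^ i + r x)" by auto
    have "g' \<in> I" using pspan_subset_ideal[OF PI G(2)] g'(1) by blast
    then have "(\<lambda>x. f x + (-1) * g' x) \<in> I" using I(3)[OF Suc.prems(1) I(4)[OF PF_const[of "-1"]]] by simp
    moreover have "(\<lambda>x. f x + (-1) * g' x) = (\<lambda>x. g x - r x)" by (simp add: cg g' fun_eq_iff)
    ultimately have "(\<lambda>x. g x - r x) \<in> pspan (Suc n) G"
      using Suc.IH lowdeg_diff[OF cg(2) g'(2)] by simp
    from pspan_add[OF g'(1) this] show ?case by (simp add: cg g' add.commute)
  qed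
  have "I \<subseteq> pspan (Suc n) G" using main PF_lowdeg I(1) by blast
  with G show ?case by blast
qed

subsection \<open>Determinants and ranks\<close>

lemma det_sq_det: "det_sq r M = Determinant.det (mat r r (\<lambda>(i, j). M i j))"
proof -
  have "(\<Sum>p | p permutes {..<r}. of_int (sign p) * (\<Prod>i<r. M i (p i)))
    = (\<Sum>p | p permutes {0..<r}. of_int (sign p) * (\<Prod>i = 0..<r. mat r r (\<lambda>(i, j). M i j) $$ (i, p i)))"
    unfolding lessThan_atLeast0
  proof (rule sum.cong[OF refl])
    fix p assume "p \<in> {p. p permutes {0..<r}}"
    then have p: "p i < r" if "i < r" for i using permutes_in_image[of p "{0..<r}" i] that by simp
    have "(\<Prod>i = 0..<r. M i (p i)) = (\<Prod>i = 0..<r. mat r r (\<lambda>(i, j). M i j) $$ (i, p i))"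
      by (rule prod.cong[OF refl]) (simp add: p)
    then show "of_int (sign p) * (\<Prod>i = 0..<r. M i (p i))
      = of_int (sign p) * (\<Prod>i = 0..<r. mat r r (\<lambda>(i, j). M i j) $$ (i, p i))" by simp
  qed
  then show ?thesis
    unfolding det_sq_def Determinant.det_def by simp
qed

lemma det_sq_transpose: "det_sq r (\<lambda>i j. M j i) = det_sq r M"
proof -
  have "mat r r (\<lambda>(i, j). M j i) = transpose_mat (mat r r (\<lambda>(i, j). M i j))" by (rule eq_matI) auto
  then show ?thesis unfolding det_sq_det by (simp add: Determinant.det_transpose[of _ r])
qed

lemma det_sq_eq_0_iff:
  "det_sq r M = 0 \<longleftrightarrow> (\<exists>v. (\<exists>j<r. v j \<noteq> 0) \<and> (\<forall>i<r. (\<Sum>j<r. M i j * v j) = 0))"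
proof -
  let ?A = "mat r r (\<lambda>(i, j). M i j)"
  have "det_sq r M = 0 \<longleftrightarrow> (\<exists>v\<in>carrier_vec r. v \<noteq> 0\<^sub>v r \<and> ?A *\<^sub>v v = 0\<^sub>v r)"
    unfolding det_sq_det by (subst det_0_iff_vec_prod_zero_field[of _ r]) auto
  also have "\<dots> \<longleftrightarrow> (\<exists>v. (\<exists>j<r. v j \<noteq> 0) \<and> (\<forall>i<r. (\<Sum>j<r. M i j * v j) = 0))"
  proof safe
    fix v :: "complex vec" assume v: "v \<in> carrier_vec r" "v \<noteq> 0\<^sub>v r" "?A *\<^sub>v v = 0\<^sub>v r"
    have "(\<Sum>j<r. M i j * v $ j) = 0" if "i < r" for i
    proof -
      have "(?A *\<^sub>v v) $ i = 0" using v(3) that by simp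
      then show ?thesis using that v(1) by (simp add: scalar_prod_def lessThan_atLeast0)
    qed
    moreover have "\<exists>j<r. v $ j \<noteq> 0" using v(1,2) by (metis carrier_vecD eq_vecI index_zero_vec)
    ultimately show "\<exists>v. (\<exists>j<r. v j \<noteq> 0) \<and> (\<forall>i<r. (\<Sum>j<r. M i j * v j) = 0)"
      by (intro exI[of _ "\<lambda>j. v $ j"]) auto
  next
    fix v :: "nat \<Rightarrow> complex" and j assume v: "j < r" "v j \<noteq> 0" "\<forall>i<r. (\<Sum>j<r. M i j * v j) = 0"
    have "vec r v \<noteq> 0\<^sub>v r" using v(1,2) by (metis index_vec index_zero_vec(1))
    moreover have "?A *\<^sub>v vec r v = 0\<^sub>v r"
      using v(3) by (intro eq_vecI) (auto simp: scalar_prod_def lessThan_atLeast0)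
    ultimately show "\<exists>v\<in>carrier_vec r. v \<noteq> 0\<^sub>v r \<and> ?A *\<^sub>v v = 0\<^sub>v r" by (intro bexI[of _ "vec r v"]) auto
  qed
  finally show ?thesis .
qed

lemma det_sq_eq_0_iff_left:
  "det_sq r M = 0 \<longleftrightarrow> (\<exists>u. (\<exists>i<r. u i \<noteq> 0) \<and> (\<forall>j<r. (\<Sum>i<r. u i * M i j) = 0))"
proof -
  have "det_sq r M = 0 \<longleftrightarrow> det_sq r (\<lambda>i j. M j i) = 0" unfolding det_sq_transpose[of r M] ..
  also have "\<dots> \<longleftrightarrow> (\<exists>u. (\<exists>i<r. u i \<noteq> 0) \<and> (\<forall>j<r. (\<Sum>i<r. M i j * u i) = 0))"
    by (rule det_sq_eq_0_iff)
  finally have *: "det_sq r M = 0 \<longleftrightarrow> (\<exists>u. (\<exists>i<r. u i \<noteq> 0) \<and> (\<forall>j<r. (\<Sum>i<r. M i j * u i) = 0))" .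
  have c: "(\<Sum>i<r. M i j * u i) = (\<Sum>i<r. u i * M i j)" for u j by (intro sum.cong refl mult.commute)
  show ?thesis using * unfolding c .
qed

text \<open>Zero rows pad \<open>M\<close> to a square matrix; a zero row makes its determinant
  vanish, and the kernel criterion applies.\<close>

lemma homogeneous_solution:
  assumes "r < n"
  shows "\<exists>v :: nat \<Rightarrow> complex. (\<exists>j<n. v j \<noteq> 0) \<and> (\<forall>i<r. (\<Sum>j<n. M i j * v j) = 0)"
proof -
  let ?M = "\<lambda>i j. if i < r then M i j else 0"
  have "(\<Sum>i<n. (if i = r then 1 else 0) * ?M i j) = 0" for j
    by (intro sum.neutral) auto
  then have "det_sq n ?M = 0"
    unfolding det_sq_eq_0_iff_left using assms by (intro exI[of _ "\<lambda>i. if i = r then 1 else 0"]) auto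
  then obtain v where "\<exists>j<n. v j \<noteq> 0" "\<forall>i<n. (\<Sum>j<n. ?M i j * v j) = 0"
    unfolding det_sq_eq_0_iff by blast
  moreover have "(\<Sum>j<n. M i j * v j) = 0" if "i < r" for i
    using calculation(2) that assms by (auto dest!: spec[of _ i])
  ultimately show ?thesis by blast
qed

text \<open>Appending the column \<open>- b\<close> gives one unknown more than equations. The last
  unknown of a nonzero solution cannot vanish, since \<open>M\<close> has trivial kernel; dividing
  by it solves the system.\<close>

lemma inhomogeneous_solution:
  assumes "det_sq r M \<noteq> 0"
  shows "\<exists>v. \<forall>i<r. (\<Sum>j<r. M i j * v j) = b i"
proof -
  obtain v where v: "\<exists>j<Suc r. v j \<noteq> 0" "\<forall>i<r. (\<Sum>j<Suc r. (if j < r then M i j else - b i) * v j) = 0"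
    using homogeneous_solution[of r "Suc r" "\<lambda>i j. if j < r then M i j else - b i"] by auto
  have eq: "(\<Sum>j<r. M i j * v j) = b i * v r" if "i < r" for i
    using v(2) that by simp
  have "v r \<noteq> 0"
  proof
    assume "v r = 0"
    then have "\<exists>j<r. v j \<noteq> 0" "\<forall>i<r. (\<Sum>j<r. M i j * v j) = 0" using v(1) eq by (auto simp: less_Suc_eq)
    then show False using assms det_sq_eq_0_iff by blast
  qed
  then have "(\<Sum>j<r. M i j * (v j / v r)) = b i" if "i < r" for i
    using eq[OF that] by (simp flip: sum_divide_distrib)
  then show ?thesis by (intro exI[of _ "\<lambda>j. v j / v r"]) auto
qed

definition nonzero_minor :: "nat \<Rightarrow> nat \<Rightarrow> (nat \<Rightarrow> nat \<Rightarrow> complex) \<Rightarrow> nat \<Rightarrow> bool" where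
  "nonzero_minor nr nc M s \<longleftrightarrow> (\<exists>\<rho> \<kappa>.
      inj_on \<rho> {..<s} \<and> \<rho> ` {..<s} \<subseteq> {..<nr} \<and>
      inj_on \<kappa> {..<s} \<and> \<kappa> ` {..<s} \<subseteq> {..<nc} \<and>
      det_sq s (\<lambda>i j. M (\<rho> i) (\<kappa> j)) \<noteq> 0)"

lemma nonzero_minor_le: "nonzero_minor nr nc M s \<Longrightarrow> s \<le> nc"
  unfolding nonzero_minor_def by (metis card_image card_lessThan card_mono finite_lessThan)

lemma nonzero_minor_0: "nonzero_minor nr nc M 0"
  unfolding nonzero_minor_def by (auto simp: det_sq_def)

lemma nonzero_minor_mat_rank: "nonzero_minor nr nc M (mat_rank nr nc M)"
proof -
  have "nonzero_minor nr nc M (GREATEST s. nonzero_minor nr nc M s)"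
    by (rule GreatestI_nat[where P = "nonzero_minor nr nc M" and k = 0 and b = nc, OF nonzero_minor_0]) (rule nonzero_minor_le)
  then show ?thesis unfolding mat_rank_def nonzero_minor_def .
qed

lemma mat_rank_eqI:
  "nonzero_minor nr nc M s \<Longrightarrow> (\<And>t. nonzero_minor nr nc M t \<Longrightarrow> t \<le> s) \<Longrightarrow> mat_rank nr nc M = s"
  unfolding mat_rank_def nonzero_minor_def[symmetric] by (rule Greatest_equality)

text \<open>A maximal nonzero minor spans all rows of \<open>M\<close>. If \<open>s + d < n\<close>,
  its \<open>s\<close> rows and the \<open>d\<close> rows of \<open>N\<close> have a common nonzero
  kernel vector, which is then killed by all of \<open>M\<close> and \<open>N\<close>.\<close>

lemma large_minor:
  fixes M N :: "nat \<Rightarrow> nat \<Rightarrow> complex"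
  assumes inj: "\<And>v. (\<And>i. i < nr \<Longrightarrow> (\<Sum>j<n. M i j * v j) = 0) \<Longrightarrow> (\<And>i. i < d \<Longrightarrow> (\<Sum>j<n. N i j * v j) = 0)
      \<Longrightarrow> (\<And>j. j < n \<Longrightarrow> v j = 0)"
  shows "\<exists>s. n \<le> s + d \<and> nonzero_minor nr n M s"
proof -
  define s where "s = mat_rank nr n M"
  have max: "t \<le> s" if "nonzero_minor nr n M t" for t
  proof -
    have "t \<le> (GREATEST s. nonzero_minor nr n M s)"
      by (rule Greatest_le_nat[where P = "nonzero_minor nr n M" and b = n, OF that]) (rule nonzero_minor_le)
    then show ?thesis unfolding s_def mat_rank_def nonzero_minor_def .
  qed
  have "nonzero_minor nr n M s" unfolding s_def by (rule nonzero_minor_mat_rank)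
  then obtain \<rho> \<kappa> where rk: "inj_on \<rho> {..<s}" "\<rho> ` {..<s} \<subseteq> {..<nr}" "inj_on \<kappa> {..<s}" "\<kappa> ` {..<s} \<subseteq> {..<n}"
    and nz: "det_sq s (\<lambda>i j. M (\<rho> i) (\<kappa> j)) \<noteq> 0" unfolding nonzero_minor_def by blast
  have "n \<le> s + d"
  proof (rule ccontr)
    assume "\<not> n \<le> s + d"
    then obtain v where v: "\<exists>j<n. v j \<noteq> 0"
      "\<And>i. i < s + d \<Longrightarrow> (\<Sum>j<n. (if i < s then M (\<rho> i) j else N (i - s) j) * v j) = 0"
      using homogeneous_solution[of "s + d" n "\<lambda>i j. if i < s then M (\<rho> i) j else N (i - s) j"] by auto
    have vr: "(\<Sum>j<n. M (\<rho> i) j * v j) = 0" if "i < s" for i using v(2)[of i] that by simp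
    have vN: "(\<Sum>j<n. N i j * v j) = 0" if "i < d" for i using v(2)[of "i + s"] that by simp
    have "(\<Sum>j<n. M i j * v j) = 0" if i: "i < nr" for i
    proof (cases "i \<in> \<rho> ` {..<s}")
      case True
      then show ?thesis using vr by auto
    next
      case False
      \<comment> \<open>Coefficients that express row \<open>i\<close> by the rows of the minor, so
        far only on the columns of the minor; bordering with any other column shows that they are
        correct there as well.\<close>
      obtain c where c: "\<And>u. u < s \<Longrightarrow> (\<Sum>t<s. M (\<rho> t) (\<kappa> u) * c t) = M i (\<kappa> u)"
        using inhomogeneous_solution[of s "\<lambda>u t. M (\<rho> t) (\<kappa> u)" "\<lambda>u. M i (\<kappa> u)"] nz det_sq_transpose[of s "\<lambda>i j. M (\<rho> i) (\<kappa> j)"]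
        by auto
      have "M i j = (\<Sum>t<s. M (\<rho> t) j * c t)" if j: "j < n" for j
      proof (cases "j \<in> \<kappa> ` {..<s}")
        case True
        then show ?thesis using c by auto
      next
        case jn: False
        let ?r = "\<rho>(s := i)" and ?k = "\<kappa>(s := j)"
        have "\<not> nonzero_minor nr n M (Suc s)" using max by force
        moreover have "inj_on ?r {..<Suc s}" "?r ` {..<Suc s} \<subseteq> {..<nr}" "inj_on ?k {..<Suc s}" "?k ` {..<Suc s} \<subseteq> {..<n}"
          using rk i j jn False by (auto simp: lessThan_Suc inj_on_def fun_upd_def)
        \<comment> \<open>The bordered minor vanishes by maximality. Its left kernel vector
          \<open>u\<close> is nonzero at the new row and otherwise proportional to \<open>c\<close>,
          because the minor itself has trivial left kernel.\<close>
        ultimately have "det_sq (Suc s) (\<lambda>a b. M (?r a) (?k b)) = 0" unfolding nonzero_minor_def by blast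
        then obtain u where u: "\<exists>t<Suc s. u t \<noteq> 0" "\<And>w. w < Suc s \<Longrightarrow> (\<Sum>t<Suc s. u t * M (?r t) (?k w)) = 0"
          unfolding det_sq_eq_0_iff_left by auto
        have u1: "(\<Sum>t<s. u t * M (\<rho> t) (\<kappa> w)) + u s * M i (\<kappa> w) = 0" if "w < s" for w
          using u(2)[of w] that by simp
        have u2: "(\<Sum>t<s. u t * M (\<rho> t) j) + u s * M i j = 0" using u(2)[of s] by simp
        have "(\<Sum>t<s. (u t + u s * c t) * M (\<rho> t) (\<kappa> w)) = 0" if "w < s" for w
        proof -
          have "(\<Sum>t<s. (u t + u s * c t) * M (\<rho> t) (\<kappa> w))
            = (\<Sum>t<s. u t * M (\<rho> t) (\<kappa> w)) + u s * (\<Sum>t<s. M (\<rho> t) (\<kappa> w) * c t)"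
            unfolding sum_distrib_left sum.distrib[symmetric] by (intro sum.cong refl) (simp add: algebra_simps)
          then show ?thesis using u1[OF that] c[OF that] by simp
        qed
        note left_null = this
        have uc: "u t = - u s * c t" if "t < s" for t
        proof (rule ccontr)
          assume "u t \<noteq> - u s * c t"
          then have "u t + u s * c t \<noteq> 0" by (simp add: eq_neg_iff_add_eq_0)
          then have "det_sq s (\<lambda>i j. M (\<rho> i) (\<kappa> j)) = 0"
            unfolding det_sq_eq_0_iff_left using that left_null
            by (intro exI[of _ "\<lambda>t. u t + u s * c t"] conjI exI[of _ t]) auto
          with nz show False by contradiction
        qed
        have us: "u s \<noteq> 0" using u(1) uc by (auto simp: less_Suc_eq)
        have "u s * M i j = u s * (\<Sum>t<s. M (\<rho> t) j * c t)"
        proof -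
          have "(\<Sum>t<s. u t * M (\<rho> t) j) = - (u s * (\<Sum>t<s. M (\<rho> t) j * c t))"
            unfolding sum_distrib_left sum_negf[symmetric] by (intro sum.cong refl) (simp add: uc algebra_simps)
          then show ?thesis using u2 by simp
        qed
        then show ?thesis using us by simp
      qed
      then have "(\<Sum>j<n. M i j * v j) = (\<Sum>j<n. \<Sum>t<s. c t * (M (\<rho> t) j * v j))"
        by (intro sum.cong) (auto simp: sum_distrib_right sum_distrib_left mult_ac)
      also have "\<dots> = (\<Sum>t<s. c t * (\<Sum>j<n. M (\<rho> t) j * v j))"
        by (subst sum.swap) (simp add: sum_distrib_left)
      also have "\<dots> = 0" using vr by simp
      finally show ?thesis .
    qed
    then show False using inj[of v] vN v(1) by blast
  qed
  with \<open>nonzero_minor nr n M s\<close> show ?thesis by blast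
qed

subsection \<open>Generic projections\<close>

text \<open>A point \<open>x\<close> consists of blocks of length \<open>n + 1\<close>; block \<open>i\<close> holds the coefficients \<open>a\<^sub>i\<close> of a
  linear form, followed by a number \<open>w\<^sub>i\<close>. The map \<open>gx\<close> overwrites each \<open>w\<^sub>i\<close> by the value of the form at \<open>y\<close>.\<close>

definition gx :: "nat \<Rightarrow> (nat \<Rightarrow> complex) \<Rightarrow> (nat \<Rightarrow> complex) \<Rightarrow> nat \<Rightarrow> complex" where
  "gx n x y v = (if v mod Suc n = n then \<Sum>j<n. x (v - n + j) * y j else x v)"

lemma gx_coeff: "j < n \<Longrightarrow> gx n x y (i * Suc n + j) = x (i * Suc n + j)"
  unfolding gx_def by (simp add: mod_mult_self3 del: mult_Suc mult_Suc_right)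

lemma gx_value: "gx n x y (i * Suc n + n) = (\<Sum>j<n. x (i * Suc n + j) * y j)"
  unfolding gx_def by (simp add: mod_mult_self3 del: mult_Suc mult_Suc_right)

lemma gx_cong:
  assumes "\<And>v. v < m \<Longrightarrow> x v = x' v" "v < m"
  shows "gx n x y v = gx n x' y v"
proof -
  have "v mod Suc n = n \<Longrightarrow> n \<le> v" by (metis mod_less_eq_dividend)
  then show ?thesis using assms by (auto simp: gx_def intro!: sum.cong)
qed

lemma gx_PF1: "f \<in> PF m \<Longrightarrow> (\<lambda>x. f (gx n x y)) \<in> PF m"
proof (erule PF_subst)
  fix i assume i: "i < m"
  have "i mod Suc n = n \<Longrightarrow> n \<le> i" by (metis mod_less_eq_dividend)
  then show "(\<lambda>x. gx n x y i) \<in> PF m"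
    unfolding gx_def using i by (intro PF_if PF_sum PF.PF_mult PF.PF_var PF.PF_const) auto
qed

lemma gx_PF2: "f \<in> PF m \<Longrightarrow> (\<lambda>y. f (gx n x y)) \<in> PF n"
  by (erule PF_subst) (unfold gx_def, intro PF_if PF_sum PF.PF_mult PF.PF_var PF.PF_const, auto)

text \<open>The vanishing ideal of the incidence set of all coefficients and values of
  \<open>q\<close> linear forms at points of \<open>V\<close>; equivalently, the kernel of the
  substitution of the forms for the values.\<close>

definition J :: "nat \<Rightarrow> (nat \<Rightarrow> complex) set \<Rightarrow> nat \<Rightarrow> ((nat \<Rightarrow> complex) \<Rightarrow> complex) set" where
  "J n V q = {f \<in> PF (q * Suc n). \<forall>x. \<forall>y\<in>V. f (gx n x y) = 0}"

definition Rel :: "nat \<Rightarrow> (nat \<Rightarrow> complex) set \<Rightarrow> nat \<Rightarrow> bool" where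
  "Rel n V q \<longleftrightarrow> (\<exists>f\<in>J n V q. \<exists>x. f x \<noteq> 0)"

text \<open>\<open>Rel n V q\<close> says that \<open>q\<close> generic linear forms are algebraically dependent on \<open>V\<close>; so \<open>vd n V\<close> is the
  transcendence degree of the function field of \<open>V\<close>.\<close>

definition vd :: "nat \<Rightarrow> (nat \<Rightarrow> complex) set \<Rightarrow> nat" where
  "vd n V = (LEAST d. Rel n V (Suc d))"

lemma J_mono: "f \<in> J n V q \<Longrightarrow> q \<le> q' \<Longrightarrow> f \<in> J n V q'"
  unfolding J_def using PF_mono mult_le_mono1 by blast

lemma J_antimono: "f \<in> J n V q \<Longrightarrow> W \<subseteq> V \<Longrightarrow> f \<in> J n W q"
  unfolding J_def by blast

lemma Rel_mono: "Rel n V q \<Longrightarrow> q \<le> q' \<Longrightarrow> Rel n V q'"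
  unfolding Rel_def using J_mono by blast

lemma not_Rel_0:
  assumes "V \<noteq> {}" shows "\<not> Rel n V 0"
proof
  assume "Rel n V 0"
  then obtain f x where f: "f \<in> PF 0" "\<forall>x. \<forall>y\<in>V. f (gx n x y) = 0" "f x \<noteq> 0"
    unfolding Rel_def J_def by auto
  obtain y where "y \<in> V" using assms by blast
  have "f x = f (gx n x y)" by (rule PF_cong[OF f(1)]) simp
  with f \<open>y \<in> V\<close> show False by simp
qed

lemma det_sq_PF: "(\<And>i j. i < r \<Longrightarrow> j < r \<Longrightarrow> M i j \<in> PF m) \<Longrightarrow> (\<lambda>x. det_sq r (\<lambda>i j. M i j x)) \<in> PF m"
  unfolding det_sq_def
  by (intro PF_sum PF.PF_mult PF.PF_const PF_prod) (use permutes_in_image in fastforce)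

text \<open>When the values come from \<open>y\<close>, the square matrix whose rows are
  coefficients followed by the value annihilates the vector \<open>y\<close> extended by
  \<open>-1\<close>, so its determinant is a relation. It is a nonzero polynomial because it does
  not vanish at the identity matrix.\<close>

lemma Rel_Suc_n: "Rel n V (Suc n)"
proof -
  define f where "f = (\<lambda>x::nat \<Rightarrow> complex. det_sq (Suc n) (\<lambda>i j. x (i * Suc n + j)))"
  have idx: "i * Suc n + j < Suc n * Suc n" if "i < Suc n" "j < Suc n" for i j
  proof -
    have "i * Suc n + j < i * Suc n + Suc n" using that by simp
    also have "\<dots> = Suc i * Suc n" by simp
    also have "\<dots> \<le> Suc n * Suc n" using that by (intro mult_le_mono1) simp
    finally show ?thesis .
  qed
  have "f \<in> PF (Suc n * Suc n)"
    unfolding f_def by (intro det_sq_PF PF.PF_var idx)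
  moreover have "f (gx n x y) = 0" for x y
    unfolding f_def det_sq_eq_0_iff
  proof (intro exI[of _ "\<lambda>j. if j < n then y j else -1"] conjI allI impI)
    show "\<exists>j<Suc n. (if j < n then y j else -1) \<noteq> 0" by (rule exI[of _ n]) simp
    fix i
    show "(\<Sum>j<Suc n. gx n x y (i * Suc n + j) * (if j < n then y j else -1)) = 0"
      by (simp add: gx_coeff gx_value del: mult_Suc_right)
  qed
  moreover have "f (\<lambda>v. if v div Suc n = v mod Suc n then 1 else 0) \<noteq> 0"
  proof
    assume "f (\<lambda>v. if v div Suc n = v mod Suc n then 1 else 0) = 0"
    then obtain v :: "nat \<Rightarrow> complex" where v: "\<exists>j<Suc n. v j \<noteq> 0"
      "\<forall>i<Suc n. (\<Sum>j<Suc n. (if (i * Suc n + j) div Suc n = (i * Suc n + j) mod Suc n then 1 else 0) * v j) = 0"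
      unfolding f_def det_sq_eq_0_iff by blast
    have "v i = 0" if "i < Suc n" for i
    proof -
      have "(\<Sum>j<Suc n. (if (i * Suc n + j) div Suc n = (i * Suc n + j) mod Suc n then 1 else 0) * v j)
        = (\<Sum>j<Suc n. if i = j then v j else 0)"
        by (intro sum.cong refl) (simp add: mod_mult_self3 div_mult_self3 del: mult_Suc_right)
      then show ?thesis using v(2) that by (simp del: sum.lessThan_Suc)
    qed
    with v(1) show False by blast
  qed
  ultimately show ?thesis unfolding Rel_def J_def by blast
qed

lemma Rel_vd: "Rel n V (Suc (vd n V))"
  unfolding vd_def by (rule LeastI[of _ n]) (rule Rel_Suc_n)

lemma vd_le: "vd n V \<le> n"
  unfolding vd_def by (rule Least_le) (rule Rel_Suc_n)

lemma Rel_iff: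
  assumes "V \<noteq> {}" shows "Rel n V q \<longleftrightarrow> vd n V < q"
proof
  assume R: "Rel n V q"
  then obtain p where "q = Suc p" using not_Rel_0[OF assms] by (cases q) auto
  with R show "vd n V < q" unfolding vd_def using Least_le[of "\<lambda>d. Rel n V (Suc d)" p] by simp
next
  assume "vd n V < q"
  then show "Rel n V q" using Rel_mono[OF Rel_vd] by simp
qed

lemma vd_mono: "W \<noteq> {} \<Longrightarrow> W \<subseteq> V \<Longrightarrow> vd n W \<le> vd n V"
proof -
  assume "W \<noteq> {}" "W \<subseteq> V"
  have "Rel n W (Suc (vd n V))"
    using Rel_vd[of n V] J_antimono \<open>W \<subseteq> V\<close> unfolding Rel_def by blast
  then show ?thesis using Rel_iff[OF \<open>W \<noteq> {}\<close>] by simp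
qed

text \<open>A relation for \<open>d + 1\<close> forms without the last value would leave a nonzero
  relation among the first \<open>d\<close> forms once the coefficients of the last form are fixed
  at those of a point where \<open>f\<close> is nonzero.\<close>

lemma not_Rel_J:
  assumes "\<not> Rel n V d" "f \<in> PF (d * Suc n + n)" "\<And>x y. y \<in> V \<Longrightarrow> f (gx n x y) = 0"
  shows "f = (\<lambda>x. 0)"
proof (rule ccontr)
  assume "f \<noteq> (\<lambda>x. 0)"
  then obtain x0 where x0: "f x0 \<noteq> 0" by (auto simp: fun_eq_iff)
  define \<sigma> where "\<sigma> = (\<lambda>(x::nat \<Rightarrow> complex) v. if v < d * Suc n then x v else x0 v)"
  have "(\<lambda>x. f (\<sigma> x)) \<in> PF (d * Suc n)"
    by (rule PF_subst[OF assms(2)]) (unfold \<sigma>_def, intro PF_if PF.PF_var PF.PF_const)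
  moreover have "f (\<sigma> (gx n x y)) = 0" if "y \<in> V" for x y
  proof -
    have "f (\<sigma> (gx n x y)) = f (gx n (\<sigma> x) y)"
    proof (rule PF_cong[OF assms(2)])
      fix v assume v: "v < d * Suc n + n"
      show "\<sigma> (gx n x y) v = gx n (\<sigma> x) y v"
      proof (cases "v < d * Suc n")
        case True
        then show ?thesis using gx_cong[of "d * Suc n" x "\<sigma> x" v n y] by (simp add: \<sigma>_def)
      next
        case False
        then obtain j where "v = d * Suc n + j" "j < n" using v by (metis add_less_cancel_left le_add_diff_inverse not_less)
        then show ?thesis using gx_coeff[of j n "\<sigma> x" y d] by (simp add: \<sigma>_def del: mult_Suc_right)
      qed
    qed
    then show ?thesis using assms(3)[OF that] by simp
  qed
  moreover have "\<sigma> x0 = x0" by (auto simp: \<sigma>_def)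
  ultimately have "Rel n V d" unfolding Rel_def J_def using x0
    by (intro bexI[of _ "\<lambda>x. f (\<sigma> x)"] exI[of _ x0]) auto
  with assms(1) show False by blast
qed

section \<open>Elimination with a relation of minimal degree\<close>

text \<open>The leading coefficient \<open>l\<close> is not invertible, so each reduction step first
  multiplies by it; \<open>M\<close> counts these steps.\<close>

lemma pseudo_division:
  assumes "l \<in> PF m" "lowdeg m e g" "f \<in> PF (Suc m)"
  shows "\<exists>M h r. h \<in> PF (Suc m) \<and> lowdeg m e r \<and> (\<forall>x. l x ^ M * f x = h x * (l x * x m ^ e + g x) + r x)"
proof -
  have "\<exists>M h r. h \<in> PF (Suc m) \<and> lowdeg m e r \<and> (\<forall>x. l x ^ M * f x = h x * (l x * x m ^ e + g x) + r x)"
    if "lowdeg m i f" for i f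
    using that
  proof (induction i arbitrary: f)
    case 0
    then have "f = (\<lambda>x. 0)" by (simp add: lowdeg_0)
    then show ?case by (intro exI[of _ 0] exI[of _ "\<lambda>x. 0"]) (auto intro: lowdeg_zero)
  next
    case (Suc k)
    show ?case
    proof (cases "Suc k \<le> e")
      case True
      then have "lowdeg m e f" using Suc.prems lowdeg_mono by blast
      then show ?thesis by (intro exI[of _ 0] exI[of _ "\<lambda>x. 0"] exI[of _ f]) auto
    next
      case False
      then have ke: "e \<le> k" by simp
      obtain c f1 where c: "c \<in> PF m" "lowdeg m k f1" "f = (\<lambda>x. c x * x m ^ k + f1 x)"
        using Suc.prems by (auto simp: lowdeg_Suc)
      define f2 where "f2 = (\<lambda>x. l x * f1 x - x m ^ (k - e) * (c x * g x))"
      have "lowdeg m (e + (k - e)) (\<lambda>x. x m ^ (k - e) * (c x * g x))"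
        using assms c by (intro lowdeg_shift lowdeg_mult)
      then have "lowdeg m k (\<lambda>x. x m ^ (k - e) * (c x * g x))" using ke by simp
      from lowdeg_diff[OF lowdeg_mult[OF c(2) assms(1)] this] have "lowdeg m k f2" unfolding f2_def .
      from Suc.IH[OF this] obtain M h r where IH: "h \<in> PF (Suc m)" "lowdeg m e r"
        "\<And>x. l x ^ M * f2 x = h x * (l x * x m ^ e + g x) + r x" by blast
      have pk: "x m ^ k = x m ^ (k - e) * x m ^ e" for x :: "nat \<Rightarrow> complex" using ke by (simp flip: power_add)
      have 1: "f2 x = l x * f x - c x * x m ^ (k - e) * (l x * x m ^ e + g x)" for x
        unfolding f2_def c(3) pk by (simp add: algebra_simps)
      have "l x ^ Suc M * f x = (h x + l x ^ M * (c x * x m ^ (k - e))) * (l x * x m ^ e + g x) + r x" for x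
        using IH(3)[of x] unfolding 1 by (simp add: algebra_simps)
      moreover have "(\<lambda>x. h x + l x ^ M * (c x * x m ^ (k - e))) \<in> PF (Suc m)"
        using PF_mono[OF assms(1), of "Suc m"] PF_mono[OF c(1), of "Suc m"] IH(1)
        by (intro PF.PF_add PF.PF_mult PF_power PF.PF_var) auto
      ultimately show ?thesis using IH(2) by blast
    qed
  qed
  then show ?thesis using PF_lowdeg[OF assms(3)] by blast
qed

lemma pd_last:
  assumes "\<And>k. c k \<in> PF m"
  shows "pd m (\<lambda>x. \<Sum>k\<le>D. c k x * x m ^ k) = (\<lambda>x. \<Sum>k<D. (of_nat (Suc k) * c (Suc k) x) * x m ^ k)"
proof (rule ext, rule pd_eqI)
  fix x
  have c: "c k (x(m := t)) = c k x" for k t by (rule PF_cong[OF assms]) auto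
  have "((\<lambda>t. \<Sum>k\<le>D. c k x * t ^ k) has_field_derivative (\<Sum>k\<le>D. c k x * (of_nat k * x m ^ (k - 1)))) (at (x m))"
    by (auto intro!: derivative_eq_intros sum.cong simp: mult_ac)
  also have "(\<Sum>k\<le>D. c k x * (of_nat k * x m ^ (k - 1))) = (\<Sum>k<D. (of_nat (Suc k) * c (Suc k) x) * x m ^ k)"
    unfolding lessThan_Suc_atMost[symmetric] sum.lessThan_Suc_shift by (simp add: mult_ac)
  finally show "((\<lambda>t. \<Sum>k\<le>D. c k (x(m := t)) * (x(m := t)) m ^ k) has_field_derivative
      (\<Sum>k<D. (of_nat (Suc k) * c (Suc k) x) * x m ^ k)) (at (x m))"
    by (simp add: c)
qed

text \<open>Irreducible closed sets in the language of functions: the vanishing ideal is prime and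
  \<open>V\<close> is its zero set. \<open>irreducible_variety_irr\<close> and
  \<open>irr_irreducible_variety\<close> show that this is the original notion.\<close>

locale irr =
  fixes n :: nat and V :: "(nat \<Rightarrow> complex) set"
  assumes V_nonempty: "V \<noteq> {}" and V_cspace: "V \<subseteq> cspace n"
    and V_prime: "\<And>f g. f \<in> PF n \<Longrightarrow> g \<in> PF n \<Longrightarrow> (\<And>y. y \<in> V \<Longrightarrow> f y * g y = 0) \<Longrightarrow>
      (\<forall>y\<in>V. f y = 0) \<or> (\<forall>y\<in>V. g y = 0)"
    and V_closed: "\<And>y. y \<in> cspace n \<Longrightarrow> (\<And>f. f \<in> PF n \<Longrightarrow> \<forall>z\<in>V. f z = 0 \<Longrightarrow> f y = 0) \<Longrightarrow> y \<in> V"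
begin

lemma V_generic:
  assumes "f \<in> PF n" "g \<in> PF n" "y0 \<in> V" "f y0 \<noteq> 0" "y1 \<in> V" "g y1 \<noteq> 0"
  shows "\<exists>y\<in>V. f y \<noteq> 0 \<and> g y \<noteq> 0"
  using V_prime[OF assms(1,2)] assms(3-) by (metis mult_eq_0_iff)

text \<open>The product of \<open>V\<close> with an affine space is irreducible: from a point of
  nonvanishing for each factor, first a common \<open>y\<close> in \<open>V\<close> is found for the
  two fixed coefficient vectors, then common coefficients for this \<open>y\<close>.\<close>

lemma J_prime:
  assumes "f \<in> PF (q * Suc n)" "g \<in> PF (q * Suc n)" "(\<lambda>x. f x * g x) \<in> J n V q"
  shows "f \<in> J n V q \<or> g \<in> J n V q"
proof (rule ccontr)
  assume "\<not> ?thesis"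
  then obtain x0 y0 x1 y1 where *: "y0 \<in> V" "f (gx n x0 y0) \<noteq> 0" "y1 \<in> V" "g (gx n x1 y1) \<noteq> 0"
    using assms(1,2) by (auto simp: J_def)
  obtain y where y: "y \<in> V" "f (gx n x0 y) \<noteq> 0" "g (gx n x1 y) \<noteq> 0"
    using V_generic[OF gx_PF2[OF assms(1), of n x0] gx_PF2[OF assms(2), of n x1] *] by blast
  obtain z where "f (gx n z y) \<noteq> 0" "g (gx n z y) \<noteq> 0"
    using PF_mult_nonzero[OF gx_PF1[OF assms(1), of n y] gx_PF1[OF assms(2), of n y] y(2,3)] by blast
  then show False using assms(3) y(1) by (auto simp: J_def)
qed

lemma J_add: "f \<in> J n V q \<Longrightarrow> g \<in> J n V q \<Longrightarrow> (\<lambda>x. f x + g x) \<in> J n V q"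
  by (auto simp: J_def)

lemma J_mult: "h \<in> PF (q * Suc n) \<Longrightarrow> f \<in> J n V q \<Longrightarrow> (\<lambda>x. h x * f x) \<in> J n V q"
  by (auto simp: J_def)

lemma J_diff: "f \<in> J n V q \<Longrightarrow> g \<in> J n V q \<Longrightarrow> (\<lambda>x. f x - g x) \<in> J n V q"
  by (auto simp: J_def)

end

text \<open>\<open>F\<close> is a relation between \<open>d + 1\<close> generic linear forms whose degree \<open>D\<close> in the last value \<open>w\<^sub>d\<close>, the variable
  number \<open>m\<close>, is minimal; \<open>c D\<close> is its leading coefficient.\<close>

locale gen = irr +
  fixes d m :: nat and F :: "(nat \<Rightarrow> complex) \<Rightarrow> complex" and c :: "nat \<Rightarrow> (nat \<Rightarrow> complex) \<Rightarrow> complex" and D :: nat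
  assumes m: "m = d * Suc n + n"
    and c_PF: "\<And>k. c k \<in> PF m" and F_eq: "F = (\<lambda>x. \<Sum>k\<le>D. c k x * x m ^ k)"
    and F_J: "F \<in> J n V (Suc d)" and D_pos: "D > 0" and lead_nz: "\<exists>x. c D x \<noteq> 0"
    and min: "\<And>f. f \<in> J n V (Suc d) \<Longrightarrow> lowdeg m D f \<Longrightarrow> f = (\<lambda>x. 0)"

lemma (in irr) ex_gen: "\<exists>F c D. gen n V (vd n V) (vd n V * Suc n + n) F c D"
proof -
  define d where "d = vd n V"
  define m where "m = d * Suc n + n"
  have Sm: "Suc d * Suc n = Suc m" by (simp add: m_def)
  have nR: "\<not> Rel n V d" using Rel_iff[OF V_nonempty] by (simp add: d_def)
  obtain f0 x0 where f0: "f0 \<in> J n V (Suc d)" "f0 x0 \<noteq> 0" using Rel_vd[of n V] unfolding Rel_def d_def by blast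
  then have "f0 \<in> PF (Suc m)" using Sm by (simp add: J_def del: mult_Suc)
  then obtain i0 where "lowdeg m i0 f0" using PF_lowdeg by blast
  then have "lowdeg m (Suc i0) f0" using lowdeg_mono by simp
  \<comment> \<open>Minimality refers to the degree in the last value only; \<open>Suc e\<close>
    turns the strict bound of \<open>lowdeg\<close> into degree at most \<open>e\<close>.\<close>
  define P where "P = (\<lambda>e. \<exists>f\<in>J n V (Suc d). lowdeg m (Suc e) f \<and> f \<noteq> (\<lambda>x. 0))"
  define D where "D = (LEAST e. P e)"
  have "P i0" using f0 \<open>lowdeg m (Suc i0) f0\<close> unfolding P_def by auto
  then have "P D" unfolding D_def by (rule LeastI)
  then obtain F where F: "F \<in> J n V (Suc d)" "lowdeg m (Suc D) F" "F \<noteq> (\<lambda>x. 0)" unfolding P_def by blast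
  have min: "f = (\<lambda>x. 0)" if "f \<in> J n V (Suc d)" "lowdeg m D f" for f
  proof (cases D)
    case 0
    then show ?thesis using that by (simp add: lowdeg_0)
  next
    case (Suc e)
    then have "\<not> P e" using not_less_Least[of e P] unfolding D_def[symmetric] by simp
    then show ?thesis using that Suc unfolding P_def by blast
  qed
  obtain c where c: "\<And>k. c k \<in> PF m" "F = (\<lambda>x. \<Sum>k\<le>D. c k x * x m ^ k)"
    using F(2) unfolding lowdeg_def lessThan_Suc_atMost by blast
  \<comment> \<open>Degree 0 would be a relation without the last value, excluded by the
    independence of \<open>d\<close> generic forms.\<close>
  have "D > 0"
  proof (rule ccontr)
    assume "\<not> D > 0"
    then have "F = c 0" using c(2) by simp
    then have "F \<in> PF m" using c(1) by simp
    then have "F = (\<lambda>x. 0)" using not_Rel_J[OF nR, of F] F(1) unfolding m_def J_def by blast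
    then show False using F(3) by blast
  qed
  moreover have "\<exists>x. c D x \<noteq> 0"
  proof (rule ccontr)
    assume "\<not> ?thesis"
    then have "F = (\<lambda>x. \<Sum>k<D. c k x * x m ^ k)" using c(2) by (simp flip: lessThan_Suc_atMost)
    then have "lowdeg m D F" unfolding lowdeg_def using c(1) by blast
    then show False using min F by blast
  qed
  ultimately have "gen n V d m F c D"
    by unfold_locales (use m_def c F(1) min in auto)
  then show ?thesis unfolding d_def m_def by blast
qed

context gen
begin

lemma Suc_m: "Suc d * Suc n = Suc m"
  by (simp add: m)

lemma J_PF: "f \<in> J n V (Suc d) \<Longrightarrow> f \<in> PF (Suc m)"
  unfolding J_def Suc_m by blast

lemma F_PF: "F \<in> PF (Suc m)"
  using F_J by (rule J_PF)

text \<open>With \<open>Fd\<close>: the derivatives of \<open>F\<close> by the last value and by the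
  coefficients of the last form. Up to sign they are denominator and numerators of the inverse of
  the generic projection.\<close>

definition rho :: "(nat \<Rightarrow> complex) \<Rightarrow> complex" where
  "rho = pd m F"

definition Fd :: "nat \<Rightarrow> (nat \<Rightarrow> complex) \<Rightarrow> complex" where
  "Fd j = pd (d * Suc n + j) F"

lemma rho_PF: "rho \<in> PF (Suc m)" and Fd_PF: "Fd j \<in> PF (Suc m)"
  unfolding rho_def Fd_def by (intro pd_PF F_PF)+

lemma c_upd: "c k (x(m := t)) = c k x"
  by (rule PF_cong[OF c_PF]) auto

text \<open>Differentiation lowers the degree in the last value, so by minimality \<open>rho\<close>
  in the ideal would be identically zero; in characteristic 0 this contradicts the nonzero leading
  coefficient \<open>c D\<close> with \<open>D > 0\<close>.\<close>

lemma rho_not_J: "rho \<notin> J n V (Suc d)"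
proof
  assume "rho \<in> J n V (Suc d)"
  moreover have rho: "rho = (\<lambda>x. \<Sum>k<D. (of_nat (Suc k) * c (Suc k) x) * x m ^ k)"
    unfolding rho_def by (subst F_eq) (rule pd_last[OF c_PF])
  moreover have "lowdeg m D (\<lambda>x. \<Sum>k<D. (of_nat (Suc k) * c (Suc k) x) * x m ^ k)"
    unfolding lowdeg_def
    by (rule exI[of _ "\<lambda>k x. of_nat (Suc k) * c (Suc k) x"]) (intro conjI allI PF.PF_mult PF.PF_const c_PF refl)
  ultimately have z: "rho = (\<lambda>x. 0)" using min by simp
  obtain x where x: "c D x \<noteq> 0" using lead_nz by blast
  obtain E where E: "D = Suc E" using D_pos by (cases D) auto
  have "(\<Sum>k\<le>E. (of_nat (Suc k) * c (Suc k) x) * t ^ k) = 0" for t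
  proof -
    have "rho (x(m := t)) = 0" using z by simp
    then show ?thesis unfolding rho c_upd E lessThan_Suc_atMost by simp
  qed
  then have "of_nat (Suc E) * c (Suc E) x = 0"
    using polyfun_eq_0[of "\<lambda>k. of_nat (Suc k) * c (Suc k) x" E] by blast
  then show False using x E by (simp del: of_nat_Suc)
qed

lemma c_mono: "c k \<in> PF (Suc m)"
  using PF_mono[OF c_PF] by simp

lemma F_lead: "\<exists>g. lowdeg m D g \<and> F = (\<lambda>x. c D x * x m ^ D + g x)"
proof (intro exI conjI)
  show "lowdeg m D (\<lambda>x. \<Sum>k<D. c k x * x m ^ k)" unfolding lowdeg_def using c_PF by blast
  show "F = (\<lambda>x. c D x * x m ^ D + (\<Sum>k<D. c k x * x m ^ k))"
    unfolding F_eq by (simp add: add.commute flip: lessThan_Suc_atMost)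
qed

lemma divide_F:
  assumes "f \<in> PF (Suc m)"
  shows "\<exists>M h r. h \<in> PF (Suc m) \<and> lowdeg m D r \<and> (\<forall>x. c D x ^ M * f x = h x * F x + r x)"
proof -
  obtain g where "lowdeg m D g" "F = (\<lambda>x. c D x * x m ^ D + g x)" using F_lead by blast
  then show ?thesis using pseudo_division[OF c_PF[of D], of D g f] assms by simp
qed

lemma J_mult': "h \<in> PF (Suc m) \<Longrightarrow> f \<in> J n V (Suc d) \<Longrightarrow> (\<lambda>x. h x * f x) \<in> J n V (Suc d)"
  using J_mult[of h "Suc d" f] Suc_m by simp

lemma J_prime': "f \<in> PF (Suc m) \<Longrightarrow> g \<in> PF (Suc m) \<Longrightarrow> (\<lambda>x. f x * g x) \<in> J n V (Suc d) \<Longrightarrow>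
    f \<in> J n V (Suc d) \<or> g \<in> J n V (Suc d)"
  using J_prime[of f "Suc d" g] unfolding Suc_m .

text \<open>The remainder of the pseudo-division by \<open>F\<close> is again a relation, of degree
  below \<open>D\<close>, hence zero. After inverting \<open>c D\<close> the ideal is thus generated
  by \<open>F\<close>.\<close>

lemma J_multiple:
  assumes "f \<in> J n V (Suc d)"
  shows "\<exists>M h. h \<in> PF (Suc m) \<and> (\<forall>x. c D x ^ M * f x = h x * F x)"
proof -
  obtain M h r where *: "h \<in> PF (Suc m)" "lowdeg m D r" "\<And>x. c D x ^ M * f x = h x * F x + r x"
    using divide_F[OF J_PF[OF assms]] by blast
  have r: "r = (\<lambda>x. c D x ^ M * f x - h x * F x)" using *(3) by simp
  have "(\<lambda>x. c D x ^ M * f x - h x * F x) \<in> J n V (Suc d)"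
    by (intro J_diff J_mult' PF_power c_mono assms *(1) F_J)
  then have "r = (\<lambda>x. 0)" using min[of r] *(2) r by simp
  then show ?thesis using * by auto
qed

text \<open>Modulo the prime ideal the last value is algebraic over the other \<open>m\<close>
  variables, so a nonzero ideal of the quotient contains a nonzero polynomial in these variables
  alone. It is found as an element \<open>g\<close> of least degree in the last value among those
  outside \<open>J\<close> that are multiples of \<open>f\<close> modulo \<open>J\<close>.\<close>

lemma eliminate:
  assumes "f \<in> PF (Suc m)" "f \<notin> J n V (Suc d)"
  shows "\<exists>b a. b \<in> PF m \<and> (\<exists>x. b x \<noteq> 0) \<and> a \<in> PF (Suc m) \<and> (\<lambda>x. b x - a x * f x) \<in> J n V (Suc d)"
proof -
  let ?J = "J n V (Suc d)"
  define P where "P = (\<lambda>e. \<exists>g a. a \<in> PF (Suc m) \<and> g \<notin> ?J \<and> lowdeg m (Suc e) g \<and> (\<lambda>x. g x - a x * f x) \<in> ?J)"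
  have step: "P (E - 1)" if "lowdeg m E r" "r \<notin> ?J" "a \<in> PF (Suc m)" "(\<lambda>x. r x - a x * f x) \<in> ?J" for E r a
  proof -
    have "lowdeg m (Suc (E - 1)) r" using that(1) by (rule lowdeg_mono) simp
    then show ?thesis unfolding P_def using that by blast
  qed
  have z: "(\<lambda>x. 0) \<in> ?J" by (simp add: J_def PF.PF_const)
  \<comment> \<open>The remainder of \<open>f\<close> modulo \<open>F\<close> is a candidate of
    degree less than \<open>D\<close>, so the least degree is smaller than that of
    \<open>F\<close>.\<close>
  have PD: "P (D - 1)"
  proof -
    obtain M h r where *: "h \<in> PF (Suc m)" "lowdeg m D r" "\<And>x. c D x ^ M * f x = h x * F x + r x"
      using divide_F[OF assms(1)] by blast
    have rJ: "r \<notin> ?J"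
    proof
      assume "r \<in> ?J"
      have "(\<lambda>x. h x * F x + r x) \<in> ?J" by (intro J_add J_mult' *(1) F_J \<open>r \<in> ?J\<close>)
      then have "(\<lambda>x. c D x ^ M * f x) \<in> ?J" unfolding *(3) .
      then have "(\<lambda>x. c D x ^ M) \<in> ?J" using J_prime'[OF PF_power[OF c_mono] assms(1)] assms(2) by blast
      then have "(\<lambda>x. c D x ^ M) = (\<lambda>x. 0)"
        by (rule min) (rule lowdeg_mono[of m "Suc 0"], unfold lowdeg_Suc,
          rule exI[of _ "\<lambda>x. c D x ^ M"], rule exI[of _ "\<lambda>x. 0"], use PF_power[OF c_PF] D_pos in \<open>auto simp: lowdeg_0\<close>)
      then show False using lead_nz by (metis power_not_zero)
    qed
    have "(\<lambda>x. r x - c D x ^ M * f x) = (\<lambda>x. (-h x) * F x)" using *(3) by (simp add: algebra_simps)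
    moreover have "(\<lambda>x. (-h x) * F x) \<in> ?J" by (intro J_mult' PF_uminus *(1) F_J)
    ultimately have "(\<lambda>x. r x - c D x ^ M * f x) \<in> ?J" by simp
    from step[OF *(2) rJ PF_power[OF c_mono] this] show ?thesis .
  qed
  define E where "E = (LEAST e. P e)"
  have "P E" unfolding E_def using PD by (rule LeastI)
  have EP: "E \<le> e" if "P e" for e unfolding E_def using that by (rule Least_le)
  obtain g a where ga: "a \<in> PF (Suc m)" "g \<notin> ?J" "lowdeg m (Suc E) g" "(\<lambda>x. g x - a x * f x) \<in> ?J"
    using \<open>P E\<close> unfolding P_def by blast
  obtain lg g' where g: "lg \<in> PF m" "lowdeg m E g'" "g = (\<lambda>x. lg x * x m ^ E + g' x)"
    using ga(3) by (auto simp: lowdeg_Suc)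
  have gP: "g \<in> PF (Suc m)" using ga(3) by (rule lowdeg_PF)
  have "E = 0"
  proof (rule ccontr)
    assume "E \<noteq> 0"
    \<comment> \<open>The remainder of \<open>F\<close> modulo \<open>g\<close> is again a multiple
      of \<open>f\<close> modulo \<open>J\<close>, of smaller degree than \<open>g\<close>; so it
      lies in \<open>J\<close>, and by minimality of \<open>D\<close> it is zero.\<close>
    obtain M Q R where QR: "Q \<in> PF (Suc m)" "lowdeg m E R" "\<And>x. lg x ^ M * F x = Q x * g x + R x"
      using pseudo_division[OF g(1,2) F_PF] unfolding g(3) by blast
    have lgP: "(\<lambda>x. lg x ^ M) \<in> PF (Suc m)" by (intro PF_power PF_mono[OF g(1)]) simp
    have "(\<lambda>x. R x - (- Q x * a x) * f x) = (\<lambda>x. lg x ^ M * F x - Q x * (g x - a x * f x))"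
      using QR(3) by (simp add: algebra_simps)
    moreover have "(\<lambda>x. lg x ^ M * F x - Q x * (g x - a x * f x)) \<in> ?J"
      by (intro J_diff J_mult' lgP F_J QR(1) ga(4))
    ultimately have RJ': "(\<lambda>x. R x - (- Q x * a x) * f x) \<in> ?J" by simp
    have RJ: "R \<in> ?J"
    proof (rule ccontr)
      assume "R \<notin> ?J"
      from step[OF QR(2) this PF.PF_mult[OF PF_uminus[OF QR(1)] ga(1)] RJ'] have "P (E - 1)" .
      then show False using EP \<open>E \<noteq> 0\<close> by fastforce
    qed
    have "E \<le> D - 1" by (rule EP[OF PD])
    then have "R = (\<lambda>x. 0)" using min[OF RJ lowdeg_mono[OF QR(2)]] by simp
    then have Qg: "(\<lambda>x. lg x ^ M * F x) = (\<lambda>x. Q x * g x)" using QR(3) by simp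
    have "(\<lambda>x. Q x * g x) \<in> ?J" unfolding Qg[symmetric] by (intro J_mult' lgP F_J)
    \<comment> \<open>\<open>J\<close> is prime and \<open>g\<close> lies outside, so the quotient
      \<open>Q\<close> is in \<open>J\<close> and is a multiple of \<open>F\<close> up to a power of
      \<open>c D\<close>. Cancelling \<open>F\<close> leaves an equation between
      \<open>lg ^ M * c D ^ N\<close> and a multiple of \<open>g\<close>, which fails at a root
      \<open>t\<close> of \<open>g\<close> in the last variable.\<close>
    then have "Q \<in> ?J" using J_prime'[OF QR(1) gP] ga(2) by blast
    then obtain N h where h: "h \<in> PF (Suc m)" "\<And>x. c D x ^ N * Q x = h x * F x" using J_multiple by blast
    have lg_nz: "\<exists>x. lg x \<noteq> 0"
    proof (rule ccontr)
      assume "\<not> ?thesis"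
      then have "g = g'" using g(3) by simp
      then have "lowdeg m E g" using g(2) by simp
      from step[OF this ga(2,1,4)] have "P (E - 1)" .
      then show False using EP \<open>E \<noteq> 0\<close> by fastforce
    qed
    obtain x1 where "lg x1 \<noteq> 0" using lg_nz by blast
    obtain x0 where "c D x0 \<noteq> 0" using lead_nz by blast
    obtain x where x: "lg x \<noteq> 0" "c D x \<noteq> 0"
      using PF_mult_nonzero[OF g(1) c_PF \<open>lg x1 \<noteq> 0\<close> \<open>c D x0 \<noteq> 0\<close>] by blast
    obtain e where e: "\<And>k. e k \<in> PF m" "g' = (\<lambda>x. \<Sum>k<E. e k x * x m ^ k)" using g(2) unfolding lowdeg_def by blast
    have lgu: "lg (x(m := t)) = lg x" for t by (rule PF_cong[OF g(1)]) auto
    have eu: "e k (x(m := t)) = e k x" for k t by (rule PF_cong[OF e(1)]) auto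
    define e' where "e' = (\<lambda>k. if k = E then lg x else e k x)"
    obtain t where t: "(\<Sum>k\<le>E. e' k * t ^ k) = 0"
      using univ_root[of e' E] x(1) \<open>E \<noteq> 0\<close> by (auto simp: e'_def)
    have gt: "g (x(m := t)) = 0"
      using t unfolding g(3) e(2) lessThan_Suc_atMost[symmetric] by (simp add: lgu eu e'_def add.commute)
    have Ft: "F (x(m := t)) = 0"
    proof -
      have "lg (x(m := t)) ^ M * F (x(m := t)) = Q (x(m := t)) * g (x(m := t))" using fun_cong[OF Qg] by blast
      then show ?thesis using gt x(1) by (simp add: lgu)
    qed
    have eq: "F y * (lg y ^ M * c D y ^ N - h y * g y) = 0" for y
    proof -
      have "F y * (h y * g y) = c D y ^ N * (Q y * g y)" using h(2)[of y] by (metis mult.assoc mult.commute)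
      also have "\<dots> = c D y ^ N * (lg y ^ M * F y)" using fun_cong[OF Qg, of y] by simp
      finally have 1: "F y * (h y * g y) = c D y ^ N * (lg y ^ M * F y)" .
      have 2: "F y * (lg y ^ M * c D y ^ N) = c D y ^ N * (lg y ^ M * F y)" by (simp only: mult_ac)
      show ?thesis by (simp only: right_diff_distrib 1 2 diff_self)
    qed
    have "(\<lambda>y. lg y ^ M * c D y ^ N - h y * g y) = (\<lambda>y. 0)"
    proof (rule ccontr)
      assume "\<not> ?thesis"
      then obtain y1 where y1: "lg y1 ^ M * c D y1 ^ N - h y1 * g y1 \<noteq> 0" by (auto simp: fun_eq_iff)
      obtain y0 where y0: "F y0 \<noteq> 0"
      proof (rule ccontr)
        assume "\<not> thesis"
        then have "\<And>y. F y = 0" using that by blast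
        then have "(\<Sum>k\<le>D. c k x * t ^ k) = 0" for t
          using fun_cong[OF F_eq, of "x(m := t)"] by (simp add: c_upd)
        then have "c D x = 0" using polyfun_eq_0[of "\<lambda>k. c k x" D] by blast
        with x(2) show False by blast
      qed
      have "(\<lambda>y. lg y ^ M * c D y ^ N - h y * g y) \<in> PF (Suc m)"
        by (intro PF_diff PF.PF_mult lgP PF_power c_mono h(1) gP)
      from PF_mult_nonzero[OF F_PF this y0 y1] eq show False by auto
    qed
    from fun_cong[OF this, of "x(m := t)"] gt x show False by (simp add: lgu c_upd)
  qed
  then have "g = lg" using g(2,3) by (simp add: lowdeg_0)
  have "\<exists>x. lg x \<noteq> 0"
  proof (rule ccontr)
    assume "\<not> ?thesis"
    then have "g = (\<lambda>x. 0)" using \<open>g = lg\<close> by auto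
    then show False using ga(2) z by simp
  qed
  then show ?thesis using g(1) ga \<open>g = lg\<close> by blast
qed

end

section \<open>Block coordinates and the inverse of the generic projection\<close>

lemma block_cases:
  fixes v :: nat
  assumes "v < Suc d * Suc n"
  obtains i j where "i \<le> d" "j < n" "v = i * Suc n + j" | i where "i \<le> d" "v = i * Suc n + n"
proof -
  have 1: "v = (v div Suc n) * Suc n + v mod Suc n" by (rule div_mult_mod_eq[symmetric])
  have 2: "v mod Suc n < Suc n" by simp
  have 3: "v div Suc n \<le> d" using assms less_mult_imp_div_less less_Suc_eq_le by blast
  show ?thesis
  proof (cases "v mod Suc n = n")
    case True
    then show ?thesis using 1 3 that(2) by metis
  next
    case False
    then have "v mod Suc n < n" using 2 by linarith
    then show ?thesis using 1 3 that(1) by metis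
  qed
qed

lemma block_neq: "j < n \<Longrightarrow> i' * Suc n + n \<noteq> i * Suc n + j"
proof
  assume "j < n" "i' * Suc n + n = i * Suc n + j"
  then have "(i' * Suc n + n) mod Suc n = (i * Suc n + j) mod Suc n" by presburger
  with \<open>j < n\<close> show False by (simp add: mod_mult_self3 del: mult_Suc_right)
qed

lemma block_inj: "j < n \<Longrightarrow> j' < n \<Longrightarrow> i * Suc n + j = i' * Suc n + j' \<Longrightarrow> i = i' \<and> j = j'"
proof -
  assume a: "j < n" "j' < n" "i * Suc n + j = i' * Suc n + j'"
  then have "(i * Suc n + j) mod Suc n = (i' * Suc n + j') mod Suc n" "(i * Suc n + j) div Suc n = (i' * Suc n + j') div Suc n"
    by presburger+
  moreover have "(i * Suc n + j) mod Suc n = j" "(i' * Suc n + j') mod Suc n = j'"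
    using a(1,2) by (simp_all add: mod_mult_self3 del: mult_Suc_right)
  moreover have "(i * Suc n + j) div Suc n = i" "(i' * Suc n + j') div Suc n = i'"
    using a(1,2) by (simp_all add: div_mult_self3 del: mult_Suc_right)
  ultimately show ?thesis by simp
qed

lemma sum_two_points:
  fixes A B :: complex and a b N :: nat
  assumes "a < N" "b < N" "a \<noteq> b" and "\<And>v. v < N \<Longrightarrow> f v = (if v = a then A else 0) + (if v = b then B else 0)"
  shows "(\<Sum>v<N. f v * g v) = A * g a + B * g b"
proof -
  have "(\<Sum>v<N. f v * g v) = (\<Sum>v<N. (if v = a then A * g a else 0) + (if v = b then B * g b else 0))"
    by (rule sum.cong) (use assms(3) in \<open>auto simp: assms(4)\<close>)
  then show ?thesis using assms(1-3) by (simp add: sum.distrib)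
qed

context gen
begin

lemma block_less:
  assumes "i \<le> d" "j \<le> n" shows "i * Suc n + j < Suc m"
proof -
  have "i * Suc n \<le> d * Suc n" using assms by (intro mult_le_mono1)
  then show ?thesis using assms by (simp add: m)
qed

lemma block_less_m:
  assumes "i < d" "j \<le> n" shows "i * Suc n + j < m"
proof -
  have "i * Suc n + Suc n \<le> d * Suc n" using assms mult_le_mono1[of "Suc i" d "Suc n"] by simp
  then show ?thesis using assms by (simp add: m)
qed

text \<open>When coefficient \<open>j\<close> of the last form moves, the values at \<open>y\<close>
  follow: only that coefficient and the last value change, the latter with speed \<open>y j\<close>.
  \<open>F\<close> stays zero along this line, so its derivative vanishes.\<close>

lemma gradient_relation:
  assumes "y \<in> V" "j < n"
  shows "Fd j (gx n x y) = - y j * rho (gx n x y)"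
proof -
  let ?v = "d * Suc n + j"
  define e where "e = (\<lambda>v. if v = ?v then 1 else 0 :: complex)"
  define z where "z = (\<lambda>t v. gx n x y v + t * gx n e y v)"
  have z: "z t = gx n (\<lambda>v. x v + t * e v) y" for t
    unfolding z_def gx_def by (auto simp: fun_eq_iff sum.distrib distrib_right sum_distrib_left mult.assoc)
  have z0: "z 0 = gx n x y" by (simp add: z_def)
  have ge: "gx n e y v = (if v = ?v then 1 else 0) + (if v = m then y j else 0)" if "v < Suc m" for v
    using that unfolding Suc_m[symmetric]
  proof (cases rule: block_cases)
    case (1 i j')
    then show ?thesis using block_neq[of j' n d i] assms(2)
      by (simp add: gx_coeff e_def m del: mult_Suc_right)
  next
    case (2 i)
    have "gx n e y v = (\<Sum>j'<n. if i = d \<and> j' = j then y j' else 0)"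
      unfolding 2 gx_value
    proof (rule sum.cong[OF refl])
      fix j' assume "j' \<in> {..<n}"
      then have "i * Suc n + j' = d * Suc n + j \<longleftrightarrow> i = d \<and> j' = j" using block_inj[of j' n j i d] assms(2) by auto
      then show "e (i * Suc n + j') * y j' = (if i = d \<and> j' = j then y j' else 0)"
        unfolding e_def by (simp del: mult_Suc_right)
    qed
    also have "\<dots> = (if i = d then y j else 0)" using assms(2) by (cases "i = d") auto
    also have "\<dots> = (if v = ?v then 1 else 0) + (if v = m then y j else 0)"
    proof -
      have "v \<noteq> ?v" unfolding 2(2) by (rule block_neq[OF assms(2)])
      moreover have "v = m \<longleftrightarrow> i = d" unfolding 2 m by (simp del: mult_Suc_right)
      ultimately show ?thesis by simp
    qed
    finally show ?thesis .
  qed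
  have "((\<lambda>t. F (z t)) has_field_derivative (\<Sum>v<Suc m. gx n e y v * pd v F (z 0))) (at 0)"
    by (rule PF_chain[OF F_PF]) (auto simp: z_def intro!: derivative_eq_intros)
  moreover have "F (z t) = 0" for t unfolding z using F_J assms(1) by (simp add: J_def)
  ultimately have "(\<Sum>v<Suc m. gx n e y v * pd v F (z 0)) = 0"
    using DERIV_unique[OF _ DERIV_const[of 0]] by simp
  moreover have "(\<Sum>v<Suc m. gx n e y v * pd v F (z 0)) = 1 * pd ?v F (z 0) + y j * pd m F (z 0)"
    by (rule sum_two_points[where b = m]) (use ge block_less[of d j] assms(2) m in auto)
  ultimately show ?thesis unfolding z0 rho_def Fd_def by (simp add: add_eq_0_iff)
qed

text \<open>Clears denominators after the substitution \<open>y j = - Fd j / rho\<close>. The point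
  \<open>z\<close> is arbitrary, so \<open>ft\<close> carries equations for \<open>y\<close> over to
  points \<open>z\<close> that are not known to come from \<open>V\<close>.\<close>

lemma homogenize:
  assumes "f \<in> PF n"
  shows "\<exists>E ft. ft \<in> PF (Suc m) \<and> (\<forall>z y. (\<forall>j<n. Fd j z = - y j * rho z) \<longrightarrow> ft z = rho z ^ E * f y)"
  using assms
proof (induction rule: PF.induct)
  case (PF_const a)
  show ?case by (rule exI[of _ 0], rule exI[of _ "\<lambda>x. a"]) (auto intro: PF.PF_const)
next
  case (PF_var i)
  show ?case by (rule exI[of _ 1], rule exI[of _ "\<lambda>x. - Fd i x"]) (use PF_var PF_uminus[OF Fd_PF] in auto)
next
  case (PF_add f g)
  then obtain E ft E' gt where *: "ft \<in> PF (Suc m)" "gt \<in> PF (Suc m)"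
    "\<And>z y. (\<forall>j<n. Fd j z = - y j * rho z) \<Longrightarrow> ft z = rho z ^ E * f y"
    "\<And>z y. (\<forall>j<n. Fd j z = - y j * rho z) \<Longrightarrow> gt z = rho z ^ E' * g y" by blast
  show ?case
  proof (rule exI[of _ "E + E'"], rule exI[of _ "\<lambda>z. rho z ^ E' * ft z + rho z ^ E * gt z"], intro conjI allI impI)
    show "(\<lambda>z. rho z ^ E' * ft z + rho z ^ E * gt z) \<in> PF (Suc m)"
      by (intro PF.PF_add PF.PF_mult PF_power rho_PF *(1,2))
    fix z y assume "\<forall>j<n. Fd j z = - y j * rho z"
    from *(3,4)[OF this] show "rho z ^ E' * ft z + rho z ^ E * gt z = rho z ^ (E + E') * (f y + g y)"
      by (simp add: power_add algebra_simps)
  qed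
next
  case (PF_mult f g)
  then obtain E ft E' gt where *: "ft \<in> PF (Suc m)" "gt \<in> PF (Suc m)"
    "\<And>z y. (\<forall>j<n. Fd j z = - y j * rho z) \<Longrightarrow> ft z = rho z ^ E * f y"
    "\<And>z y. (\<forall>j<n. Fd j z = - y j * rho z) \<Longrightarrow> gt z = rho z ^ E' * g y" by blast
  show ?case
  proof (rule exI[of _ "E + E'"], rule exI[of _ "\<lambda>z. ft z * gt z"], intro conjI allI impI)
    show "(\<lambda>z. ft z * gt z) \<in> PF (Suc m)" by (intro PF.PF_mult *(1,2))
    fix z y assume "\<forall>j<n. Fd j z = - y j * rho z"
    from *(3,4)[OF this] show "ft z * gt z = rho z ^ (E + E') * (f y * g y)"
      by (simp add: power_add algebra_simps)
  qed
qed

lemma homogenize_J: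
  assumes "ft \<in> PF (Suc m)" "\<And>z y. (\<forall>j<n. Fd j z = - y j * rho z) \<Longrightarrow> ft z = rho z ^ E * f y"
    "\<And>y. y \<in> V \<Longrightarrow> f y = 0"
  shows "ft \<in> J n V (Suc d)"
proof -
  have "ft (gx n x y) = 0" if "y \<in> V" for x y
  proof -
    have "ft (gx n x y) = rho (gx n x y) ^ E * f y"
      by (rule assms(2)) (use gradient_relation[OF that] in blast)
    then show ?thesis using assms(3)[OF that] by simp
  qed
  with assms(1) show ?thesis unfolding J_def Suc_m by blast
qed

text \<open>By \<open>J_multiple\<close>, off the zeros of \<open>c D\<close> the single equation
  \<open>F = 0\<close> cuts out the zero set of \<open>J\<close>.\<close>

lemma J_zero:
  assumes "f \<in> J n V (Suc d)" "F z = 0" "c D z \<noteq> 0"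
  shows "f z = 0"
proof -
  obtain M h where "c D z ^ M * f z = h z * F z" using J_multiple[OF assms(1)] by blast
  then show ?thesis using assms(2,3) by simp
qed

text \<open>The equation between value \<open>i\<close> and form \<open>i\<close> at
  \<open>y\<close>, after substituting \<open>y j = - Fd j / rho\<close> and clearing the
  denominator.\<close>

definition linrel :: "nat \<Rightarrow> (nat \<Rightarrow> complex) \<Rightarrow> complex" where
  "linrel i z = rho z * z (i * Suc n + n) + (\<Sum>j<n. z (i * Suc n + j) * Fd j z)"

lemma linrel_J: "i \<le> d \<Longrightarrow> linrel i \<in> J n V (Suc d)"
proof -
  assume i: "i \<le> d"
  have "linrel i \<in> PF (Suc m)" unfolding linrel_def
    using i by (intro PF.PF_add PF.PF_mult PF_sum rho_PF Fd_PF PF.PF_var block_less) auto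
  moreover have "linrel i (gx n x y) = 0" if "y \<in> V" for x y
    unfolding linrel_def using that
    by (simp add: gx_value gx_coeff gradient_relation sum_distrib_left sum_negf mult_ac del: mult_Suc_right)
  ultimately show ?thesis unfolding J_def Suc_m by simp
qed

text \<open>The rational inverse of the generic projection: the homogenized equations of
  \<open>V\<close> and the relations \<open>linrel\<close> lie in \<open>J\<close>, hence hold at
  \<open>z\<close> by \<open>J_zero\<close>, and division by powers of \<open>rho z\<close> gives
  the equations for \<open>y\<close>.\<close>

lemma lift_point:
  assumes "F z = 0" "c D z \<noteq> 0" "rho z \<noteq> 0"
  defines "y \<equiv> \<lambda>j. if j < n then - Fd j z / rho z else 0"
  shows "y \<in> V" and "\<And>i. i \<le> d \<Longrightarrow> z (i * Suc n + n) = (\<Sum>j<n. z (i * Suc n + j) * y j)"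
proof -
  have Fy: "\<forall>j<n. Fd j z = - y j * rho z" using assms(3) by (simp add: y_def)
  show "y \<in> V"
  proof (rule V_closed)
    show "y \<in> cspace n" by (simp add: y_def cspace_def)
    fix f assume f: "f \<in> PF n" "\<forall>z\<in>V. f z = 0"
    obtain E ft where ft: "ft \<in> PF (Suc m)" "\<And>z y. (\<forall>j<n. Fd j z = - y j * rho z) \<Longrightarrow> ft z = rho z ^ E * f y"
      using homogenize[OF f(1)] by blast
    have "ft \<in> J n V (Suc d)" by (rule homogenize_J[OF ft]) (use f in auto)
    then have "ft z = 0" using J_zero assms(1,2) by blast
    then show "f y = 0" using ft(2)[OF Fy] assms(3) by simp
  qed
  fix i assume "i \<le> d"
  then have "linrel i z = 0" using J_zero linrel_J assms(1,2) by blast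
  then have "rho z * z (i * Suc n + n) = rho z * (\<Sum>j<n. z (i * Suc n + j) * y j)"
    unfolding linrel_def using Fy
    by (simp add: sum_distrib_left sum_negf mult_ac add_eq_0_iff2 del: mult_Suc_right)
  then show "z (i * Suc n + n) = (\<Sum>j<n. z (i * Suc n + j) * y j)" using assms(3) by simp
qed

text \<open>For prescribed values of the first \<open>d\<close> forms, \<open>F = 0\<close> is
  solved for the last value by the fundamental theorem of algebra, and the zero is lifted. The
  polynomial from \<open>eliminate\<close> keeps \<open>rho\<close> nonzero at whichever root is
  taken.\<close>

lemma dominant:
  "\<exists>b. b \<in> PF m \<and> (\<exists>x. b x \<noteq> 0) \<and> (\<forall>x. b x \<noteq> 0 \<longrightarrow> (\<exists>y\<in>V. \<forall>i<d. x (i * Suc n + n) = (\<Sum>j<n. x (i * Suc n + j) * y j)))"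
proof -
  obtain b a where b: "b \<in> PF m" "\<exists>x. b x \<noteq> 0" "a \<in> PF (Suc m)" "(\<lambda>x. b x - a x * rho x) \<in> J n V (Suc d)"
    using eliminate[OF rho_PF rho_not_J] by blast
  show ?thesis
  proof (rule exI[of _ "\<lambda>x. b x * c D x"], intro conjI allI impI)
    show "(\<lambda>x. b x * c D x) \<in> PF m" by (intro PF.PF_mult b c_PF)
    show "\<exists>x. b x * c D x \<noteq> 0" using PF_mult_nonzero[OF b(1) c_PF[of D]] b(2) lead_nz by (metis mult_eq_0_iff)
    fix x assume x: "b x * c D x \<noteq> 0"
    then obtain t where t: "(\<Sum>k\<le>D. c k x * t ^ k) = 0" using univ_root[of "\<lambda>k. c k x" D] D_pos by auto
    define z where "z = x(m := t)"
    have cz: "c k z = c k x" for k unfolding z_def by (rule c_upd)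
    have bz: "b z = b x" unfolding z_def by (rule PF_cong[OF b(1)]) auto
    have Fz: "F z = 0" using t unfolding fun_cong[OF F_eq, of z] cz by (simp add: z_def)
    have "b z - a z * rho z = 0" using J_zero[OF b(4) Fz] x cz by auto
    then have rz: "rho z \<noteq> 0" using x bz by auto
    have lz: "c D z \<noteq> 0" using x cz by auto
    have eq: "z (i * Suc n + j) = x (i * Suc n + j)" if "i < d" "j \<le> n" for i j
      using block_less_m[OF that] unfolding z_def by simp
    show "\<exists>y\<in>V. \<forall>i<d. x (i * Suc n + n) = (\<Sum>j<n. x (i * Suc n + j) * y j)"
    proof (rule bexI[OF _ lift_point(1)[OF Fz lz rz]], intro allI impI)
      fix i assume "i < d"
      then show "x (i * Suc n + n) = (\<Sum>j<n. x (i * Suc n + j) * (if j < n then - Fd j z / rho z else 0))"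
        using lift_point(2)[OF Fz lz rz, of i] eq[of i] by (simp del: mult_Suc_right)
    qed
  qed
qed

end

subsection \<open>Irreducible varieties and their dimension\<close>

definition closed_set :: "nat \<Rightarrow> (nat \<Rightarrow> complex) set \<Rightarrow> bool" where
  "closed_set n S \<longleftrightarrow> S \<subseteq> cspace n \<and> (\<forall>y\<in>cspace n. (\<forall>f\<in>PF n. (\<forall>z\<in>S. f z = 0) \<longrightarrow> f y = 0) \<longrightarrow> y \<in> S)"

definition van :: "nat \<Rightarrow> (nat \<Rightarrow> complex) set \<Rightarrow> ((nat \<Rightarrow> complex) \<Rightarrow> complex) set" where
  "van n S = {f\<in>PF n. \<forall>z\<in>S. f z = 0}"

lemma pideal_van: "pideal n (van n S)"
  unfolding pideal_def van_def by auto

lemma closed_setD: "closed_set n S \<Longrightarrow> y \<in> cspace n \<Longrightarrow> y \<notin> S \<Longrightarrow> \<exists>f\<in>van n S. f y \<noteq> 0"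
  unfolding closed_set_def van_def by blast

lemma closed_set_sub: "closed_set n S \<Longrightarrow> f \<in> PF n \<Longrightarrow> closed_set n {y\<in>S. f y = 0}"
  unfolding closed_set_def
proof (intro conjI ballI impI)
  assume S: "S \<subseteq> cspace n \<and> (\<forall>y\<in>cspace n. (\<forall>f\<in>PF n. (\<forall>z\<in>S. f z = 0) \<longrightarrow> f y = 0) \<longrightarrow> y \<in> S)" and f: "f \<in> PF n"
  show "{y\<in>S. f y = 0} \<subseteq> cspace n" using S by blast
  fix y assume y: "y \<in> cspace n" "\<forall>g\<in>PF n. (\<forall>z\<in>{y\<in>S. f y = 0}. g z = 0) \<longrightarrow> g y = 0"
  then have "f y = 0" using f by blast
  moreover have "y \<in> S" using S y by blast
  ultimately show "y \<in> {y\<in>S. f y = 0}" by blast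
qed

text \<open>The vanishing ideals of a strictly decreasing chain have an ideal as union; its finitely
  many generators all vanish on some \<open>S N\<close>, so the chain cannot decrease there.\<close>

lemma wf_closed_sets: "wf {(S, T). closed_set n S \<and> closed_set n T \<and> S \<subset> T}"
proof (rule ccontr)
  assume "\<not> ?thesis"
  then obtain S where "\<forall>i. (S (Suc i), S i) \<in> {(S, T). closed_set n S \<and> closed_set n T \<and> S \<subset> T}"
    unfolding wf_iff_no_infinite_down_chain by blast
  then have S: "closed_set n (S i)" "S (Suc i) \<subset> S i" for i by auto
  have anti: "S j \<subseteq> S i" if "i \<le> j" for i j using that
  proof (induction j)
    case (Suc j)
    then show ?case using S(2)[of j] by (cases "i = Suc j") auto
  qed simp
  have mono: "van n (S i) \<subseteq> van n (S j)" if "i \<le> j" for i j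
    using anti[OF that] unfolding van_def by blast
  define U where "U = (\<Union>i. van n (S i))"
  have "pideal n U"
    unfolding pideal_def
  proof (intro conjI ballI)
    show "U \<subseteq> PF n" unfolding U_def van_def by blast
    show "(\<lambda>x. 0) \<in> U" unfolding U_def van_def by auto
    fix f assume "f \<in> U"
    then obtain i where i: "f \<in> van n (S i)" unfolding U_def by blast
    show "(\<lambda>x. h x * f x) \<in> U" if "h \<in> PF n" for h
      using i that unfolding U_def van_def by auto
    fix g assume "g \<in> U"
    then obtain j where j: "g \<in> van n (S j)" unfolding U_def by blast
    have "f \<in> van n (S (max i j))" "g \<in> van n (S (max i j))"
      using i j mono[of i "max i j"] mono[of j "max i j"] by auto
    then have "(\<lambda>x. f x + g x) \<in> van n (S (max i j))" unfolding van_def by auto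
    then show "(\<lambda>x. f x + g x) \<in> U" unfolding U_def by blast
  qed
  from hilbert_basis[OF this] obtain B where B: "finite B" "B \<subseteq> U" "U \<subseteq> pspan n B" by blast
  from B(1,2) have "\<exists>N. B \<subseteq> van n (S N)"
  proof (induction B)
    case (insert b B)
    then obtain N i where N: "B \<subseteq> van n (S N)" "b \<in> van n (S i)" unfolding U_def by auto
    then show ?case using mono[of N "max N i"] mono[of i "max N i"] by (intro exI[of _ "max N i"]) auto
  qed simp
  then obtain N where "B \<subseteq> van n (S N)" by blast
  then have UN: "U \<subseteq> van n (S N)" using B(3) pspan_subset_ideal[OF pideal_van] by blast
  obtain y where y: "y \<in> S N" "y \<notin> S (Suc N)" using S(2)[of N] by blast
  then have "y \<in> cspace n" using S(1)[of N] unfolding closed_set_def by blast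
  then obtain f where f: "f \<in> van n (S (Suc N))" "f y \<noteq> 0" using closed_setD[OF S(1)] y(2) by blast
  then have "f \<in> van n (S N)" using UN unfolding U_def by blast
  then show False using f(2) y(1) unfolding van_def by blast
qed

lemma irr_closed_set: "irr n V \<Longrightarrow> closed_set n V"
  unfolding closed_set_def using irr.V_cspace irr.V_closed by blast

lemma irrI:
  assumes "closed_set n V" "V \<noteq> {}"
    "\<And>f g. f \<in> PF n \<Longrightarrow> g \<in> PF n \<Longrightarrow> \<forall>y\<in>V. f y * g y = 0 \<Longrightarrow> (\<forall>y\<in>V. f y = 0) \<or> (\<forall>y\<in>V. g y = 0)"
  shows "irr n V"
proof
  show "V \<noteq> {}" by fact
  show "V \<subseteq> cspace n" using assms(1) unfolding closed_set_def by blast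
  show "(\<forall>y\<in>V. f y = 0) \<or> (\<forall>y\<in>V. g y = 0)"
    if "f \<in> PF n" "g \<in> PF n" "\<And>y. y \<in> V \<Longrightarrow> f y * g y = 0" for f g
    by (rule assms(3)) (use that in auto)
  show "y \<in> V" if "y \<in> cspace n" "\<And>f. f \<in> PF n \<Longrightarrow> \<forall>z\<in>V. f z = 0 \<Longrightarrow> f y = 0" for y
    using that assms(1) unfolding closed_set_def by blast
qed

text \<open>Noetherian induction: a nonempty closed set that is not irreducible is the union of two
  proper closed subsets, cut out by the two factors of a product that vanishes on it.\<close>

lemma decomposition:
  "closed_set n S \<Longrightarrow> \<exists>\<W>. finite \<W> \<and> (\<forall>W\<in>\<W>. irr n W) \<and> S = \<Union>\<W>"
proof (induction S rule: wf_induct_rule[OF wf_closed_sets[of n]])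
  case (1 S)
  consider "S = {}" | "irr n S" | "S \<noteq> {}" "\<not> irr n S" by blast
  then show ?case
  proof cases
    case 1
    then show ?thesis by (intro exI[of _ "{}"]) auto
  next
    case 2
    then show ?thesis by (intro exI[of _ "{S}"]) auto
  next
    case 3
    then obtain f g where fg: "f \<in> PF n" "g \<in> PF n" "\<forall>y\<in>S. f y * g y = 0"
      "\<not> (\<forall>y\<in>S. f y = 0)" "\<not> (\<forall>y\<in>S. g y = 0)" using irrI[OF 1(2)] by blast
    let ?A = "{y\<in>S. f y = 0}" and ?B = "{y\<in>S. g y = 0}"
    have c: "closed_set n ?A" "closed_set n ?B" by (rule closed_set_sub[OF 1(2)], fact)+
    have sub: "?A \<subset> S" "?B \<subset> S" using fg(4,5) by blast+
    obtain X where X: "finite X" "\<forall>W\<in>X. irr n W" "?A = \<Union>X" using 1(1)[of ?A] c(1) sub(1) 1(2) by blast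
    obtain Y where Y: "finite Y" "\<forall>W\<in>Y. irr n W" "?B = \<Union>Y" using 1(1)[of ?B] c(2) sub(2) 1(2) by blast
    have "S = ?A \<union> ?B" using fg(3) by auto
    then have "S = \<Union>(X \<union> Y)" unfolding X(3) Y(3) by blast
    then show ?thesis using X Y by (intro exI[of _ "X \<union> Y"]) auto
  qed
qed

lemma irreducible_variety_irr:
  assumes "irreducible_variety n V" shows "irr n V"
proof -
  obtain F where F: "\<forall>f\<in>F. poly_in n f" "V = zero_set n F"
    using assms unfolding irreducible_variety_def is_variety_def by blast
  have ne: "V \<noteq> {}" using assms unfolding irreducible_variety_def by blast
  have split: "V = W1 \<or> V = W2" if "is_variety n W1" "is_variety n W2" "V = W1 \<union> W2" for W1 W2
    using assms that unfolding irreducible_variety_def by blast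
  show ?thesis
  proof (rule irrI[OF _ ne])
    show "closed_set n V" unfolding closed_set_def
    proof (intro conjI ballI impI)
      show "V \<subseteq> cspace n" unfolding F zero_set_def by blast
      fix y assume y: "y \<in> cspace n" "\<forall>f\<in>PF n. (\<forall>z\<in>V. f z = 0) \<longrightarrow> f y = 0"
      have "eval f y = 0" if "f \<in> F" for f
      proof -
        have "eval f \<in> PF n" using F(1) that eval_PF by blast
        moreover have "\<forall>z\<in>V. eval f z = 0" using that unfolding F zero_set_def by blast
        ultimately show ?thesis using y(2) by blast
      qed
      then show "y \<in> V" using y(1) unfolding F zero_set_def by blast
    qed
    fix f g assume fg: "f \<in> PF n" "g \<in> PF n" "\<forall>y\<in>V. f y * g y = 0"
    obtain p q where p: "poly_in n p" "eval p = f" and q: "poly_in n q" "eval q = g" using PF_eval fg by metis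
    \<comment> \<open>If the product of two polynomials vanishes on \<open>V\<close>, adjoining
      either one to the equations splits \<open>V\<close> into two varieties.\<close>
    have "V = zero_set n (insert p F) \<union> zero_set n (insert q F)"
      using fg(3) unfolding F(2) zero_set_def using p q by auto
    moreover have "is_variety n (zero_set n (insert p F))" "is_variety n (zero_set n (insert q F))"
      unfolding is_variety_def using F(1) p(1) q(1) by blast+
    ultimately have "V = zero_set n (insert p F) \<or> V = zero_set n (insert q F)" using split by blast
    then show "(\<forall>y\<in>V. f y = 0) \<or> (\<forall>y\<in>V. g y = 0)"
      unfolding zero_set_def using p q by auto
  qed
qed

lemma vanish_van: "p \<in> vanish n S \<Longrightarrow> eval p \<in> van n S"
  unfolding vanish_def van_def using eval_PF by auto

lemma van_vanish: "f \<in> van n S \<Longrightarrow> \<exists>p\<in>vanish n S. eval p = f"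
  unfolding vanish_def van_def using PF_eval by fastforce

lemma closed_set_variety:
  assumes "closed_set n V" shows "V = zero_set n (vanish n V)" "is_variety n V"
proof -
  show eq: "V = zero_set n (vanish n V)"
  proof
    show "V \<subseteq> zero_set n (vanish n V)"
      using assms unfolding closed_set_def zero_set_def vanish_def by blast
    show "zero_set n (vanish n V) \<subseteq> V"
    proof
      fix y assume y: "y \<in> zero_set n (vanish n V)"
      show "y \<in> V"
      proof (rule ccontr)
        assume "y \<notin> V"
        then obtain f where f: "f \<in> van n V" "f y \<noteq> 0"
          using closed_setD[OF assms] y unfolding zero_set_def by blast
        then obtain p where "p \<in> vanish n V" "eval p = f" using van_vanish by blast
        then show False using y f(2) unfolding zero_set_def by blast
      qed
    qed
  qed
  have "\<forall>f\<in>vanish n V. poly_in n f" unfolding vanish_def by blast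
  then show "is_variety n V" unfolding is_variety_def using eq by blast
qed

lemma irr_irreducible_variety:
  assumes "irr n V" shows "irreducible_variety n V"
  unfolding irreducible_variety_def
proof (intro conjI allI impI)
  show "is_variety n V" using closed_set_variety irr_closed_set assms by blast
  show "V \<noteq> {}" using assms by (rule irr.V_nonempty)
  fix W1 W2 assume W: "is_variety n W1 \<and> is_variety n W2 \<and> V = W1 \<union> W2"
  then obtain F G where F: "\<forall>f\<in>F. poly_in n f" "W1 = zero_set n F" and G: "\<forall>f\<in>G. poly_in n f" "W2 = zero_set n G"
    unfolding is_variety_def by blast
  have cs: "V \<subseteq> cspace n" using assms by (rule irr.V_cspace)
  show "V = W1 \<or> V = W2"
  proof (rule ccontr)
    assume "\<not> ?thesis"
    then obtain y z where y: "y \<in> V" "y \<notin> W1" and z: "z \<in> V" "z \<notin> W2" using W by blast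
    then obtain f g where f: "f \<in> F" "eval f y \<noteq> 0" and g: "g \<in> G" "eval g z \<noteq> 0"
      using cs unfolding F(2) G(2) zero_set_def by blast
    have "eval f u * eval g u = 0" if "u \<in> V" for u
    proof -
      have "u \<in> W1 \<or> u \<in> W2" using that W by blast
      then show ?thesis using f(1) g(1) unfolding F(2) G(2) zero_set_def by auto
    qed
    then have "(\<forall>y\<in>V. eval f y = 0) \<or> (\<forall>y\<in>V. eval g y = 0)"
      using irr.V_prime[OF assms, of "eval f" "eval g"] eval_PF F(1) G(1) f(1) g(1) by blast
    then show False using f(2) g(2) y(1) z(1) by blast
  qed
qed

lemma zariski_closure_van: "zariski_closure q T = {y\<in>cspace q. \<forall>p\<in>van q T. p y = 0}"
proof
  show "zariski_closure q T \<subseteq> {y\<in>cspace q. \<forall>p\<in>van q T. p y = 0}"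
  proof
    fix y assume y: "y \<in> zariski_closure q T"
    have "p y = 0" if p: "p \<in> van q T" for p
    proof -
      obtain r where "r \<in> vanish q T" "eval r = p" using van_vanish[OF p] by blast
      then show ?thesis using y unfolding zariski_closure_def zero_set_def by blast
    qed
    then show "y \<in> {y\<in>cspace q. \<forall>p\<in>van q T. p y = 0}" using y unfolding zariski_closure_def zero_set_def by blast
  qed
  show "{y\<in>cspace q. \<forall>p\<in>van q T. p y = 0} \<subseteq> zariski_closure q T"
    unfolding zariski_closure_def zero_set_def using vanish_van by blast
qed

lemma subset_zariski_closure: "T \<subseteq> cspace q \<Longrightarrow> T \<subseteq> zariski_closure q T"
  unfolding zariski_closure_van van_def by blast

lemma van_zariski_closure:
  assumes "T \<subseteq> cspace q" shows "van q (zariski_closure q T) = van q T"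
proof
  show "van q (zariski_closure q T) \<subseteq> van q T"
    using subset_zariski_closure[OF assms] unfolding van_def by blast
  show "van q T \<subseteq> van q (zariski_closure q T)"
  proof
    fix p assume p: "p \<in> van q T"
    then have "p \<in> PF q" unfolding van_def by blast
    moreover have "\<forall>y\<in>zariski_closure q T. p y = 0" using p unfolding zariski_closure_van by blast
    ultimately show "p \<in> van q (zariski_closure q T)" unfolding van_def by blast
  qed
qed

text \<open>Irreducibility is a property of the vanishing ideal, which a set shares with its
  closure. The two applications are images under projections and the germ of real solutions at a
  smooth point.\<close>

lemma irr_zariski_closure:
  assumes T: "T \<subseteq> cspace q" "T \<noteq> {}"
    and prime: "\<And>f g. f \<in> PF q \<Longrightarrow> g \<in> PF q \<Longrightarrow> (\<And>y. y \<in> T \<Longrightarrow> f y * g y = 0) \<Longrightarrow> f \<in> van q T \<or> g \<in> van q T"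
  shows "irr q (zariski_closure q T)"
proof (rule irrI)
  let ?W = "zariski_closure q T"
  show "closed_set q ?W" unfolding closed_set_def
  proof (intro conjI ballI impI)
    show "?W \<subseteq> cspace q" unfolding zariski_closure_van by blast
    fix y assume y: "y \<in> cspace q" "\<forall>f\<in>PF q. (\<forall>z\<in>?W. f z = 0) \<longrightarrow> f y = 0"
    have "p y = 0" if "p \<in> van q T" for p
    proof -
      have "p \<in> van q ?W" using that van_zariski_closure[OF T(1)] by simp
      then have "p \<in> PF q" "\<forall>z\<in>?W. p z = 0" unfolding van_def by auto
      then show ?thesis using bspec[OF y(2), of p] by simp
    qed
    then show "y \<in> ?W" using y(1) unfolding zariski_closure_van by blast
  qed
  show "?W \<noteq> {}" using subset_zariski_closure[OF T(1)] T(2) by blast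
  fix f g assume fg: "f \<in> PF q" "g \<in> PF q" "\<forall>y\<in>?W. f y * g y = 0"
  have "f \<in> van q T \<or> g \<in> van q T"
    by (rule prime[OF fg(1,2)]) (use fg(3) subset_zariski_closure[OF T(1)] in blast)
  then have "f \<in> van q ?W \<or> g \<in> van q ?W" unfolding van_zariski_closure[OF T(1)] .
  then show "(\<forall>y\<in>?W. f y = 0) \<or> (\<forall>y\<in>?W. g y = 0)" unfolding van_def by blast
qed

section \<open>Comparison of chains with the transcendence degree\<close>

text \<open>An equation \<open>f\<close> of \<open>W\<close> that is not one of \<open>V\<close>
  homogenizes to \<open>ft\<close> outside \<open>J\<close>, and elimination turns it into a nonzero
  \<open>b\<close> without the last value. Over \<open>W\<close> both \<open>ft\<close> and the
  relations of \<open>V\<close> vanish, hence so does \<open>b\<close>, and already \<open>d\<close>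
  forms are dependent on \<open>W\<close>.\<close>

lemma vd_strict_mono:
  assumes V: "irr n V" and W: "irr n W" and sub: "W \<subset> V"
  shows "vd n W < vd n V"
proof -
  define d where "d = vd n V"
  define m where "m = d * Suc n + n"
  obtain F c D where "gen n V d m F c D" using irr.ex_gen[OF V] unfolding d_def m_def by blast
  then interpret gen n V d m F c D .
  obtain y1 where y1: "y1 \<in> V" "y1 \<notin> W" using sub by blast
  then obtain f where f: "f \<in> PF n" "\<And>y. y \<in> W \<Longrightarrow> f y = 0" "f y1 \<noteq> 0"
    using closed_setD[OF irr_closed_set[OF W], of y1] V_cspace unfolding van_def by blast
  obtain E ft where ft: "ft \<in> PF (Suc m)" "\<And>z y. (\<forall>j<n. Fd j z = - y j * rho z) \<Longrightarrow> ft z = rho z ^ E * f y"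
    using homogenize[OF f(1)] by blast
  have ftV: "ft (gx n x y) = rho (gx n x y) ^ E * f y" if "y \<in> V" for x y
    by (rule ft(2)) (use gradient_relation[OF that] in blast)
  have "ft \<notin> J n V (Suc d)"
  proof
    assume ftJ: "ft \<in> J n V (Suc d)"
    obtain x0 y0 where 0: "y0 \<in> V" "rho (gx n x0 y0) \<noteq> 0"
      using rho_not_J rho_PF unfolding J_def Suc_m by blast
    obtain y where "y \<in> V" "f y \<noteq> 0" "rho (gx n x0 y) \<noteq> 0"
      using V_generic[OF f(1) gx_PF2[OF rho_PF, of n x0] y1(1) f(3) 0] by blast
    then show False using ftJ ftV unfolding J_def by auto
  qed
  then obtain b a where b: "b \<in> PF m" "\<exists>x. b x \<noteq> 0" "(\<lambda>x. b x - a x * ft x) \<in> J n V (Suc d)"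
    using eliminate[OF ft(1)] by blast
  have "b (gx n x y) = 0" if "y \<in> W" for x y
  proof -
    have "y \<in> V" using that sub by blast
    then have "b (gx n x y) - a (gx n x y) * ft (gx n x y) = 0" "ft (gx n x y) = 0"
      using b(3) ftV f(2)[OF that] unfolding J_def by auto
    then show ?thesis by simp
  qed
  then have "Rel n W d" using not_Rel_J[of n W d b] b(1,2) unfolding m by auto
  then show ?thesis using Rel_iff[OF irr.V_nonempty[OF W]] unfolding d_def by blast
qed

lemma PF_prod_nonzero:
  assumes "finite A" "\<And>a. a \<in> A \<Longrightarrow> f a \<in> PF m" "\<And>a. a \<in> A \<Longrightarrow> \<exists>x. f a x \<noteq> 0"
  shows "\<exists>x. (\<Prod>a\<in>A. f a x) \<noteq> 0"
  using assms
proof (induction A)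
  case (insert a A)
  have "\<exists>y. (\<Prod>a\<in>A. f a y) \<noteq> 0" by (rule insert.IH) (use insert.prems in auto)
  then obtain x y where xy: "f a x \<noteq> 0" "(\<Prod>a\<in>A. f a y) \<noteq> 0" using insert.prems(2)[of a] by blast
  have "(\<lambda>x. \<Prod>a\<in>A. f a x) \<in> PF m" using insert by (intro PF_prod) auto
  from PF_mult_nonzero[OF insert.prems(1) this xy] insert.hyps show ?case by auto
qed simp

text \<open>\<open>V\<close> is cut with a generic hyperplane: form number \<open>e\<close> is
  required to take a generic value. If every component of the section had \<open>vd\<close> below
  \<open>e\<close>, the product of their relations among the first \<open>e\<close> forms would be a
  relation on the whole section, although by \<open>dominant\<close> these forms take generic values
  there.\<close>

lemma codimension_one:
  assumes V: "irr n V" and vd: "vd n V = Suc e"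
  shows "\<exists>W. irr n W \<and> W \<subset> V \<and> e \<le> vd n W"
proof -
  define d where "d = vd n V"
  define m where "m = d * Suc n + n"
  obtain F c D where "gen n V d m F c D" using irr.ex_gen[OF V] unfolding d_def m_def by blast
  then interpret gen n V d m F c D .
  have ed: "e < d" using vd by (simp add: d_def)
  obtain b where b: "b \<in> PF m" "\<exists>x. b x \<noteq> 0"
    "\<And>x. b x \<noteq> 0 \<Longrightarrow> \<exists>y\<in>V. \<forall>i<d. x (i * Suc n + n) = (\<Sum>j<n. x (i * Suc n + j) * y j)"
    using dominant by blast
  obtain y0 where y0: "y0 \<in> V" using V_nonempty by blast
  define \<delta> where "\<delta> = (\<lambda>x y. x (e * Suc n + n) - (\<Sum>j<n. x (e * Suc n + j) * y j :: complex))"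
  have "(\<lambda>x. \<delta> x y0) \<in> PF m" unfolding \<delta>_def
    using ed by (intro PF_diff PF_sum PF.PF_mult PF.PF_const PF.PF_var block_less_m) auto
  moreover have "\<delta> (\<lambda>v. if v = e * Suc n + n then 1 else 0) y0 \<noteq> 0" unfolding \<delta>_def by simp
  \<comment> \<open>\<open>b x0\<close> nonzero makes the hyperplane generic, and
    \<open>\<delta> x0 y0\<close> nonzero prevents it from containing \<open>V\<close>.\<close>
  ultimately obtain x0 where x0: "b x0 \<noteq> 0" "\<delta> x0 y0 \<noteq> 0"
    using b(2) PF_mult_nonzero[OF b(1)] by blast
  define S where "S = {y\<in>V. \<delta> x0 y = 0}"
  have "\<delta> x0 \<in> PF n" unfolding \<delta>_def by (intro PF_diff PF_sum PF.PF_mult PF.PF_const PF.PF_var) auto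
  then have "closed_set n S" unfolding S_def by (rule closed_set_sub[OF irr_closed_set[OF V]])
  then have "\<exists>\<W>. finite \<W> \<and> (\<forall>W\<in>\<W>. irr n W) \<and> S = \<Union>\<W>" by (rule decomposition)
  then obtain \<W> where W': "finite \<W> \<and> (\<forall>W\<in>\<W>. irr n W) \<and> S = \<Union>\<W>" by (elim exE)
  then have W: "finite \<W>" "\<And>W. W \<in> \<W> \<Longrightarrow> irr n W" "S = \<Union>\<W>" by simp_all
  have "S \<subset> V" using y0 x0(2) unfolding S_def by blast
  have "\<exists>W\<in>\<W>. e \<le> vd n W"
  proof (rule ccontr)
    assume "\<not> ?thesis"
    then have "Rel n W e" if "W \<in> \<W>" for W using Rel_iff[OF irr.V_nonempty[OF W(2)[OF that]]] that by auto
    then have "\<forall>W\<in>\<W>. \<exists>f. f \<in> J n W e \<and> (\<exists>x. f x \<noteq> 0)" unfolding Rel_def by blast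
    from bchoice[OF this] obtain g where g: "\<And>W. W \<in> \<W> \<Longrightarrow> g W \<in> J n W e" "\<And>W. W \<in> \<W> \<Longrightarrow> \<exists>x. g W x \<noteq> 0" by blast
    have gPF: "g W \<in> PF (e * Suc n)" if "W \<in> \<W>" for W using g(1)[OF that] unfolding J_def by blast
    define G where "G = (\<lambda>x. \<Prod>W\<in>\<W>. g W x)"
    have GP: "G \<in> PF (e * Suc n)" unfolding G_def by (intro PF_prod gPF)
    have "\<exists>x. G x \<noteq> 0" unfolding G_def
      by (rule PF_prod_nonzero[OF W(1), of g "e * Suc n"]) (fact gPF, fact g(2))
    then obtain x1 where x1: "G x1 \<noteq> 0" by blast
    \<comment> \<open>Block \<open>e\<close> is frozen at \<open>x0\<close>, so that each point
      supplied by \<open>dominant\<close> lies in the section \<open>S\<close>; the other blocks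
      remain free.\<close>
    define \<sigma> where "\<sigma> = (\<lambda>(x::nat \<Rightarrow> complex) v. if v < e * Suc n then x v else if v < Suc e * Suc n then x0 v else x v)"
    have bs: "(\<lambda>x. b (\<sigma> x)) \<in> PF m"
      by (rule PF_subst[OF b(1)]) (unfold \<sigma>_def, intro PF_if PF.PF_var PF.PF_const)
    have "\<sigma> x0 = x0" unfolding \<sigma>_def by auto
    then have "b (\<sigma> x0) \<noteq> 0" using x0 by simp
    then obtain x where x: "b (\<sigma> x) \<noteq> 0" "G x \<noteq> 0" using PF_mult_nonzero[OF bs GP _ x1] by blast
    obtain y where y: "y \<in> V" "\<And>i. i < d \<Longrightarrow> \<sigma> x (i * Suc n + n) = (\<Sum>j<n. \<sigma> x (i * Suc n + j) * y j)"
      using b(3)[OF x(1)] by blast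
    have se: "\<sigma> x (e * Suc n + j) = x0 (e * Suc n + j)" if "j \<le> n" for j unfolding \<sigma>_def using that by simp
    have sl: "\<sigma> x v = x v" if "v < e * Suc n" for v unfolding \<sigma>_def using that by simp
    have "\<delta> x0 y = 0" using y(2)[OF ed] unfolding \<delta>_def by (simp add: se del: mult_Suc_right)
    then have "y \<in> S" using y(1) unfolding S_def by blast
    then obtain W where W': "W \<in> \<W>" "y \<in> W" unfolding W(3) by blast
    have "g W x = g W (gx n x y)"
    proof (rule PF_cong[OF gPF[OF W'(1)]])
      fix v assume v: "v < e * Suc n"
      then obtain e' where e': "e = Suc e'" by (cases e) auto
      from v have "v < Suc e' * Suc n" unfolding e' .
      then show "x v = gx n x y v"
      proof (cases rule: block_cases)
        case (1 i j)
        then show ?thesis by (simp add: gx_coeff del: mult_Suc_right)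
      next
        case (2 i)
        have i: "i < e" using 2 e' by simp
        have lt: "i * Suc n + j < e * Suc n" if "j \<le> n" for j
        proof -
          have "i * Suc n + j < Suc i * Suc n" using that by simp
          also have "\<dots> \<le> e * Suc n" using i by (intro mult_le_mono1) simp
          finally show ?thesis .
        qed
        have "\<sigma> x (i * Suc n + n) = (\<Sum>j<n. \<sigma> x (i * Suc n + j) * y j)" using y(2) i ed by simp
        then show ?thesis unfolding 2(2) gx_value using sl[OF lt] by (simp del: mult_Suc_right)
      qed
    qed
    also have "\<dots> = 0" using g(1)[OF W'(1)] W'(2) unfolding J_def by blast
    finally have "G x = 0" unfolding G_def using W(1) W'(1) by (intro prod_zero) auto
    with x(2) show False by contradiction
  qed
  then obtain W where "W \<in> \<W>" "e \<le> vd n W" by blast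
  then show ?thesis using W(2) W(3) \<open>S \<subset> V\<close> by blast
qed

text \<open>Repeated hyperplane sections give a chain of length \<open>vd n V\<close>, and
  \<open>vd\<close> increases strictly along any chain, which bounds its length.\<close>

theorem var_dim_eq_vd:
  assumes "irr n V" shows "var_dim n V = vd n V"
  unfolding var_dim_def
proof (rule Greatest_equality)
  let ?P = "\<lambda>V d. \<exists>Z. (\<forall>i\<le>d. irreducible_variety n (Z i)) \<and> (\<forall>i<d. Z i \<subset> Z (Suc i)) \<and> Z d \<subseteq> V"
  have "irr n V \<Longrightarrow> vd n V = k \<Longrightarrow> ?P V k" for k
  proof (induction k arbitrary: V)
    case 0
    then show ?case using irr_irreducible_variety by (intro exI[of _ "\<lambda>i. V"]) auto
  next
    case (Suc k)
    obtain W where W: "irr n W" "W \<subset> V" "k \<le> vd n W" using codimension_one[OF Suc.prems] by blast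
    have "vd n W = k" using vd_strict_mono[OF Suc.prems(1) W(1,2)] W(3) Suc.prems(2) by simp
    from Suc.IH[OF W(1) this] obtain Z where Z: "\<forall>i\<le>k. irreducible_variety n (Z i)" "\<forall>i<k. Z i \<subset> Z (Suc i)" "Z k \<subseteq> W"
      by blast
    show ?case
    proof (intro exI[of _ "\<lambda>i. if i \<le> k then Z i else V"] conjI allI impI)
      fix i show "irreducible_variety n (if i \<le> k then Z i else V)"
        using Z(1) irr_irreducible_variety[OF Suc.prems(1)] by simp
    next
      fix i assume i: "i < Suc k"
      show "(if i \<le> k then Z i else V) \<subset> (if Suc i \<le> k then Z (Suc i) else V)"
      proof (cases "i = k")
        case True
        then show ?thesis using Z(3) W(2) by auto
      next
        case False
        then show ?thesis using i Z(2) by simp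
      qed
    qed simp
  qed
  then show "?P V (vd n V)" using assms by blast
next
  fix k assume "\<exists>Z. (\<forall>i\<le>k. irreducible_variety n (Z i)) \<and> (\<forall>i<k. Z i \<subset> Z (Suc i)) \<and> Z k \<subseteq> V"
  then obtain Z where Z: "\<And>i. i \<le> k \<Longrightarrow> irr n (Z i)" "\<And>i. i < k \<Longrightarrow> Z i \<subset> Z (Suc i)" "Z k \<subseteq> V"
    using irreducible_variety_irr by blast
  have "i \<le> k \<Longrightarrow> i \<le> vd n (Z i)" for i
  proof (induction i)
    case (Suc i)
    have "vd n (Z i) < vd n (Z (Suc i))"
      by (rule vd_strict_mono) (use Suc.prems Z in auto)
    then show ?case using Suc by simp
  qed simp
  then have "k \<le> vd n (Z k)" by blast
  also have "\<dots> \<le> vd n V" using vd_mono[OF irr.V_nonempty[OF Z(1)] Z(3)] by blast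
  finally show "k \<le> vd n V" .
qed

subsection \<open>Tangent spaces\<close>

lemma PF_directional:
  assumes "f \<in> PF m"
  shows "((\<lambda>t. f (\<lambda>i. z i + t * e i)) has_field_derivative (\<Sum>i<m. e i * pd i f z)) (at 0)"
proof -
  have "((\<lambda>t. z i + t * e i) has_field_derivative e i) (at 0)" for i
    by (auto intro!: derivative_eq_intros)
  from PF_chain[OF assms, of "\<lambda>t i. z i + t * e i" e 0, OF this] show ?thesis by simp
qed

context gen
begin

definition dirF :: "(nat \<Rightarrow> complex) \<Rightarrow> (nat \<Rightarrow> complex) \<Rightarrow> complex" where
  "dirF z e = (\<Sum>v<Suc m. e v * pd v F z)"

text \<open>Differentiating \<open>c D ^ M * f = h * F\<close> at a common zero of \<open>F\<close>
  and \<open>f\<close> shows that a direction tangent to \<open>F = 0\<close> is tangent to all of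
  \<open>J\<close>.\<close>

lemma J_derivative:
  assumes f: "f \<in> J n V (Suc d)" and z: "F z = 0" "c D z \<noteq> 0" and e: "dirF z e = 0"
  shows "((\<lambda>t. f (\<lambda>v. z v + t * e v)) has_field_derivative 0) (at 0)"
proof -
  let ?z = "\<lambda>t v. z v + t * e v"
  obtain M h where h: "h \<in> PF (Suc m)" "\<And>x. c D x ^ M * f x = h x * F x" using J_multiple[OF f] by blast
  obtain f' where f': "((\<lambda>t. f (?z t)) has_field_derivative f') (at 0)"
    by (rule that, rule PF_directional[OF J_PF[OF f]])
  obtain l' where l': "((\<lambda>t. c D (?z t) ^ M) has_field_derivative l') (at 0)"
    by (rule that, rule PF_directional[OF PF_power[OF c_mono]])
  obtain h' where h': "((\<lambda>t. h (?z t)) has_field_derivative h') (at 0)"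
    by (rule that, rule PF_directional[OF h(1)])
  have F': "((\<lambda>t. F (?z t)) has_field_derivative 0) (at 0)"
    using PF_directional[OF F_PF, of z e] e unfolding dirF_def by simp
  have z0: "?z 0 = z" by simp
  have fz: "f z = 0" using J_zero[OF f z] .
  have "((\<lambda>t. c D (?z t) ^ M * f (?z t)) has_field_derivative l' * f (?z 0) + f' * c D (?z 0) ^ M) (at 0)"
    by (rule DERIV_mult[OF l' f'])
  moreover have "((\<lambda>t. h (?z t) * F (?z t)) has_field_derivative h' * F (?z 0) + 0 * h (?z 0)) (at 0)"
    by (rule DERIV_mult[OF h' F'])
  ultimately have "l' * f (?z 0) + f' * c D (?z 0) ^ M = h' * F (?z 0) + 0 * h (?z 0)"
    unfolding h(2) by (rule DERIV_unique)
  then have "f' = 0" using fz z by simp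
  with f' show ?thesis by simp
qed

text \<open>The tangent vector is the derivative of the lifted point \<open>y = - Fd / rho\<close> along \<open>F = 0\<close>.\<close>

lemma tangent_surj:
  assumes y: "y \<in> V" and z: "c D (gx n x y) \<noteq> 0" "rho (gx n x y) \<noteq> 0"
  shows "\<exists>v. (\<forall>f\<in>van n V. (\<Sum>j<n. v j * pd j f y) = 0) \<and> (\<forall>i<d. (\<Sum>j<n. x (i * Suc n + j) * v j) = u i)"
proof -
  define z where "z = gx n x y"
  \<comment> \<open>The values of the first \<open>d\<close> forms move with velocities
    \<open>u\<close> and all coefficients stay fixed; \<open>\<tau>\<close> is the velocity of the
    last value that keeps \<open>F\<close> zero to first order.\<close>
  define e0 where "e0 = (\<lambda>v. if \<exists>i<d. v = i * Suc n + n then u (v div Suc n) else 0)"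
  define \<tau> where "\<tau> = - (\<Sum>v<m. e0 v * pd v F z) / rho z"
  define e where "e = (\<lambda>v. if v = m then \<tau> else e0 v)"
  have lz: "c D z \<noteq> 0" and rz: "rho z \<noteq> 0" using z unfolding z_def by auto
  have Fz: "F z = 0" unfolding z_def using F_J y unfolding J_def by blast
  have "dirF z e = (\<Sum>v<m. e0 v * pd v F z) + \<tau> * rho z"
    unfolding dirF_def rho_def e_def by simp
  also have "\<dots> = 0" unfolding \<tau>_def using rz by simp
  finally have dF: "dirF z e = 0" .
  have ew: "e (i * Suc n + n) = u i" if "i < d" for i
  proof -
    have "i * Suc n + n \<noteq> m" using block_less_m[OF that, of n] by simp
    moreover have "(i * Suc n + n) div Suc n = i" by (simp add: div_mult_self3 del: mult_Suc_right)
    ultimately show ?thesis unfolding e_def e0_def using that by (auto simp del: mult_Suc_right)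
  qed
  have ea: "e (i * Suc n + j) = 0" if "j < n" for i j
  proof -
    have ne: "i * Suc n + j \<noteq> i' * Suc n + n" for i' by (rule block_neq[OF that, symmetric])
    show ?thesis unfolding e_def e0_def m by (simp add: ne del: mult_Suc_right)
  qed
  let ?z = "\<lambda>t v. z v + t * e v"
  have z0: "?z 0 = z" by simp
  define yt where "yt = (\<lambda>t j. - Fd j (?z t) / rho (?z t))"
  have rd: "((\<lambda>t. rho (?z t)) has_field_derivative (\<Sum>v<Suc m. e v * pd v rho z)) (at 0)"
    by (rule PF_directional[OF rho_PF])
  have "\<exists>v. ((\<lambda>t. yt t j) has_field_derivative v) (at 0)" for j
    unfolding yt_def
    by (rule exI, rule DERIV_divide[OF DERIV_minus[OF PF_directional[OF Fd_PF[of j], of z e]] rd]) (simp add: rz)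
  then have "\<exists>v. \<forall>j. ((\<lambda>t. yt t j) has_field_derivative v j) (at 0)" by (intro choice allI)
  then obtain v where "\<forall>j. ((\<lambda>t. yt t j) has_field_derivative v j) (at 0)" by (elim exE)
  then have v: "((\<lambda>t. yt t j) has_field_derivative v j) (at 0)" for j by (rule spec)
  have rc: "isCont (\<lambda>t. rho (?z t)) 0" using rd by (rule DERIV_isCont)
  have ev: "eventually (\<lambda>t. rho (?z t) \<noteq> 0) (nhds 0)"
  proof -
    have "eventually (\<lambda>t. rho (?z t) \<noteq> 0) (at 0)"
      using rc rz tendsto_imp_eventually_ne[of "\<lambda>t. rho (?z t)" "rho z" "at 0" 0] unfolding isCont_def by simp
    then show ?thesis unfolding eventually_at_filter using rz by (auto elim!: eventually_mono)
  qed
  have Fy: "Fd j (?z t) = - yt t j * rho (?z t)" if "rho (?z t) \<noteq> 0" for t j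
    unfolding yt_def using that by simp
  have y0: "yt 0 j = y j" if "j < n" for j
    unfolding yt_def using gradient_relation[OF y that, of x] rz by (simp add: z_def)
  show ?thesis
  proof (intro exI[of _ v] conjI ballI allI impI)
    fix f assume f: "f \<in> van n V"
    then have fP: "f \<in> PF n" unfolding van_def by blast
    obtain E ft where ft: "ft \<in> PF (Suc m)" "\<And>z y. (\<forall>j<n. Fd j z = - y j * rho z) \<Longrightarrow> ft z = rho z ^ E * f y"
      using homogenize[OF fP] by blast
    have "ft \<in> J n V (Suc d)" by (rule homogenize_J[OF ft]) (use f in \<open>auto simp: van_def\<close>)
    from J_derivative[OF this Fz lz dF]
    have 1: "((\<lambda>t. ft (?z t)) has_field_derivative 0) (at 0)" .
    have "((\<lambda>t. f (yt t)) has_field_derivative (\<Sum>j<n. v j * pd j f (yt 0))) (at 0)"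
      by (rule PF_chain[OF fP]) (rule v)
    then have fd: "((\<lambda>t. f (yt t)) has_field_derivative (\<Sum>j<n. v j * pd j f y)) (at 0)"
    proof -
      assume a: "((\<lambda>t. f (yt t)) has_field_derivative (\<Sum>j<n. v j * pd j f (yt 0))) (at 0)"
      have "pd j f (yt 0) = pd j f y" for j by (rule PF_cong[OF pd_PF[OF fP]]) (rule y0)
      with a show ?thesis by simp
    qed
    have fy: "f (yt 0) = 0"
    proof -
      have "f (yt 0) = f y" by (rule PF_cong[OF fP]) (rule y0)
      then show ?thesis using f y unfolding van_def by simp
    qed
    obtain r' where r': "((\<lambda>t. rho (?z t) ^ E) has_field_derivative r') (at 0)"
      by (rule that, rule PF_directional[OF PF_power[OF rho_PF]])
    have "((\<lambda>t. rho (?z t) ^ E * f (yt t)) has_field_derivative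
        r' * f (yt 0) + (\<Sum>j<n. v j * pd j f y) * rho (?z 0) ^ E) (at 0)"
      by (rule DERIV_mult[OF r' fd])
    then have 2: "((\<lambda>t. rho (?z t) ^ E * f (yt t)) has_field_derivative (\<Sum>j<n. v j * pd j f y) * rho z ^ E) (at 0)"
      using fy by simp
    \<comment> \<open>The identity requires \<open>rho\<close> nonzero and so is known only near
      \<open>t = 0\<close>, which suffices for the derivative; the comparison leaves a multiple of
      \<open>rho z ^ E\<close>.\<close>
    have "eventually (\<lambda>t. ft (?z t) = rho (?z t) ^ E * f (yt t)) (nhds 0)"
      using ev
    proof (rule eventually_mono)
      fix t assume "rho (?z t) \<noteq> 0"
      then have "\<forall>j<n. Fd j (?z t) = - yt t j * rho (?z t)" using Fy by simp
      then show "ft (?z t) = rho (?z t) ^ E * f (yt t)" by (rule ft(2))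
    qed
    from iffD2[OF DERIV_cong_ev[OF refl this refl] 2]
    have "((\<lambda>t. ft (?z t)) has_field_derivative (\<Sum>j<n. v j * pd j f y) * rho z ^ E) (at 0)" .
    from DERIV_unique[OF this 1] show "(\<Sum>j<n. v j * pd j f y) = 0" using rz by simp
  next
    fix i assume i: "i < d"
    have 1: "((\<lambda>t. linrel i (?z t)) has_field_derivative 0) (at 0)"
      by (rule J_derivative[OF linrel_J Fz lz dF]) (use i in simp)
    define g where "g = (\<lambda>t. (z (i * Suc n + n) + t * u i) - (\<Sum>j<n. z (i * Suc n + j) * yt t j))"
    have gd: "(g has_field_derivative u i - (\<Sum>j<n. z (i * Suc n + j) * v j)) (at 0)"
      unfolding g_def by (auto intro!: derivative_eq_intros v sum.cong simp: mult.commute)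
    have g0: "g 0 = 0" unfolding g_def using y0 by (simp add: z_def gx_value gx_coeff del: mult_Suc_right)
    have "((\<lambda>t. rho (?z t) * g t) has_field_derivative
        (\<Sum>v<Suc m. e v * pd v rho z) * g 0 + (u i - (\<Sum>j<n. z (i * Suc n + j) * v j)) * rho (?z 0)) (at 0)"
      by (rule DERIV_mult[OF rd gd])
    then have 2: "((\<lambda>t. rho (?z t) * g t) has_field_derivative (u i - (\<Sum>j<n. z (i * Suc n + j) * v j)) * rho z) (at 0)"
      using g0 by simp
    have "linrel i (?z t) = rho (?z t) * g t" if "rho (?z t) \<noteq> 0" for t
      unfolding linrel_def g_def using Fy[OF that] ew[OF i] ea
      by (simp add: right_diff_distrib sum_distrib_left sum_negf mult_ac del: mult_Suc_right)
    then have "eventually (\<lambda>t. linrel i (?z t) = rho (?z t) * g t) (nhds 0)"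
      by (rule eventually_mono[OF ev])
    from iffD2[OF DERIV_cong_ev[OF refl this refl] 2]
    have "((\<lambda>t. linrel i (?z t)) has_field_derivative (u i - (\<Sum>j<n. z (i * Suc n + j) * v j)) * rho z) (at 0)" .
    from DERIV_unique[OF this 1] rz have "u i = (\<Sum>j<n. z (i * Suc n + j) * v j)" by simp
    then show "(\<Sum>j<n. x (i * Suc n + j) * v j) = u i" unfolding z_def by (simp add: gx_coeff del: mult_Suc_right)
  qed
qed

text \<open>Moving \<open>y\<close> along such a \<open>v\<close> changes only the last value, with
  velocity \<open>\<tau>\<close>. The relation \<open>F\<close> forces \<open>\<tau> = 0\<close>,
  and then the equation \<open>y j * rho + Fd j = 0\<close>, valid on \<open>V\<close>, forces
  \<open>v j = 0\<close>.\<close>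

lemma tangent_inj:
  assumes y: "y \<in> V" and r: "rho (gx n x y) \<noteq> 0"
    and v: "\<And>f. f \<in> van n V \<Longrightarrow> (\<Sum>j<n. v j * pd j f y) = 0"
    and A: "\<And>i. i < d \<Longrightarrow> (\<Sum>j<n. x (i * Suc n + j) * v j) = 0" and j: "j < n"
  shows "v j = 0"
proof -
  define \<tau> where "\<tau> = (\<Sum>j<n. x (d * Suc n + j) * v j)"
  let ?y = "\<lambda>t j. y j + t * v j"
  define e where "e = (\<lambda>w. if w = m then \<tau> else 0)"
  have z: "gx n x (?y t) w = gx n x y w + t * e w" if "w < Suc m" for t w
    using that unfolding Suc_m[symmetric]
  proof (cases rule: block_cases)
    case (1 i j')
    then show ?thesis using block_neq[of j' n d i] by (simp add: gx_coeff e_def m del: mult_Suc_right)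
  next
    case (2 i)
    have "gx n x (?y t) w = gx n x y w + t * (\<Sum>j<n. x (i * Suc n + j) * v j)"
      unfolding 2 gx_value sum_distrib_left sum.distrib[symmetric]
      by (intro sum.cong refl) (simp add: algebra_simps)
    also have "(\<Sum>j<n. x (i * Suc n + j) * v j) = e w"
    proof (cases "i = d")
      case True
      then show ?thesis unfolding e_def \<tau>_def 2 m by simp
    next
      case False
      then have "w \<noteq> m" unfolding 2 m by (simp del: mult_Suc_right)
      then show ?thesis using A[of i] 2 False by (simp add: e_def)
    qed
    finally show ?thesis .
  qed
  have dir: "((\<lambda>t. P (gx n x (?y t))) has_field_derivative \<tau> * pd m P (gx n x y)) (at 0)" if "P \<in> PF (Suc m)" for P
  proof -
    have "P (gx n x (?y t)) = P (\<lambda>w. gx n x y w + t * e w)" for t by (rule PF_cong[OF that]) (rule z)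
    moreover have "(\<Sum>w<Suc m. e w * pd w P (gx n x y)) = \<tau> * pd m P (gx n x y)" by (simp add: e_def)
    ultimately show ?thesis using PF_directional[OF that, of "gx n x y" e] by simp
  qed
  have I: "D' = 0" if "f \<in> van n V" "((\<lambda>t. f (?y t)) has_field_derivative D') (at 0)" for f D'
  proof -
    have "f \<in> PF n" using that(1) unfolding van_def by blast
    from DERIV_unique[OF PF_directional[OF this, of y v] that(2)] show ?thesis using v[OF that(1)] by simp
  qed
  have "(\<lambda>y. F (gx n x y)) \<in> van n V"
    unfolding van_def using gx_PF2[OF F_PF] F_J unfolding J_def by blast
  from I[OF this dir[OF F_PF]] have "\<tau> = 0" using r unfolding rho_def by simp
  define f where "f = (\<lambda>y. y j * rho (gx n x y) + Fd j (gx n x y))"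
  have "f \<in> PF n" unfolding f_def by (intro PF.PF_add PF.PF_mult PF.PF_var j gx_PF2[OF rho_PF] gx_PF2[OF Fd_PF])
  then have fV: "f \<in> van n V" unfolding van_def using gradient_relation[OF _ j, of _ x] by (auto simp: f_def)
  have "((\<lambda>t. (y j + t * v j) * rho (gx n x (?y t)) + Fd j (gx n x (?y t))) has_field_derivative v j * rho (gx n x y)) (at 0)"
    using dir[OF rho_PF] dir[OF Fd_PF[of j]] \<open>\<tau> = 0\<close> by (auto intro!: derivative_eq_intros)
  then have "((\<lambda>t. f (?y t)) has_field_derivative v j * rho (gx n x y)) (at 0)" unfolding f_def .
  from I[OF fV this] show ?thesis using r by simp
qed

text \<open>Neither \<open>rho\<close> nor \<open>c D\<close> lies in the prime ideal
  \<open>J\<close>, so by irreducibility any nonvanishing condition on \<open>V\<close> can be met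
  together with both.\<close>

lemma generic_point:
  assumes "f \<in> PF n" "y0 \<in> V" "f y0 \<noteq> 0"
  shows "\<exists>x. \<exists>y\<in>V. f y \<noteq> 0 \<and> rho (gx n x y) \<noteq> 0 \<and> c D (gx n x y) \<noteq> 0"
proof -
  have "c D \<notin> J n V (Suc d)"
  proof
    assume "c D \<in> J n V (Suc d)"
    moreover have "lowdeg m D (c D)"
      by (rule lowdeg_mono[of m "Suc 0"]) (use c_PF D_pos lowdeg_0 in \<open>auto simp: lowdeg_Suc\<close>)
    ultimately have "c D = (\<lambda>x. 0)" by (rule min)
    then show False using lead_nz by simp
  qed
  then have "(\<lambda>z. rho z * c D z) \<notin> J n V (Suc d)" using J_prime'[OF rho_PF c_mono] rho_not_J by blast
  moreover have P: "(\<lambda>z. rho z * c D z) \<in> PF (Suc m)" by (intro PF.PF_mult rho_PF c_mono)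
  ultimately obtain x y1 where "y1 \<in> V" "rho (gx n x y1) * c D (gx n x y1) \<noteq> 0" unfolding J_def Suc_m by blast
  from V_generic[OF assms(1) gx_PF2[OF P, of n x] assms(2,3) this] show ?thesis by auto
qed

end

text \<open>The minor stays nonzero at a generic point. There the \<open>s\<close> gradients and
  \<open>d\<close> generic linear forms are independent, because tangent vectors dual to the forms
  exist and are annihilated by the gradients. Thus the Jacobian rank is at most the codimension at
  every point of \<open>V\<close>, not only at generic ones.\<close>

lemma minor_size_le:
  assumes V: "irr n V" and f: "\<And>i. i < s \<Longrightarrow> f i \<in> van n V" and \<kappa>: "\<And>j. j < s \<Longrightarrow> \<kappa> j < n"
    and y0: "y0 \<in> V" "det_sq s (\<lambda>i j. pd (\<kappa> j) (f i) y0) \<noteq> 0"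
  shows "s + vd n V \<le> n"
proof -
  define d where "d = vd n V"
  define m where "m = d * Suc n + n"
  obtain F c D where "gen n V d m F c D" using irr.ex_gen[OF V] unfolding d_def m_def by blast
  then interpret gen n V d m F c D .
  have fP: "f i \<in> PF n" if "i < s" for i using f[OF that] unfolding van_def by blast
  have "(\<lambda>y. det_sq s (\<lambda>i j. pd (\<kappa> j) (f i) y)) \<in> PF n" by (rule det_sq_PF) (intro pd_PF fP)
  from generic_point[OF this y0] obtain x y where y: "y \<in> V" "det_sq s (\<lambda>i j. pd (\<kappa> j) (f i) y) \<noteq> 0"
    "rho (gx n x y) \<noteq> 0" "c D (gx n x y) \<noteq> 0" by blast
  have "s + d \<le> n"
  proof (rule ccontr)
    assume "\<not> s + d \<le> n"
    then obtain \<alpha> where \<alpha>: "\<exists>i<s + d. \<alpha> i \<noteq> 0"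
      "\<forall>j<n. (\<Sum>i<s + d. (if i < s then pd j (f i) y else x ((i - s) * Suc n + j)) * \<alpha> i) = 0"
      using homogeneous_solution[of n "s + d" "\<lambda>j i. if i < s then pd j (f i) y else x ((i - s) * Suc n + j)"] by auto
    have eq: "(\<Sum>i<s. \<alpha> i * pd j (f i) y) + (\<Sum>i<d. \<alpha> (s + i) * x (i * Suc n + j)) = 0" if "j < n" for j
    proof -
      have "(\<Sum>i<s + d. g i) = (\<Sum>i<s. g i) + (\<Sum>i<d. g (s + i))" for g :: "nat \<Rightarrow> complex"
        by (induction d) (auto simp: add.assoc)
      then show ?thesis using \<alpha>(2) that by (simp add: mult.commute del: mult_Suc_right)
    qed
    \<comment> \<open>Pairing the dependency with a tangent vector dual to form \<open>i0\<close>
      isolates the coefficient of that form.\<close>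
    have \<alpha>0: "\<alpha> (s + i0) = 0" if "i0 < d" for i0
    proof -
      obtain v where "(\<forall>f\<in>van n V. (\<Sum>j<n. v j * pd j f y) = 0) \<and>
        (\<forall>i<d. (\<Sum>j<n. x (i * Suc n + j) * v j) = (if i = i0 then 1 else 0))"
        using tangent_surj[OF y(1,4,3), of "\<lambda>i. if i = i0 then 1 else 0"] by (elim exE)
      then have v: "\<And>f. f \<in> van n V \<Longrightarrow> (\<Sum>j<n. v j * pd j f y) = 0"
        "\<And>i. i < d \<Longrightarrow> (\<Sum>j<n. x (i * Suc n + j) * v j) = (if i = i0 then 1 else 0)" by blast+
      have "0 = (\<Sum>j<n. v j * ((\<Sum>i<s. \<alpha> i * pd j (f i) y) + (\<Sum>i<d. \<alpha> (s + i) * x (i * Suc n + j))))"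
        using eq by simp
      also have "\<dots> = (\<Sum>j<n. \<Sum>i<s. \<alpha> i * (v j * pd j (f i) y)) + (\<Sum>j<n. \<Sum>i<d. \<alpha> (s + i) * (x (i * Suc n + j) * v j))"
        by (simp add: distrib_left sum.distrib sum_distrib_left mult_ac del: mult_Suc_right)
      also have "\<dots> = (\<Sum>i<s. \<alpha> i * (\<Sum>j<n. v j * pd j (f i) y)) + (\<Sum>i<d. \<alpha> (s + i) * (\<Sum>j<n. x (i * Suc n + j) * v j))"
        unfolding sum_distrib_left by (subst (1 2) sum.swap) (rule refl)
      also have "\<dots> = (\<Sum>i<d. \<alpha> (s + i) * (if i = i0 then 1 else 0))"
        using v f by simp
      also have "\<dots> = (\<Sum>i<d. if i = i0 then \<alpha> (s + i) else 0)" by (rule sum.cong) auto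
      also have "\<dots> = \<alpha> (s + i0)" using that by simp
      finally show ?thesis by simp
    qed
    then have "(\<Sum>i<s. \<alpha> i * pd j (f i) y) = 0" if "j < n" for j using eq[OF that] by simp
    moreover have "\<exists>i<s. \<alpha> i \<noteq> 0"
    proof (rule ccontr)
      assume no: "\<not> ?thesis"
      obtain i where i: "i < s + d" "\<alpha> i \<noteq> 0" using \<alpha>(1) by blast
      then have "s \<le> i" using no by (meson not_less)
      moreover have "i - s < d" using calculation i(1) by arith
      ultimately show False using \<alpha>0[of "i - s"] i by simp
    qed
    ultimately have "det_sq s (\<lambda>i j. pd (\<kappa> j) (f i) y) = 0"
      unfolding det_sq_eq_0_iff_left using \<kappa> by blast
    with y(2) show False by contradiction
  qed
  then show ?thesis unfolding d_def .
qed

text \<open>The point is generic: there \<open>d\<close> generic linear forms are injective on the tangent space.\<close>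

lemma ex_large_minor:
  assumes V: "irr n V" and f: "\<And>i. i < r \<Longrightarrow> f i \<in> van n V" and gens: "van n V \<subseteq> pspan n (f ` {..<r})"
  shows "\<exists>y\<in>V. \<exists>s. n \<le> s + vd n V \<and> nonzero_minor r n (\<lambda>i j. pd j (f i) y) s"
proof -
  define d where "d = vd n V"
  define m where "m = d * Suc n + n"
  obtain F c D where "gen n V d m F c D" using irr.ex_gen[OF V] unfolding d_def m_def by blast
  then interpret gen n V d m F c D .
  obtain y0 where "y0 \<in> V" using V_nonempty by blast
  from generic_point[OF PF_const[of 1] this] obtain x y where y: "y \<in> V" "rho (gx n x y) \<noteq> 0" by auto
  have fP: "f i \<in> PF n" if "i < r" for i using f[OF that] unfolding van_def by blast
  have "\<exists>s. n \<le> s + d \<and> nonzero_minor r n (\<lambda>i j. pd j (f i) y) s"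
  proof (rule large_minor[where N = "\<lambda>i j. x (i * Suc n + j)"])
    fix v j assume v: "\<And>i. i < r \<Longrightarrow> (\<Sum>j<n. pd j (f i) y * v j) = 0"
      "\<And>i. i < d \<Longrightarrow> (\<Sum>j<n. x (i * Suc n + j) * v j) = 0" "j < n"
    have vf: "(\<Sum>j<n. v j * pd j (f i) y) = 0" if "i < r" for i using v(1)[OF that] by (simp add: mult.commute)
    \<comment> \<open>The gradients of the generators annihilate \<open>v\<close>; at a point of
      \<open>V\<close> the product rule extends this to the whole vanishing ideal.\<close>
    have van: "(\<Sum>j<n. v j * pd j g y) = 0" if "g \<in> pspan n (f ` {..<r})" for g
      using that
    proof (induction rule: pspan.induct)
      case (pspan_step g b h)
      then obtain i where i: "i < r" "b = f i" by blast
      have bP: "b \<in> PF n" using fP[OF i(1)] i(2) by simp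
      have gP: "g \<in> PF n" by (rule pspan_PF[OF pspan_step(1)]) (use fP in blast)
      have by0: "b y = 0" using f[OF i(1)] y(1) i(2) unfolding van_def by blast
      have "pd j (\<lambda>x. g x + h x * b x) y = pd j g y + h y * pd j b y" for j
        using by0 pd_add[OF gP PF.PF_mult[OF pspan_step.hyps(3) bP]] pd_mult[OF pspan_step.hyps(3) bP] by simp
      then have "(\<Sum>j<n. v j * pd j (\<lambda>x. g x + h x * b x) y) = (\<Sum>j<n. v j * pd j g y) + h y * (\<Sum>j<n. v j * pd j b y)"
        by (simp add: distrib_left sum.distrib sum_distrib_left mult.left_commute)
      then show ?case using pspan_step.IH vf[OF i(1)] i(2) by simp
    qed simp
    show "v j = 0"
      by (rule tangent_inj[OF y _ v(2,3)]) (use van gens in blast)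
  qed
  with y(1) show ?thesis unfolding d_def by blast
qed

subsection \<open>Real points\<close>

definition real_dense :: "nat \<Rightarrow> (nat \<Rightarrow> complex) set \<Rightarrow> bool" where
  "real_dense n V \<longleftrightarrow> (\<forall>f\<in>PF n. (\<forall>y\<in>V. (\<forall>i. y i \<in> \<real>) \<longrightarrow> f y = 0) \<longrightarrow> (\<forall>y\<in>V. f y = 0))"

lemma ideal_gen_vanish:
  assumes "G \<subseteq> vanish n V" shows "ideal_gen n G \<subseteq> vanish n V"
proof
  fix p assume "p \<in> ideal_gen n G"
  then obtain l :: nat and gs hs where *: "\<forall>i<l. gs i \<in> G \<and> poly_in n (hs i)" "p = (\<Sum>i<l. hs i * gs i)"
    unfolding ideal_gen_def by auto
  then have gs: "poly_in n (gs i)" "y \<in> V \<Longrightarrow> eval (gs i) y = 0" if "i < l" for i y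
    using that assms unfolding vanish_def by auto
  have "poly_in n p" unfolding *(2) by (intro poly_in_sum poly_in_mult) (use * gs in auto)
  moreover have "eval p y = 0" if "y \<in> V" for y
    unfolding *(2) eval_sum eval_mult using gs(2)[OF _ that] by simp
  ultimately show "p \<in> vanish n V" unfolding vanish_def by blast
qed

lemma ideal_gen_base: "g \<in> G \<Longrightarrow> g \<in> ideal_gen n G"
  unfolding ideal_gen_def
  by (rule CollectI, rule exI[of _ 1], rule exI[of _ "\<lambda>i. g"], rule exI[of _ "\<lambda>i. 1"])
     (auto simp: poly_in_def vars_def)

lemma vanish_ideal_gen:
  assumes "van n V \<subseteq> pspan n (eval ` G)" "\<And>g. g \<in> G \<Longrightarrow> poly_in n g"
  shows "vanish n V \<subseteq> ideal_gen n G"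
proof
  fix p assume p: "p \<in> vanish n V"
  then have "eval p \<in> pspan n (eval ` G)" using vanish_van assms(1) by blast
  from pspan_explicit[OF this] obtain l :: nat and b h where
    bh: "(\<forall>i<l. b i \<in> eval ` G \<and> h i \<in> PF n) \<and> eval p = (\<lambda>x. \<Sum>i<l. h i x * b i x)"
    by (elim exE)
  note bh1 = conjunct1[OF bh]
  have "\<forall>i\<in>{..<l}. \<exists>g. g \<in> G \<and> eval g = b i"
  proof
    fix i assume "i \<in> {..<l}"
    then have "b i \<in> eval ` G" using bh1 by simp
    then show "\<exists>g. g \<in> G \<and> eval g = b i" by (elim imageE) auto
  qed
  from bchoice[OF this] obtain gs where gs: "\<And>i. i < l \<Longrightarrow> gs i \<in> G \<and> eval (gs i) = b i" by auto
  have "\<forall>i\<in>{..<l}. \<exists>g. poly_in n g \<and> eval g = h i" using bh1 PF_eval by auto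
  from bchoice[OF this] obtain hs where hs: "\<And>i. i < l \<Longrightarrow> poly_in n (hs i) \<and> eval (hs i) = h i" by auto
  have "p = (\<Sum>i<l. hs i * gs i)"
  proof (rule eval_inj)
    show "poly_in n p" using p unfolding vanish_def by blast
    show "poly_in n (\<Sum>i<l. hs i * gs i)" by (intro poly_in_sum poly_in_mult) (use hs gs assms(2) in auto)
    show "eval p = eval (\<Sum>i<l. hs i * gs i)"
    proof
      fix x
      have "eval p x = (\<Sum>i<l. h i x * b i x)" using bh by simp
      also have "\<dots> = eval (\<Sum>i<l. hs i * gs i) x"
        unfolding eval_sum eval_mult by (rule sum.cong) (use gs hs in auto)
      finally show "eval p x = eval (\<Sum>i<l. hs i * gs i) x" .
    qed
  qed
  then show "p \<in> ideal_gen n G" unfolding ideal_gen_def using gs hs by blast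
qed

lemma complex_real_parts: "a \<in> \<real> \<Longrightarrow> b \<in> \<real> \<Longrightarrow> a + \<i> * b = 0 \<Longrightarrow> a = 0 \<and> b = 0"
  by (auto elim!: Reals_cases simp: complex_eq_iff)

lemma real_dense_defined_over_R:
  assumes "real_dense n V" shows "defined_over_R n V"
  unfolding defined_over_R_def
proof (intro exI conjI)
  let ?G = "{p\<in>vanish n V. real_coeffs p}"
  show "\<forall>g\<in>?G. real_coeffs g" by blast
  have "vanish n V \<subseteq> ideal_gen n ?G"
  proof (rule vanish_ideal_gen)
    show "poly_in n g" if "g \<in> ?G" for g using that unfolding vanish_def by blast
    show "van n V \<subseteq> pspan n (eval ` ?G)"
    proof
      fix f assume f: "f \<in> van n V"
      then have "f \<in> PF n" unfolding van_def by blast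
      then obtain g h where gh: "g \<in> PF n" "h \<in> PF n" "cjf g = g" "cjf h = h" "f = (\<lambda>x. g x + \<i> * h x)"
        using real_fun_decomp by blast
      have 0: "g y = 0 \<and> h y = 0" if "y \<in> V" "\<forall>i. y i \<in> \<real>" for y
      proof (rule complex_real_parts)
        show "g y \<in> \<real>" "h y \<in> \<real>" using real_fun_real_point gh that by auto
        show "g y + \<i> * h y = 0" using f that(1) gh(5) unfolding van_def by auto
      qed
      have mem: "k \<in> eval ` ?G" if "k \<in> PF n" "cjf k = k" "\<And>y. y \<in> V \<Longrightarrow> \<forall>i. y i \<in> \<real> \<Longrightarrow> k y = 0" for k
      proof -
        have "k \<in> van n V" using assms that(1,3) unfolding real_dense_def van_def by blast
        then obtain p where p: "p \<in> vanish n V" "eval p = k" using van_vanish by blast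
        then have "real_coeffs p" using that(2) cjf_real_coeffs[of n p] unfolding vanish_def by blast
        with p show ?thesis by blast
      qed
      have "g \<in> eval ` ?G" by (rule mem) (use gh 0 in auto)
      moreover have "h \<in> eval ` ?G" by (rule mem) (use gh 0 in auto)
      ultimately show "f \<in> pspan n (eval ` ?G)"
        unfolding gh(5) by (intro pspan_step pspan_base PF.PF_const)
    qed
  qed
  moreover have "ideal_gen n ?G \<subseteq> vanish n V" by (rule ideal_gen_vanish) blast
  ultimately show "vanish n V = ideal_gen n ?G" by blast
qed

lemma real_dense_smooth_point:
  assumes V: "irr n V" and dense: "real_dense n V"
  shows "has_smooth_real_point n V"
proof -
  obtain B where B: "finite B" "B \<subseteq> van n V" "van n V \<subseteq> pspan n B"
    using hilbert_basis[OF pideal_van[of n V]] by (elim exE conjE)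
  have "\<exists>P. finite P \<and> P \<subseteq> vanish n V \<and> eval ` P = B"
  proof -
    have "B \<subseteq> eval ` vanish n V" using B(2) van_vanish by blast
    then show ?thesis using finite_subset_image[OF B(1)] by metis
  qed
  then obtain P where P: "finite P" "P \<subseteq> vanish n V" "eval ` P = B" by blast
  obtain fs where fs: "set fs = P" using finite_list[OF P(1)] by blast
  define f where "f = (\<lambda>i. eval (fs ! i))"
  have fv: "f i \<in> van n V" if "i < length fs" for i
    using that P(2) fs vanish_van nth_mem unfolding f_def by blast
  have "f ` {..<length fs} = B"
    unfolding f_def P(3)[symmetric] fs[symmetric] set_conv_nth by auto
  then have "\<exists>y\<in>V. \<exists>s. n \<le> s + vd n V \<and> nonzero_minor (length fs) n (\<lambda>i j. pd j (f i) y) s"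
    using ex_large_minor[OF V, of "length fs" f] fv B(3) by simp
  then obtain y s where y: "y \<in> V" "n \<le> s + vd n V" and "nonzero_minor (length fs) n (\<lambda>i j. pd j (f i) y) s"
    by (elim bexE exE conjE)
  then obtain \<rho> \<kappa> where
    rk: "inj_on \<rho> {..<s}" "\<rho> ` {..<s} \<subseteq> {..<length fs}" "inj_on \<kappa> {..<s}" "\<kappa> ` {..<s} \<subseteq> {..<n}" and
    nz: "det_sq s (\<lambda>i j. pd (\<kappa> j) (f (\<rho> i)) y) \<noteq> 0"
    unfolding nonzero_minor_def by (elim exE conjE)
  define \<mu> where "\<mu> = (\<lambda>y. det_sq s (\<lambda>i j. pd (\<kappa> j) (f (\<rho> i)) y))"
  have "\<mu> \<in> PF n" unfolding \<mu>_def
  proof (rule det_sq_PF, rule pd_PF)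
    fix i j assume "i < s"
    then have "\<rho> i < length fs" using rk(2) by blast
    then show "f (\<rho> i) \<in> PF n" using fv unfolding van_def by blast
  qed
  with dense have "(\<forall>y\<in>V. (\<forall>i. y i \<in> \<real>) \<longrightarrow> \<mu> y = 0) \<longrightarrow> (\<forall>y\<in>V. \<mu> y = 0)"
    unfolding real_dense_def by (rule bspec)
  moreover have "\<mu> y \<noteq> 0" unfolding \<mu>_def by (rule nz)
  ultimately obtain \<xi> where \<xi>: "\<xi> \<in> V" "\<forall>i. \<xi> i \<in> \<real>" "\<mu> \<xi> \<noteq> 0" using y(1) by blast
  \<comment> \<open>The rank bound holds at every point of \<open>V\<close>, so the minor carried
    over to the real point \<open>\<xi>\<close> has exactly the size that smoothness
    requires.\<close>
  have le: "t + vd n V \<le> n" if "nonzero_minor (length fs) n (\<lambda>i j. pd j (f i) \<xi>) t" for t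
    using that unfolding nonzero_minor_def
  proof (elim exE conjE)
    fix \<rho>' \<kappa>' assume *: "\<rho>' ` {..<t} \<subseteq> {..<length fs}" "\<kappa>' ` {..<t} \<subseteq> {..<n}"
      "det_sq t (\<lambda>i j. pd (\<kappa>' j) (f (\<rho>' i)) \<xi>) \<noteq> 0"
    show ?thesis
    proof (rule minor_size_le[OF V _ _ \<xi>(1) *(3)])
      show "f (\<rho>' i) \<in> van n V" if "i < t" for i by (rule fv) (use *(1) that in auto)
      show "\<kappa>' j < n" if "j < t" for j using *(2) that by auto
    qed
  qed
  have nm: "nonzero_minor (length fs) n (\<lambda>i j. pd j (f i) \<xi>) s"
    unfolding nonzero_minor_def using rk \<xi>(3)[unfolded \<mu>_def]
    by (intro exI[of _ \<rho>] exI[of _ \<kappa>] conjI)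
  have s: "s = n - vd n V" using le[OF nm] y(2) by simp
  have "mat_rank (length fs) n (\<lambda>i j. pd j (f i) \<xi>) = n - vd n V"
  proof (rule mat_rank_eqI)
    show "nonzero_minor (length fs) n (\<lambda>i j. pd j (f i) \<xi>) (n - vd n V)" using nm s by simp
    show "t \<le> n - vd n V" if "nonzero_minor (length fs) n (\<lambda>i j. pd j (f i) \<xi>) t" for t
      using le[OF that] by simp
  qed
  then have "mat_rank (length fs) n (\<lambda>i j. eval (pdiff j (fs ! i)) \<xi>) = n - var_dim n V"
    unfolding eval_pdiff f_def var_dim_eq_vd[OF V] .
  moreover have "vanish n V = ideal_gen n (set fs)"
  proof
    show "ideal_gen n (set fs) \<subseteq> vanish n V" unfolding fs by (rule ideal_gen_vanish[OF P(2)])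
    show "vanish n V \<subseteq> ideal_gen n (set fs)" unfolding fs
      by (rule vanish_ideal_gen) (use P B(3) in \<open>auto simp: vanish_def\<close>)
  qed
  ultimately show ?thesis unfolding has_smooth_real_point_def smooth_real_point_def using \<xi> by blast
qed

lemma smooth_real_point_minor:
  assumes V: "irr n V" and \<xi>: "smooth_real_point n V \<xi>" and c: "c = n - vd n V"
  shows "\<exists>f \<kappa>. (\<forall>i<c. f i \<in> van n V) \<and> inj_on \<kappa> {..<c} \<and> \<kappa> ` {..<c} \<subseteq> {..<n} \<and>
    det_sq c (\<lambda>i j. pd (\<kappa> j) (f i) \<xi>) \<noteq> 0"
proof -
  obtain fs where fs: "vanish n V = ideal_gen n (set fs)"
    "mat_rank (length fs) n (\<lambda>i j. eval (pdiff j (fs ! i)) \<xi>) = n - var_dim n V"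
    using \<xi> unfolding smooth_real_point_def by blast
  then have "nonzero_minor (length fs) n (\<lambda>i j. eval (pdiff j (fs ! i)) \<xi>) c"
    using nonzero_minor_mat_rank[of "length fs" n "\<lambda>i j. eval (pdiff j (fs ! i)) \<xi>"]
    unfolding var_dim_eq_vd[OF V] c by simp
  then obtain \<rho> \<kappa> where rk0: "inj_on \<rho> {..<c}" and rk: "\<rho> ` {..<c} \<subseteq> {..<length fs}" "inj_on \<kappa> {..<c}" "\<kappa> ` {..<c} \<subseteq> {..<n}"
    "det_sq c (\<lambda>i j. eval (pdiff (\<kappa> j) (fs ! \<rho> i)) \<xi>) \<noteq> 0"
    unfolding nonzero_minor_def by (elim exE conjE)
  have "eval (fs ! \<rho> i) \<in> van n V" if "i < c" for i
  proof (rule vanish_van)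
    have "fs ! \<rho> i \<in> set fs" using rk(1) that by (intro nth_mem) auto
    then show "fs ! \<rho> i \<in> vanish n V" unfolding fs(1) by (rule ideal_gen_base)
  qed
  then show ?thesis using rk unfolding eval_pdiff
    by (intro exI[of _ "\<lambda>i. eval (fs ! \<rho> i)"] exI[of _ \<kappa>]) auto
qed

text \<open>A polynomial with real coefficients vanishes at the conjugate of each of its zeros, and
  such polynomials generate the ideal of \<open>V\<close>.\<close>

lemma defined_over_R_cnj:
  assumes V: "irr n V" and R: "defined_over_R n V" and y: "y \<in> V"
  shows "(\<lambda>i. cnj (y i)) \<in> V"
proof (rule irr.V_closed[OF V])
  show "(\<lambda>i. cnj (y i)) \<in> cspace n" using y irr.V_cspace[OF V] unfolding cspace_def by auto
  fix f assume "f \<in> PF n" "\<forall>z\<in>V. f z = 0"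
  then obtain p where p: "p \<in> vanish n V" "eval p = f" using van_vanish unfolding van_def by blast
  obtain G where G: "\<forall>g\<in>G. real_coeffs g" "vanish n V = ideal_gen n G" using R unfolding defined_over_R_def by blast
  obtain l :: nat and gs hs where *: "\<forall>i<l. gs i \<in> G \<and> poly_in n (hs i)" "p = (\<Sum>i<l. hs i * gs i)"
    using p(1) unfolding G(2) ideal_gen_def by auto
  have "eval (gs i) (\<lambda>i. cnj (y i)) = 0" if "i < l" for i
  proof -
    have g: "gs i \<in> G" using * that by blast
    then have "gs i \<in> vanish n V" unfolding G(2) by (rule ideal_gen_base)
    then have 0: "eval (gs i) y = 0" using y unfolding vanish_def by blast
    have "cjf (eval (gs i)) = eval (gs i)" using G(1) g by (intro real_coeffs_cjf) blast
    then have "eval (gs i) (\<lambda>i. cnj (y i)) = cnj (eval (gs i) (\<lambda>i. cnj (cnj (y i))))"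
      unfolding cjf_def by metis
    then show ?thesis using 0 by simp
  qed
  then show "f (\<lambda>i. cnj (y i)) = 0" unfolding p(2)[symmetric] *(2) eval_sum eval_mult by simp
qed

subsection \<open>Orders of vanishing modulo an ideal\<close>

text \<open>\<open>Hom n j P\<close>: \<open>P x z\<close> is a polynomial that is homogeneous of degree \<open>j\<close> in \<open>z\<close>. On the diagonal \<open>z = x\<close> these are
  the polynomials vanishing to order \<open>j\<close> at \<open>0\<close>.\<close>

inductive Hom :: "nat \<Rightarrow> nat \<Rightarrow> ((nat \<Rightarrow> complex) \<Rightarrow> (nat \<Rightarrow> complex) \<Rightarrow> complex) \<Rightarrow> bool" for n :: nat where
  Hom_base: "f \<in> PF n \<Longrightarrow> Hom n 0 (\<lambda>x z. f x)"
| Hom_zero: "Hom n j (\<lambda>x z. 0)"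
| Hom_add: "Hom n j P \<Longrightarrow> Hom n j Q \<Longrightarrow> Hom n j (\<lambda>x z. P x z + Q x z)"
| Hom_var: "Hom n j P \<Longrightarrow> i < n \<Longrightarrow> Hom n (Suc j) (\<lambda>x z. z i * P x z)"

lemma Hom_scale: "Hom n j P \<Longrightarrow> P x (\<lambda>i. t * z i) = t ^ j * P x z"
  by (induction rule: Hom.induct) (auto simp: distrib_left mult_ac)

lemma Hom_Suc_0: "Hom n (Suc j) P \<Longrightarrow> P x (\<lambda>i. 0) = 0"
  using Hom_scale[of n "Suc j" P x 0 "\<lambda>i. 0"] by simp

lemma Hom_cong:
  assumes "Hom n j P" and x: "\<And>i. i < n \<Longrightarrow> x i = x' i" and z: "\<And>i. i < n \<Longrightarrow> z i = z' i"
  shows "P x z = P x' z'"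
  using assms(1)
proof (induction rule: Hom.induct)
  case (Hom_base f)
  show ?case by (rule PF_cong[OF Hom_base]) (rule x)
next
  case (Hom_var j P i)
  show ?case unfolding Hom_var.IH z[OF Hom_var.hyps(2)] ..
next
  case (Hom_add j P Q)
  show ?case unfolding Hom_add.IH ..
qed simp

lemma Hom_mult_PF: "Hom n j P \<Longrightarrow> f \<in> PF n \<Longrightarrow> Hom n j (\<lambda>x z. f x * P x z)"
proof (induction rule: Hom.induct)
  case (Hom_base g)
  then show ?case using Hom.Hom_base[OF PF.PF_mult[of f n g]] by simp
next
  case (Hom_zero j)
  show ?case using Hom.Hom_zero[of n j] by simp
next
  case (Hom_add j P Q)
  then show ?case using Hom.Hom_add[of n j "\<lambda>x z. f x * P x z" "\<lambda>x z. f x * Q x z"]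
    by (simp add: distrib_left)
next
  case (Hom_var j P i)
  then show ?case using Hom.Hom_var[of n j "\<lambda>x z. f x * P x z" i] by (simp add: mult.left_commute)
qed

lemma Hom_mult: "Hom n j P \<Longrightarrow> Hom n k Q \<Longrightarrow> Hom n (j + k) (\<lambda>x z. P x z * Q x z)"
proof (induction rule: Hom.induct)
  case (Hom_base f)
  then show ?case using Hom_mult_PF[of n k Q f] by simp
next
  case (Hom_zero j)
  show ?case using Hom.Hom_zero[of n "j + k"] by simp
next
  case (Hom_add j P P')
  then show ?case using Hom.Hom_add[of n "j + k" "\<lambda>x z. P x z * Q x z" "\<lambda>x z. P' x z * Q x z"]
    by (simp add: distrib_right)
next
  case (Hom_var j P i)
  then show ?case using Hom.Hom_var[of n "j + k" "\<lambda>x z. P x z * Q x z" i] by (simp add: mult.assoc)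
qed

lemma Hom_sum: "(\<And>i. i \<in> A \<Longrightarrow> Hom n j (P i)) \<Longrightarrow> Hom n j (\<lambda>x z. \<Sum>i\<in>A. P i x z)"
  by (induction A rule: infinite_finite_induct) (auto intro: Hom.Hom_zero Hom.Hom_add)

text \<open>\<open>x\<close> and \<open>z\<close> become two blocks of \<open>n\<close> variables
  each, which makes the basis theorem applicable; \<open>pair\<close> merges two points
  accordingly.\<close>

lemma Hom_pair: "Hom n j P \<Longrightarrow> (\<lambda>w. P w (\<lambda>i. w (n + i))) \<in> PF (n + n)"
proof (induction rule: Hom.induct)
  case (Hom_base f)
  then show ?case by (rule PF_mono) simp
next
  case (Hom_var j P i)
  show ?case by (rule PF.PF_mult[OF PF.PF_var Hom_var.IH]) (use Hom_var.hyps in simp)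
next
  case (Hom_add j P Q)
  show ?case by (rule PF.PF_add[OF Hom_add.IH])
qed (rule PF_const)

lemma Hom_diag: "Hom n j P \<Longrightarrow> (\<lambda>x. P x x) \<in> PF n"
proof (induction rule: Hom.induct)
  case (Hom_var j P i)
  show ?case by (rule PF.PF_mult[OF PF.PF_var[OF Hom_var.hyps(2)] Hom_var.IH])
next
  case (Hom_add j P Q)
  show ?case by (rule PF.PF_add[OF Hom_add.IH])
next
  case (Hom_base f)
  then show ?case by simp
qed (rule PF_const)

text \<open>Homogeneous polynomials of degree \<open>j\<close> in the variables indexed by
  \<open>S\<close> alone: the normal forms of leading parts modulo \<open>I\<close>. The zero
  function belongs to every degree.\<close>

inductive SHom :: "nat set \<Rightarrow> nat \<Rightarrow> ((nat \<Rightarrow> complex) \<Rightarrow> complex) \<Rightarrow> bool" for S :: "nat set" where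
  SHom_const: "SHom S 0 (\<lambda>x. c)"
| SHom_zero: "SHom S j (\<lambda>x. 0)"
| SHom_add: "SHom S j r \<Longrightarrow> SHom S j r' \<Longrightarrow> SHom S j (\<lambda>x. r x + r' x)"
| SHom_var: "SHom S j r \<Longrightarrow> s \<in> S \<Longrightarrow> SHom S (Suc j) (\<lambda>x. x s * r x)"

lemma SHom_Hom: "SHom S j r \<Longrightarrow> S \<subseteq> {..<n} \<Longrightarrow> Hom n j (\<lambda>x z. r z)"
proof (induction rule: SHom.induct)
  case (SHom_const c)
  show ?case using Hom.Hom_base[OF PF_const[of c n]] by simp
next
  case (SHom_var j r s)
  then show ?case using Hom.Hom_var[of n j "\<lambda>x z. r z" s] by auto
qed (auto intro: Hom.Hom_zero Hom.Hom_add)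

lemma SHom_PF: "SHom S j r \<Longrightarrow> S \<subseteq> {..<n} \<Longrightarrow> r \<in> PF n"
  using Hom_diag[OF SHom_Hom] by simp

lemma SHom_scale: "SHom S j r \<Longrightarrow> r (\<lambda>i. t * x i) = t ^ j * r x"
  by (induction rule: SHom.induct) (auto simp: distrib_left mult_ac)

lemma SHom_cong:
  assumes "SHom S j r" and x: "\<And>s. s \<in> S \<Longrightarrow> x s = y s"
  shows "r x = r y"
  using assms(1)
proof (induction rule: SHom.induct)
  case (SHom_var j r s)
  show ?case unfolding SHom_var.IH x[OF SHom_var.hyps(2)] ..
next
  case (SHom_add j r r')
  show ?case unfolding SHom_add.IH ..
qed simp_all

lemma SHom_smult: "SHom S j r \<Longrightarrow> SHom S j (\<lambda>x. a * r x)"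
proof (induction rule: SHom.induct)
  case (SHom_const c)
  show ?case by (rule SHom.SHom_const)
next
  case (SHom_zero j)
  show ?case using SHom.SHom_zero[of S j] by simp
next
  case (SHom_add j r r')
  then show ?case using SHom.SHom_add[of S j "\<lambda>x. a * r x" "\<lambda>x. a * r' x"] by (simp add: distrib_left)
next
  case (SHom_var j r s)
  then show ?case using SHom.SHom_var[of S j "\<lambda>x. a * r x" s] by (simp add: mult.left_commute)
qed

lemma SHom_sum: "(\<And>i. i \<in> A \<Longrightarrow> SHom S j (r i)) \<Longrightarrow> SHom S j (\<lambda>x. \<Sum>i\<in>A. r i x)"
  by (induction A rule: infinite_finite_induct) (auto intro: SHom.SHom_zero SHom.SHom_add)

lemma expand_at_0:
  assumes "f \<in> PF n"
  shows "\<exists>q. (\<forall>k. q k \<in> PF n) \<and> (\<forall>x. f x = f (\<lambda>i. 0) + (\<Sum>k<n. x k * q k x))"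
  using assms
proof (induction rule: PF.induct)
  case (PF_const c)
  show ?case by (rule exI[of _ "\<lambda>k x. 0"]) (auto intro: PF.PF_const)
next
  case (PF_var i)
  have "(\<Sum>k<n. x k * (if k = i then 1 else 0)) = x i" for x :: "nat \<Rightarrow> complex"
  proof -
    have "(\<Sum>k<n. x k * (if k = i then 1 else 0)) = (\<Sum>k<n. if k = i then x k else 0)"
      by (rule sum.cong) auto
    then show ?thesis using PF_var by simp
  qed
  then show ?case by (intro exI[of _ "\<lambda>k x. if k = i then 1 else 0"]) (auto intro: PF.PF_const)
next
  case (PF_add f g)
  then obtain q r where *: "\<forall>k. q k \<in> PF n" "\<forall>x. f x = f (\<lambda>i. 0) + (\<Sum>k<n. x k * q k x)"
    "\<forall>k. r k \<in> PF n" "\<forall>x. g x = g (\<lambda>i. 0) + (\<Sum>k<n. x k * r k x)" by (elim exE conjE)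
  show ?case
  proof (rule exI[of _ "\<lambda>k x. q k x + r k x"], intro conjI allI)
    show "(\<lambda>x. q k x + r k x) \<in> PF n" for k by (intro PF.PF_add *(1)[rule_format] *(3)[rule_format])
    fix x
    show "f x + g x = f (\<lambda>i. 0) + g (\<lambda>i. 0) + (\<Sum>k<n. x k * (q k x + r k x))"
      using *(2)[rule_format, of x] *(4)[rule_format, of x] by (simp add: distrib_left sum.distrib)
  qed
next
  case (PF_mult f g)
  then obtain q r where *: "\<forall>k. q k \<in> PF n" "\<forall>x. f x = f (\<lambda>i. 0) + (\<Sum>k<n. x k * q k x)"
    "\<forall>k. r k \<in> PF n" "\<forall>x. g x = g (\<lambda>i. 0) + (\<Sum>k<n. x k * r k x)" by (elim exE conjE)
  show ?case
  proof (rule exI[of _ "\<lambda>k x. q k x * g x + f (\<lambda>i. 0) * r k x"], intro conjI allI)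
    show "(\<lambda>x. q k x * g x + f (\<lambda>i. 0) * r k x) \<in> PF n" for k
      by (intro PF.PF_add PF.PF_mult PF.PF_const *(1)[rule_format] *(3)[rule_format] PF_mult.hyps)
    fix x
    have "(\<Sum>k<n. x k * (q k x * g x + f (\<lambda>i. 0) * r k x))
      = (\<Sum>k<n. x k * q k x) * g x + f (\<lambda>i. 0) * (\<Sum>k<n. x k * r k x)"
      unfolding sum_distrib_left sum_distrib_right sum.distrib[symmetric]
      by (rule sum.cong) (auto simp: algebra_simps)
    moreover have "(\<Sum>k<n. x k * q k x) = f x - f (\<lambda>i. 0)" using *(2)[rule_format, of x] by simp
    moreover have "(\<Sum>k<n. x k * r k x) = g x - g (\<lambda>i. 0)" using *(4)[rule_format, of x] by simp
    ultimately show "f x * g x = f (\<lambda>i. 0) * g (\<lambda>i. 0) + (\<Sum>k<n. x k * (q k x * g x + f (\<lambda>i. 0) * r k x))"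
      by (simp add: algebra_simps)
  qed
qed

text \<open>Normal form of the equations at the smooth point, moved to the origin: the variables in
  \<open>C\<close> are solved for in terms of the free variables in \<open>S\<close>, with linear
  part \<open>L\<close> and a remainder of order two, since each \<open>q i k\<close> vanishes at
  the origin.\<close>

locale core =
  fixes n :: nat and C :: "nat set" and g :: "nat \<Rightarrow> (nat \<Rightarrow> complex) \<Rightarrow> complex"
    and L :: "nat \<Rightarrow> nat \<Rightarrow> complex" and q :: "nat \<Rightarrow> nat \<Rightarrow> (nat \<Rightarrow> complex) \<Rightarrow> complex"
    and S :: "nat set"
  assumes C: "C \<subseteq> {..<n}" and S: "S = {..<n} - C"
    and g: "\<And>i x. i \<in> C \<Longrightarrow> g i x = x i - (\<Sum>s\<in>S. L i s * x s) - (\<Sum>k<n. x k * q i k x)"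
    and q_PF: "\<And>i k. q i k \<in> PF n" and q_0: "\<And>i k. q i k (\<lambda>i. 0) = 0"
begin

lemma S_sub: "S \<subseteq> {..<n}" using S by blast

lemma finS: "finite S" using S by simp

abbreviation "I \<equiv> pspan n (g ` C)"

lemma g_PF: "i \<in> C \<Longrightarrow> g i \<in> PF n"
proof -
  assume i: "i \<in> C"
  have "g i = (\<lambda>x. x i - (\<Sum>s\<in>S. L i s * x s) - (\<Sum>k<n. x k * q i k x))" using g[OF i] by auto
  then show ?thesis using i C S_sub
    by (auto intro!: PF_diff PF_sum PF.PF_mult PF.PF_const PF.PF_var q_PF)
qed

text \<open>Modulo \<open>I\<close> a variable \<open>x i\<close> with \<open>i\<close> in
  \<open>C\<close> equals a linear form in the free variables plus terms of order two, so a form of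
  degree \<open>j\<close> can be rewritten in the free variables at the price of terms of higher
  order.\<close>

lemma leading_part:
  assumes "Hom n j P"
  shows "\<exists>r P'. SHom S j r \<and> Hom n (Suc j) P' \<and> (\<lambda>x. P x x - r x - P' x x) \<in> I"
  using assms
proof (induction rule: Hom.induct)
  case (Hom_base f)
  obtain p where p: "\<forall>k. p k \<in> PF n" "\<forall>x. f x = f (\<lambda>i. 0) + (\<Sum>k<n. x k * p k x)"
    using expand_at_0[OF Hom_base] by (elim exE conjE)
  show ?case
  proof (intro exI conjI)
    show "SHom S 0 (\<lambda>x. f (\<lambda>i. 0))" by (rule SHom.SHom_const)
    show "Hom n (Suc 0) (\<lambda>x z. \<Sum>k<n. z k * p k x)"
      by (intro Hom_sum Hom.Hom_var Hom.Hom_base p(1)[rule_format]) simp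
    have "(\<lambda>x. f x - f (\<lambda>i. 0) - (\<Sum>k<n. x k * p k x)) = (\<lambda>x. 0)"
    proof
      fix x show "f x - f (\<lambda>i. 0) - (\<Sum>k<n. x k * p k x) = 0"
        using p(2)[rule_format, of x] by simp
    qed
    then show "(\<lambda>x. f x - f (\<lambda>i. 0) - (\<Sum>k<n. x k * p k x)) \<in> I" using pspan_zero by metis
  qed
next
  case (Hom_zero j)
  have "(\<lambda>x. 0 - 0 - 0 :: complex) \<in> I" using pspan_zero by simp
  then show ?case using SHom.SHom_zero Hom.Hom_zero by blast
next
  case (Hom_add j P Q)
  then obtain r P' r' Q' where *: "SHom S j r" "Hom n (Suc j) P'" "(\<lambda>x. P x x - r x - P' x x) \<in> I"
    "SHom S j r'" "Hom n (Suc j) Q'" "(\<lambda>x. Q x x - r' x - Q' x x) \<in> I" by (elim exE conjE)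
  show ?case
  proof (intro exI conjI)
    show "SHom S j (\<lambda>x. r x + r' x)" by (intro SHom.SHom_add *)
    show "Hom n (Suc j) (\<lambda>x z. P' x z + Q' x z)" by (intro Hom.Hom_add *)
    have "(\<lambda>x. P x x + Q x x - (r x + r' x) - (P' x x + Q' x x))
      = (\<lambda>x. (P x x - r x - P' x x) + (Q x x - r' x - Q' x x))" by (auto simp: fun_eq_iff)
    then show "(\<lambda>x. P x x + Q x x - (r x + r' x) - (P' x x + Q' x x)) \<in> I"
      using pspan_add[OF *(6,3)] by simp
  qed
next
  case (Hom_var j P i)
  then obtain r P' where *: "SHom S j r" "Hom n (Suc j) P'" "(\<lambda>x. P x x - r x - P' x x) \<in> I"
    by (elim exE conjE)
  have xi: "(\<lambda>x. x i) \<in> PF n" using Hom_var(3) Hom_var.hyps by (intro PF.PF_var) auto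
  have m: "(\<lambda>x. x i * (P x x - r x - P' x x)) \<in> I" by (rule pspan_mult[OF *(3) xi])
  have HP: "Hom n (Suc (Suc j)) (\<lambda>x z. z i * P' x z)" by (intro Hom.Hom_var * Hom_var.hyps)
  show ?case
  proof (cases "i \<in> S")
    case True
    show ?thesis
    proof (intro exI conjI)
      show "SHom S (Suc j) (\<lambda>x. x i * r x)" by (intro SHom.SHom_var * True)
      show "Hom n (Suc (Suc j)) (\<lambda>x z. z i * P' x z)" by (rule HP)
      show "(\<lambda>x. x i * P x x - x i * r x - x i * P' x x) \<in> I" using m by (simp add: right_diff_distrib)
    qed
  next
    case False
    then have iC: "i \<in> C" using Hom_var.hyps S by auto
    \<comment> \<open>Expanding \<open>q i k\<close> once more exhibits the remainder as a form of
      degree 2 in \<open>z\<close>; multiplied by \<open>r\<close> it has degree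
      \<open>j + 2\<close>.\<close>
    have "\<forall>k. \<exists>p. (\<forall>l. p l \<in> PF n) \<and> (\<forall>x. q i k x = (\<Sum>l<n. x l * p l x))"
    proof
      fix k
      obtain p where p: "\<forall>l. p l \<in> PF n" "\<forall>x. q i k x = q i k (\<lambda>i. 0) + (\<Sum>l<n. x l * p l x)"
        using expand_at_0[OF q_PF[of i k]] by (elim exE conjE)
      then show "\<exists>p. (\<forall>l. p l \<in> PF n) \<and> (\<forall>x. q i k x = (\<Sum>l<n. x l * p l x))"
        by (intro exI[of _ p]) (simp add: q_0)
    qed
    from choice[OF this] obtain p where "\<forall>k. (\<forall>l. p k l \<in> PF n) \<and> (\<forall>x. q i k x = (\<Sum>l<n. x l * p k l x))"
      by (elim exE)
    then have p: "\<And>k l. p k l \<in> PF n" "\<And>k x. q i k x = (\<Sum>l<n. x l * p k l x)" by auto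
    let ?Q = "\<lambda>x z. (\<Sum>k<n. \<Sum>l<n. z k * (z l * (p k l x * r z)))"
    show ?thesis
    proof (intro exI conjI)
      show "SHom S (Suc j) (\<lambda>x. \<Sum>s\<in>S. L i s * (x s * r x))"
        by (intro SHom_sum SHom_smult SHom.SHom_var *)
      show "Hom n (Suc (Suc j)) (\<lambda>x z. z i * P' x z + ?Q x z)"
        by (intro Hom.Hom_add HP Hom_sum Hom.Hom_var Hom_mult_PF p SHom_Hom[OF *(1) S_sub]) auto
      have "(\<lambda>x. r x * g i x) \<in> I"
        by (rule pspan_mult[OF pspan_base SHom_PF[OF *(1) S_sub]]) (use iC in blast)
      from pspan_add[OF this m]
      have "(\<lambda>x. x i * (P x x - r x - P' x x) + r x * g i x) \<in> I" .
      moreover have "x i * (P x x - r x - P' x x) + r x * g i x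
        = x i * P x x - (\<Sum>s\<in>S. L i s * (x s * r x)) - (x i * P' x x + ?Q x x)" for x
      proof -
        have 1: "?Q x x = r x * (\<Sum>k<n. x k * q i k x)"
          unfolding p(2) sum_distrib_left by (intro sum.cong refl) (simp add: mult_ac)
        have 2: "(\<Sum>s\<in>S. L i s * (x s * r x)) = r x * (\<Sum>s\<in>S. L i s * x s)"
          unfolding sum_distrib_left by (intro sum.cong refl) (simp add: mult_ac)
        show ?thesis unfolding 1 2 g[OF iC] by (simp add: algebra_simps)
      qed
      ultimately show "(\<lambda>x. x i * P x x - (\<Sum>s\<in>S. L i s * (x s * r x)) - (x i * P' x x + ?Q x x)) \<in> I" by simp
    qed
  qed
qed

end

subsection \<open>Krull's intersection theorem\<close>

text \<open>Finite sums of components, where \<open>A k\<close> says what a component of degree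
  \<open>k\<close> is. It is used for \<open>Hom n\<close> and for the graded combinations of a
  sequence of forms.\<close>

definition gsum :: "(nat \<Rightarrow> ((nat \<Rightarrow> complex) \<Rightarrow> (nat \<Rightarrow> complex) \<Rightarrow> complex) \<Rightarrow> bool)
    \<Rightarrow> ((nat \<Rightarrow> complex) \<Rightarrow> (nat \<Rightarrow> complex) \<Rightarrow> complex) \<Rightarrow> bool" where
  "gsum A f \<longleftrightarrow> (\<exists>K F. (\<forall>k. A k (F k)) \<and> f = (\<lambda>x z. \<Sum>k\<le>(K::nat). F k x z))"

lemma gsum_single:
  assumes "A k f" "\<And>j. A j (\<lambda>x z. 0)" shows "gsum A f"
  unfolding gsum_def
proof (rule exI[of _ k], rule exI[of _ "\<lambda>j. if j = k then f else (\<lambda>x z. 0)"], intro conjI allI)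
  show "A j (if j = k then f else (\<lambda>x z. 0))" for j using assms by simp
  have "(\<Sum>j\<le>k. (if j = k then f else (\<lambda>x z. 0)) x z) = (\<Sum>j\<le>k. if j = k then f x z else 0)" for x z
    by (rule sum.cong) auto
  then show "f = (\<lambda>x z. \<Sum>j\<le>k. (if j = k then f else (\<lambda>x z. 0)) x z)" by (simp add: fun_eq_iff)
qed

lemma gsum_add:
  assumes "gsum A f" "gsum A f'" "\<And>j. A j (\<lambda>x z. 0)"
    "\<And>j a b. A j a \<Longrightarrow> A j b \<Longrightarrow> A j (\<lambda>x z. a x z + b x z)"
  shows "gsum A (\<lambda>x z. f x z + f' x z)"
proof -
  obtain K F where F: "\<forall>k. A k (F k)" "f = (\<lambda>x z. \<Sum>k\<le>(K::nat). F k x z)"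
    using assms(1) unfolding gsum_def by (elim exE conjE)
  obtain K' F' where F': "\<forall>k. A k (F' k)" "f' = (\<lambda>x z. \<Sum>k\<le>(K'::nat). F' k x z)"
    using assms(2) unfolding gsum_def by (elim exE conjE)
  let ?a = "\<lambda>k. if k \<le> K then F k else (\<lambda>x z. 0)" and ?b = "\<lambda>k. if k \<le> K' then F' k else (\<lambda>x z. 0)"
  have 1: "(\<Sum>k\<le>K. F k x z) = (\<Sum>k\<le>max K K'. ?a k x z)" for x z
    by (rule sum.mono_neutral_cong_left) auto
  have 2: "(\<Sum>k\<le>K'. F' k x z) = (\<Sum>k\<le>max K K'. ?b k x z)" for x z
    by (rule sum.mono_neutral_cong_left) auto
  have "A k (\<lambda>x z. ?a k x z + ?b k x z)" for k
    by (rule assms(4)) (use F(1) F'(1) assms(3) in auto)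
  moreover have "(\<lambda>x z. f x z + f' x z) = (\<lambda>x z. \<Sum>k\<le>max K K'. ?a k x z + ?b k x z)"
    unfolding F(2) F'(2) 1 2 sum.distrib by (rule refl)
  ultimately show ?thesis unfolding gsum_def
    by (intro exI[of _ "max K K'"] exI[of _ "\<lambda>k x z. ?a k x z + ?b k x z"]) simp
qed

lemma gsum_sum:
  assumes "\<And>i. i \<in> B \<Longrightarrow> gsum A (f i)" "\<And>j. A j (\<lambda>x z. 0)"
    "\<And>j a b. A j a \<Longrightarrow> A j b \<Longrightarrow> A j (\<lambda>x z. a x z + b x z)"
  shows "gsum A (\<lambda>x z. \<Sum>i\<in>B. f i x z)"
  using assms(1)
proof (induction B rule: infinite_finite_induct)
  case (insert b B)
  have "gsum A (\<lambda>x z. f b x z + (\<Sum>i\<in>B. f i x z))"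
    by (rule gsum_add) (use insert assms(2,3) in auto)
  then show ?case using insert.hyps by simp
qed (use gsum_single[of A 0] assms(2) in auto)

definition pair :: "nat \<Rightarrow> (nat \<Rightarrow> complex) \<Rightarrow> (nat \<Rightarrow> complex) \<Rightarrow> nat \<Rightarrow> complex" where
  "pair n x z i = (if i < n then x i else z (i - n))"

lemma gsum_Hom_single: "Hom n k f \<Longrightarrow> gsum (Hom n) f"
  by (rule gsum_single[where A = "Hom n" and k = k]) (assumption, rule Hom.Hom_zero)

lemma gsum_Hom_add: "gsum (Hom n) f \<Longrightarrow> gsum (Hom n) f' \<Longrightarrow> gsum (Hom n) (\<lambda>x z. f x z + f' x z)"
  by (rule gsum_add[where A = "Hom n"]) (assumption, assumption, rule Hom.Hom_zero, rule Hom.Hom_add)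

lemma gsum_Hom_sum: "(\<And>i. i \<in> B \<Longrightarrow> gsum (Hom n) (f i)) \<Longrightarrow> gsum (Hom n) (\<lambda>x z. \<Sum>i\<in>B. f i x z)"
  by (rule gsum_sum[where A = "Hom n"]) (assumption, rule Hom.Hom_zero, rule Hom.Hom_add)

lemma PF_graded: "h \<in> PF (n + n) \<Longrightarrow> gsum (Hom n) (\<lambda>x z. h (pair n x z))"
proof (induction rule: PF.induct)
  case (PF_const c)
  show ?case by (rule gsum_Hom_single[OF Hom.Hom_base[OF PF.PF_const]])
next
  case (PF_var i)
  show ?case
  proof (cases "i < n")
    case True
    have "gsum (Hom n) (\<lambda>x z. x i)"
      by (rule gsum_Hom_single[OF Hom.Hom_base[OF PF.PF_var[OF True]]])
    then show ?thesis unfolding pair_def using True by simp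
  next
    case False
    then have "i - n < n" using PF_var by simp
    then have "Hom n (Suc 0) (\<lambda>x z. z (i - n) * 1)" by (intro Hom.Hom_var Hom.Hom_base PF.PF_const)
    from gsum_Hom_single[OF this] have "gsum (Hom n) (\<lambda>x z. z (i - n) * 1)" .
    then show ?thesis unfolding pair_def using False by simp
  qed
next
  case (PF_add f g)
  show ?case by (rule gsum_Hom_add[OF PF_add.IH])
next
  case (PF_mult f g)
  obtain K F where F: "\<forall>k. Hom n k (F k)" "(\<lambda>x z. f (pair n x z)) = (\<lambda>x z. \<Sum>k\<le>(K::nat). F k x z)"
    using PF_mult.IH(1) unfolding gsum_def by (elim exE conjE)
  obtain K' F' where F': "\<forall>k. Hom n k (F' k)" "(\<lambda>x z. g (pair n x z)) = (\<lambda>x z. \<Sum>k\<le>(K'::nat). F' k x z)"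
    using PF_mult.IH(2) unfolding gsum_def by (elim exE conjE)
  have "gsum (Hom n) (\<lambda>x z. \<Sum>k\<le>K. \<Sum>k'\<le>K'. F k x z * F' k' x z)"
  proof (intro gsum_Hom_sum)
    show "gsum (Hom n) (\<lambda>x z. F k x z * F' k' x z)" for k k'
      by (rule gsum_Hom_single[OF Hom_mult[OF F(1)[rule_format] F'(1)[rule_format]]])
  qed
  moreover have "f (pair n x z) * g (pair n x z) = (\<Sum>k\<le>K. \<Sum>k'\<le>K'. F k x z * F' k' x z)" for x z
    using fun_cong[OF fun_cong[OF F(2), of x], of z] fun_cong[OF fun_cong[OF F'(2), of x], of z]
    by (simp add: sum_product)
  ultimately show ?case by simp
qed

lemma pspan_mono: "f \<in> pspan n B \<Longrightarrow> B \<subseteq> B' \<Longrightarrow> f \<in> pspan n B'"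
  by (induction rule: pspan.induct) (auto intro: pspan.pspan_zero pspan.pspan_step)

lemma pspan_range_finite:
  "f \<in> pspan n (range P) \<Longrightarrow> \<exists>N::nat. f \<in> pspan n (P ` {..N})"
proof (induction rule: pspan.induct)
  case pspan_zero
  show ?case using pspan.pspan_zero by blast
next
  case (pspan_step f b h)
  then obtain N j where N: "f \<in> pspan n (P ` {..N})" "b = P j" by blast
  have "f \<in> pspan n (P ` {..max N j})" by (rule pspan_mono[OF N(1)]) auto
  moreover have "b \<in> P ` {..max N j}" unfolding N(2) by simp
  ultimately have "(\<lambda>x. f x + h x * b x) \<in> pspan n (P ` {..max N j})"
    using pspan_step.hyps(3) by (rule pspan.pspan_step)
  then show ?case by blast
qed

text \<open>An expression of \<open>P (Suc N)\<close> by its predecessors has arbitrary coefficients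
  at first; only its component of degree \<open>N + 1\<close> in \<open>z\<close> counts, and there
  the coefficient of \<open>P j\<close> has degree \<open>N + 1 - j\<close>.\<close>

lemma graded_relation:
  assumes P: "\<And>j. Hom n j (P j)"
  shows "\<exists>N h. (\<forall>j\<le>N. Hom n (Suc (N - j)) (h j)) \<and> (\<forall>x z. P (Suc N) x z = (\<Sum>j\<le>N. h j x z * P j x z))"
proof -
  define PP where "PP = (\<lambda>j w. P j w (\<lambda>i. w (n + i)))"
  have PP: "PP j \<in> PF (n + n)" for j unfolding PP_def by (rule Hom_pair[OF P])
  have PPp: "PP j (pair n x z) = P j x z" for j x z
    unfolding PP_def by (rule Hom_cong[OF P]) (auto simp: pair_def)
  have "pideal (n + n) (pspan (n + n) (range PP))" by (rule pideal_pspan) (use PP in blast)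
  from hilbert_basis[OF this] obtain B where B: "finite B" "B \<subseteq> pspan (n + n) (range PP)"
    "pspan (n + n) (range PP) \<subseteq> pspan (n + n) B" by (elim exE conjE)
  from B(1,2) have "\<exists>N. B \<subseteq> pspan (n + n) (PP ` {..N})"
  proof (induction B)
    case (insert b B)
    then obtain N where N: "B \<subseteq> pspan (n + n) (PP ` {..N})" by auto
    obtain N' where N': "b \<in> pspan (n + n) (PP ` {..N'})" using insert.prems pspan_range_finite by blast
    have m: "pspan (n + n) (PP ` {..M}) \<subseteq> pspan (n + n) (PP ` {..max N N'})" if "M \<le> max N N'" for M
    proof
      fix f assume "f \<in> pspan (n + n) (PP ` {..M})"
      then show "f \<in> pspan (n + n) (PP ` {..max N N'})" by (rule pspan_mono) (use that in auto)
    qed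
    show ?case using N N' m[of N] m[of N'] by (intro exI[of _ "max N N'"]) auto
  qed auto
  then obtain N where N: "B \<subseteq> pspan (n + n) (PP ` {..N})" by blast
  have "pideal (n + n) (pspan (n + n) (PP ` {..N}))" by (rule pideal_pspan) (use PP in blast)
  from pspan_subset_ideal[OF this N] B(3) have PN: "PP (Suc N) \<in> pspan (n + n) (PP ` {..N})"
    using pspan_base[of "PP (Suc N)" "range PP" "n + n"] by blast
  \<comment> \<open>\<open>M k\<close> consists of the combinations of total degree
    \<open>k\<close>. For \<open>j > k\<close> the coefficient is set to zero explicitly, since the
    truncated difference \<open>k - j\<close> would admit degree 0.\<close>
  define M where "M = (\<lambda>k f. \<exists>h. (\<forall>j. if j \<le> k then Hom n (k - j) (h j) else h j = (\<lambda>x z. 0)) \<and> f = (\<lambda>x z. \<Sum>j\<le>N. h j x z * P j x z))"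
  have M0: "M k (\<lambda>x z. 0)" for k
    unfolding M_def by (rule exI[of _ "\<lambda>j x z. 0"]) (auto intro: Hom.Hom_zero)
  have Madd: "M k (\<lambda>x z. a x z + b x z)" if "M k a" "M k b" for k a b
  proof -
    obtain h where h: "\<forall>j. if j \<le> k then Hom n (k - j) (h j) else h j = (\<lambda>x z. 0)" "a = (\<lambda>x z. \<Sum>j\<le>N. h j x z * P j x z)"
      using \<open>M k a\<close> unfolding M_def by (elim exE conjE)
    obtain h' where h': "\<forall>j. if j \<le> k then Hom n (k - j) (h' j) else h' j = (\<lambda>x z. 0)" "b = (\<lambda>x z. \<Sum>j\<le>N. h' j x z * P j x z)"
      using \<open>M k b\<close> unfolding M_def by (elim exE conjE)
    show ?thesis unfolding M_def
    proof (rule exI[of _ "\<lambda>j x z. h j x z + h' j x z"], intro conjI allI)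
      fix j
      show "if j \<le> k then Hom n (k - j) (\<lambda>x z. h j x z + h' j x z) else (\<lambda>x z. h j x z + h' j x z) = (\<lambda>x z. 0)"
        using h(1)[rule_format, of j] h'(1)[rule_format, of j] by (cases "j \<le> k") (auto intro: Hom.Hom_add)
      show "(\<lambda>x z. a x z + b x z) = (\<lambda>x z. \<Sum>j\<le>N. (h j x z + h' j x z) * P j x z)"
        unfolding h(2) h'(2) by (simp add: distrib_right sum.distrib)
    qed
  qed
  have MP: "M (e + j) (\<lambda>x z. a x z * P j x z)" if "Hom n e a" "j \<le> N" for e j a
    unfolding M_def
  proof (rule exI[of _ "\<lambda>i x z. if i = j then a x z else 0"], intro conjI allI)
    fix i
    show "if i \<le> e + j then Hom n (e + j - i) (\<lambda>x z. if i = j then a x z else 0) else (\<lambda>x z. if i = j then a x z else 0) = (\<lambda>x z. 0)"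
      using that(1) by (cases "i = j") (auto intro: Hom.Hom_zero)
    have "(\<Sum>i\<le>N. (if i = j then a x z else 0) * P i x z) = (\<Sum>i\<le>N. if i = j then a x z * P i x z else 0)" for x z
      by (rule sum.cong) auto
    then show "(\<lambda>x z. a x z * P j x z) = (\<lambda>x z. \<Sum>i\<le>N. (if i = j then a x z else 0) * P i x z)"
      using that(2) by simp
  qed
  have "gsum M (\<lambda>x z. f (pair n x z))" if "f \<in> pspan (n + n) (PP ` {..N})" for f
    using that
  proof (induction rule: pspan.induct)
    case pspan_zero
    show ?case by (rule gsum_single[where A = M and k = 0, OF M0 M0])
  next
    case (pspan_step f b h)
    then obtain j where j: "j \<le> N" "b = PP j" by auto
    obtain K F where F: "\<forall>k. Hom n k (F k)" "(\<lambda>x z. h (pair n x z)) = (\<lambda>x z. \<Sum>k\<le>(K::nat). F k x z)"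
      using PF_graded[OF pspan_step.hyps(3)] unfolding gsum_def by (elim exE conjE)
    have "gsum M (\<lambda>x z. \<Sum>k\<le>K. F k x z * P j x z)"
    proof (rule gsum_sum[where A = M])
      show "gsum M (\<lambda>x z. F k x z * P j x z)" for k
        by (rule gsum_single[where A = M, OF MP[OF F(1)[rule_format] j(1)] M0])
    qed (rule M0, rule Madd)
    moreover have "(\<Sum>k\<le>K. F k x z * P j x z) = h (pair n x z) * b (pair n x z)" for x z
      using fun_cong[OF fun_cong[OF F(2), of x], of z] unfolding j(2) PPp by (simp add: sum_distrib_right)
    ultimately have "gsum M (\<lambda>x z. h (pair n x z) * b (pair n x z))" by simp
    from gsum_add[where A = M, OF pspan_step.IH this M0 Madd] show ?case .
  qed
  from this[OF PN] obtain K F where F: "\<forall>k. M k (F k)"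
    "(\<lambda>x z. PP (Suc N) (pair n x z)) = (\<lambda>x z. \<Sum>k\<le>(K::nat). F k x z)"
    unfolding gsum_def by (elim exE conjE)
  have PF': "P (Suc N) x z = (\<Sum>k\<le>K. F k x z)" for x z
    using fun_cong[OF fun_cong[OF F(2), of x], of z] unfolding PPp .
  have Mscale: "f x (\<lambda>i. t * z i) = t ^ k * f x z" if Mf: "M k f" for k f x z t
  proof -
    obtain h where h: "\<forall>j. if j \<le> k then Hom n (k - j) (h j) else h j = (\<lambda>x z. 0)" "f = (\<lambda>x z. \<Sum>j\<le>N. h j x z * P j x z)"
      using Mf unfolding M_def by (elim exE conjE)
    have "h j x (\<lambda>i. t * z i) * P j x (\<lambda>i. t * z i) = t ^ k * (h j x z * P j x z)" for j
    proof (cases "j \<le> k")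
      case True
      then have "h j x (\<lambda>i. t * z i) = t ^ (k - j) * h j x z" using h(1)[rule_format, of j] by (intro Hom_scale) simp
      moreover have "P j x (\<lambda>i. t * z i) = t ^ j * P j x z" by (rule Hom_scale[OF P])
      moreover have "t ^ k = t ^ (k - j) * t ^ j" using True by (simp flip: power_add)
      ultimately show ?thesis by (simp add: mult_ac)
    next
      case False
      then show ?thesis using h(1)[rule_format, of j] by simp
    qed
    then show ?thesis unfolding h(2) by (simp add: sum_distrib_left)
  qed
  \<comment> \<open>Replacing \<open>z\<close> by \<open>t * z\<close> multiplies the component of
    degree \<open>k\<close> by \<open>t ^ k\<close>, so comparing powers of \<open>t\<close>
    extracts degree \<open>N + 1\<close>.\<close>
  have coeff: "P (Suc N) x z = (if Suc N \<le> K then F (Suc N) x z else 0)" for x z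
  proof -
    let ?m = "max K (Suc N)"
    let ?a = "\<lambda>k. if k \<le> K then F k x z else 0" and ?b = "\<lambda>k. if k = Suc N then P (Suc N) x z else 0"
    have "(\<Sum>k\<le>?m. ?a k * t ^ k) = (\<Sum>k\<le>?m. ?b k * t ^ k)" for t
    proof -
      have sc: "F k x (\<lambda>i. t * z i) = F k x z * t ^ k" for k
        using Mscale[OF F(1)[rule_format], of k x t z] by simp
      have "(\<Sum>k\<le>?m. ?a k * t ^ k) = (\<Sum>k\<le>K. F k x (\<lambda>i. t * z i))"
        by (intro sum.mono_neutral_cong_right) (auto simp: sc)
      also have "\<dots> = P (Suc N) x (\<lambda>i. t * z i)" by (rule PF'[symmetric])
      also have "\<dots> = t ^ Suc N * P (Suc N) x z" by (rule Hom_scale[OF P])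
      also have "\<dots> = (\<Sum>k\<le>?m. if k = Suc N then P (Suc N) x z * t ^ k else 0)" by (simp add: mult.commute)
      also have "\<dots> = (\<Sum>k\<le>?m. ?b k * t ^ k)" by (rule sum.cong) auto
      finally show ?thesis .
    qed
    then have "\<forall>k\<le>?m. ?a k = ?b k" using polyfun_eq_coeffs[of ?a ?m ?b] by blast
    from this[rule_format, of "Suc N"] show ?thesis by simp
  qed
  show ?thesis
  proof (cases "Suc N \<le> K")
    case True
    obtain h where h: "\<forall>j. if j \<le> Suc N then Hom n (Suc N - j) (h j) else h j = (\<lambda>x z. 0)"
      "F (Suc N) = (\<lambda>x z. \<Sum>j\<le>N. h j x z * P j x z)"
      using F(1)[rule_format, of "Suc N"] unfolding M_def by (elim exE conjE)
    have "Hom n (Suc (N - j)) (h j)" if "j \<le> N" for j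
      using h(1)[rule_format, of j] that by (simp add: Suc_diff_le)
    then show ?thesis using coeff True h(2) by (intro exI[of _ N] exI[of _ h]) simp
  next
    case False
    then show ?thesis using coeff
      by (intro exI[of _ N] exI[of _ "\<lambda>j x z. 0"]) (simp add: Hom.Hom_zero)
  qed
qed

text \<open>Apply the Hilbert basis theorem to the ideal of all \<open>P j x z\<close> in \<open>2 n\<close> variables: some \<open>P (Suc N)\<close> is a combination of
  the earlier ones with coefficients of positive degree in \<open>z\<close>, and on the diagonal all of them are congruent to \<open>p\<close>.\<close>

theorem krull_intersection:
  assumes p: "p \<in> PF n" and P: "\<And>j. Hom n j (P j)" "\<And>j. (\<lambda>x. p x - P j x x) \<in> pspan n B"
  shows "\<exists>s\<in>PF n. s (\<lambda>i. 0) = 1 \<and> (\<lambda>x. s x * p x) \<in> pspan n B"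
proof -
  obtain N h where h: "\<forall>j\<le>N. Hom n (Suc (N - j)) (h j)" "\<forall>x z. P (Suc N) x z = (\<Sum>j\<le>N. h j x z * P j x z)"
    using graded_relation[of n P, OF P(1)] by (elim exE conjE)
  define s where "s = (\<lambda>x. 1 - (\<Sum>j\<le>N. h j x x))"
  have hP: "(\<lambda>x. h j x x) \<in> PF n" if "j \<le> N" for j using h(1) that Hom_diag by blast
  have "s \<in> PF n" unfolding s_def by (intro PF_diff PF.PF_const PF_sum hP) auto
  moreover have "h j (\<lambda>i. 0) (\<lambda>i. 0) = 0" if "j \<le> N" for j
    by (rule Hom_Suc_0[OF h(1)[rule_format, OF that]])
  then have "s (\<lambda>i. 0) = 1" unfolding s_def by simp
  moreover have "(\<lambda>x. s x * p x) \<in> pspan n B"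
  proof -
    have "(\<lambda>x. \<Sum>j\<le>N. h j x x * (p x - P j x x)) \<in> pspan n B"
      by (rule pspan_sum, rule pspan_mult[OF P(2) hP]) simp
    from pspan_diff[OF P(2) this]
    have "(\<lambda>x. (p x - P (Suc N) x x) - (\<Sum>j\<le>N. h j x x * (p x - P j x x))) \<in> pspan n B" .
    moreover have "(p x - P (Suc N) x x) - (\<Sum>j\<le>N. h j x x * (p x - P j x x)) = s x * p x" for x
      using h(2) by (simp add: s_def right_diff_distrib sum_subtractf left_diff_distrib sum_distrib_right)
    ultimately show ?thesis by simp
  qed
  ultimately show ?thesis by blast
qed

subsection \<open>Local solutions\<close>

definition nrm :: "nat \<Rightarrow> (nat \<Rightarrow> complex) \<Rightarrow> real" where
  "nrm n x = (\<Sum>k<n. cmod (x k))"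

lemma nrm_nonneg: "0 \<le> nrm n x"
  unfolding nrm_def by (rule sum_nonneg) simp

lemma nrm_coord: "k < n \<Longrightarrow> cmod (x k) \<le> nrm n x"
  unfolding nrm_def by (rule member_le_sum) auto

text \<open>On the unit ball polynomial functions are bounded, which keeps products Lipschitz in the
  induction.\<close>

lemma PF_lipschitz:
  "f \<in> PF n \<Longrightarrow> \<exists>K\<ge>0. \<forall>x y. nrm n x \<le> 1 \<longrightarrow> nrm n y \<le> 1 \<longrightarrow> cmod (f x - f y) \<le> K * nrm n (\<lambda>i. x i - y i)"
proof (induction rule: PF.induct)
  case (PF_const c)
  show ?case by (rule exI[of _ 0]) simp
next
  case (PF_var i)
  show ?case
    by (rule exI[of _ 1]) (use nrm_coord[OF PF_var, of "\<lambda>i. _ i - _ i"] in simp)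
next
  case (PF_add f g)
  obtain K where K: "K \<ge> 0" "\<And>x y. nrm n x \<le> 1 \<Longrightarrow> nrm n y \<le> 1 \<Longrightarrow> cmod (f x - f y) \<le> K * nrm n (\<lambda>i. x i - y i)"
    using PF_add.IH(1) by blast
  obtain K' where K': "K' \<ge> 0" "\<And>x y. nrm n x \<le> 1 \<Longrightarrow> nrm n y \<le> 1 \<Longrightarrow> cmod (g x - g y) \<le> K' * nrm n (\<lambda>i. x i - y i)"
    using PF_add.IH(2) by blast
  show ?case
  proof (rule exI[of _ "K + K'"], intro conjI allI impI)
    show "0 \<le> K + K'" using K(1) K'(1) by simp
    fix x y assume xy: "nrm n x \<le> 1" "nrm n y \<le> 1"
    have "f x + g x - (f y + g y) = (f x - f y) + (g x - g y)" by simp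
    then have "cmod (f x + g x - (f y + g y)) \<le> cmod (f x - f y) + cmod (g x - g y)"
      using norm_triangle_ineq by metis
    then show "cmod (f x + g x - (f y + g y)) \<le> (K + K') * nrm n (\<lambda>i. x i - y i)"
      using K(2)[OF xy] K'(2)[OF xy] by (simp add: distrib_right)
  qed
next
  case (PF_mult f g)
  obtain K where K: "K \<ge> 0" "\<And>x y. nrm n x \<le> 1 \<Longrightarrow> nrm n y \<le> 1 \<Longrightarrow> cmod (f x - f y) \<le> K * nrm n (\<lambda>i. x i - y i)"
    using PF_mult.IH(1) by blast
  obtain K' where K': "K' \<ge> 0" "\<And>x y. nrm n x \<le> 1 \<Longrightarrow> nrm n y \<le> 1 \<Longrightarrow> cmod (g x - g y) \<le> K' * nrm n (\<lambda>i. x i - y i)"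
    using PF_mult.IH(2) by blast
  have z: "nrm n (\<lambda>i. 0) \<le> 1" by (simp add: nrm_def)
  define B where "B = cmod (f (\<lambda>i. 0)) + K"
  define B' where "B' = cmod (g (\<lambda>i. 0)) + K'"
  have fB: "cmod (f x) \<le> B" if "nrm n x \<le> 1" for x
  proof -
    have "cmod (f x - f (\<lambda>i. 0)) \<le> K * nrm n x" using K(2)[OF that z] by simp
    also have "\<dots> \<le> K * 1" using that K(1) by (intro mult_left_mono) auto
    finally show ?thesis unfolding B_def using norm_triangle_sub[of "f x" "f (\<lambda>i. 0)"] by simp
  qed
  have gB: "cmod (g x) \<le> B'" if "nrm n x \<le> 1" for x
  proof -
    have "cmod (g x - g (\<lambda>i. 0)) \<le> K' * nrm n x" using K'(2)[OF that z] by simp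
    also have "\<dots> \<le> K' * 1" using that K'(1) by (intro mult_left_mono) auto
    finally show ?thesis unfolding B'_def using norm_triangle_sub[of "g x" "g (\<lambda>i. 0)"] by simp
  qed
  have B0: "B \<ge> 0" "B' \<ge> 0" unfolding B_def B'_def using K(1) K'(1) by auto
  show ?case
  proof (rule exI[of _ "B * K' + B' * K"], intro conjI allI impI)
    show "0 \<le> B * K' + B' * K" using K(1) K'(1) B0 by simp
    fix x y assume xy: "nrm n x \<le> 1" "nrm n y \<le> 1"
    have "f x * g x - f y * g y = f x * (g x - g y) + g y * (f x - f y)" by (simp add: algebra_simps)
    then have "cmod (f x * g x - f y * g y) \<le> cmod (f x) * cmod (g x - g y) + cmod (g y) * cmod (f x - f y)"
      using norm_triangle_ineq norm_mult by metis
    also have "\<dots> \<le> B * (K' * nrm n (\<lambda>i. x i - y i)) + B' * (K * nrm n (\<lambda>i. x i - y i))"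
      by (intro add_mono mult_mono fB gB K(2) K'(2) xy B0 norm_ge_zero)
    finally show "cmod (f x * g x - f y * g y) \<le> (B * K' + B' * K) * nrm n (\<lambda>i. x i - y i)"
      by (simp add: algebra_simps)
  qed
qed

lemma PF_bounded:
  assumes "f \<in> PF n" shows "\<exists>B\<ge>0. \<forall>x. nrm n x \<le> 1 \<longrightarrow> cmod (f x) \<le> B"
proof -
  obtain K where K: "K \<ge> 0" "\<And>x y. nrm n x \<le> 1 \<Longrightarrow> nrm n y \<le> 1 \<Longrightarrow> cmod (f x - f y) \<le> K * nrm n (\<lambda>i. x i - y i)"
    using PF_lipschitz[OF assms] by blast
  have z: "nrm n (\<lambda>i. 0) \<le> 1" by (simp add: nrm_def)
  have "cmod (f x) \<le> cmod (f (\<lambda>i. 0)) + K" if "nrm n x \<le> 1" for x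
  proof -
    have "cmod (f x - f (\<lambda>i. 0)) \<le> K * nrm n x" using K(2)[OF that z] by simp
    also have "\<dots> \<le> K * 1" using that K(1) by (intro mult_left_mono) auto
    finally show ?thesis using norm_triangle_sub[of "f x" "f (\<lambda>i. 0)"] by simp
  qed
  then show ?thesis using K(1) by (intro exI[of _ "cmod (f (\<lambda>i. 0)) + K"]) auto
qed

lemma PF_tendsto:
  "f \<in> PF n \<Longrightarrow> (\<And>k. k < n \<Longrightarrow> (\<lambda>t. y t k) \<longlonglongrightarrow> Y k) \<Longrightarrow> (\<lambda>t. f (y t)) \<longlonglongrightarrow> f Y"
  by (induction rule: PF.induct) (auto intro: tendsto_intros)

lemma Hom_bound:
  "Hom n j P \<Longrightarrow> \<exists>K\<ge>0. \<forall>x z. nrm n x \<le> 1 \<longrightarrow> cmod (P x z) \<le> K * nrm n z ^ j"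
proof (induction rule: Hom.induct)
  case (Hom_base f)
  then show ?case using PF_bounded by simp
next
  case (Hom_zero j)
  show ?case by (rule exI[of _ 0]) simp
next
  case (Hom_add j P Q)
  obtain K where K: "K \<ge> 0" "\<And>x z. nrm n x \<le> 1 \<Longrightarrow> cmod (P x z) \<le> K * nrm n z ^ j" using Hom_add.IH(1) by blast
  obtain K' where K': "K' \<ge> 0" "\<And>x z. nrm n x \<le> 1 \<Longrightarrow> cmod (Q x z) \<le> K' * nrm n z ^ j" using Hom_add.IH(2) by blast
  show ?case
  proof (rule exI[of _ "K + K'"], intro conjI allI impI)
    show "0 \<le> K + K'" using K(1) K'(1) by simp
    fix x z assume "nrm n x \<le> 1"
    then show "cmod (P x z + Q x z) \<le> (K + K') * nrm n z ^ j"
      using K(2)[of x z] K'(2)[of x z] norm_triangle_ineq[of "P x z" "Q x z"] by (simp add: distrib_right)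
  qed
next
  case (Hom_var j P i)
  obtain K where K: "K \<ge> 0" "\<And>x z. nrm n x \<le> 1 \<Longrightarrow> cmod (P x z) \<le> K * nrm n z ^ j" using Hom_var.IH by blast
  show ?case
  proof (rule exI[of _ K], intro conjI allI impI)
    show "0 \<le> K" by (rule K(1))
    fix x z assume x: "nrm n x \<le> 1"
    have "cmod (z i) * cmod (P x z) \<le> nrm n z * (K * nrm n z ^ j)"
      by (intro mult_mono nrm_coord K(2) x Hom_var.hyps nrm_nonneg norm_ge_zero)
    then show "cmod (z i * P x z) \<le> K * nrm n z ^ Suc j" by (simp add: norm_mult mult_ac)
  qed
qed

context core
begin

definition NS :: "(nat \<Rightarrow> complex) \<Rightarrow> real" where
  "NS a = (\<Sum>s\<in>S. cmod (a s))"

definition R :: "nat \<Rightarrow> (nat \<Rightarrow> complex) \<Rightarrow> complex" where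
  "R i x = (\<Sum>k<n. x k * q i k x)"

lemma NS_nonneg: "0 \<le> NS a"
  unfolding NS_def by (rule sum_nonneg) simp

lemma nrm_split: "nrm n x = NS x + (\<Sum>i\<in>C. cmod (x i))"
  unfolding nrm_def NS_def using sum.subset_diff[OF C finite_lessThan, of "\<lambda>k. cmod (x k)"] S by simp

lemma R_PF: "R i \<in> PF n"
  unfolding R_def by (intro PF_sum PF.PF_mult PF.PF_var q_PF) auto

lemma R_0: "R i (\<lambda>i. 0) = 0"
  unfolding R_def by simp

text \<open>On the ball of radius \<open>\<delta>\<close> both factors of
  \<open>x k * q i k x\<close> are of order \<open>\<delta>\<close>, so the product has Lipschitz
  constant at most \<open>2 * \<delta> * K i k\<close>. The choice
  \<open>\<delta> = 1 / (4 * T + 4)\<close> brings the sum of these constants down to at most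
  1/2.\<close>

lemma R_contraction:
  "\<exists>\<delta>>0. \<delta> \<le> 1 \<and> (\<forall>x y. nrm n x \<le> \<delta> \<longrightarrow> nrm n y \<le> \<delta> \<longrightarrow>
     (\<Sum>i\<in>C. cmod (R i x - R i y)) \<le> (1/2) * nrm n (\<lambda>k. x k - y k))"
proof -
  have "\<forall>i. \<forall>k. \<exists>K\<ge>0. \<forall>x y. nrm n x \<le> 1 \<longrightarrow> nrm n y \<le> 1 \<longrightarrow> cmod (q i k x - q i k y) \<le> K * nrm n (\<lambda>i. x i - y i)"
    using PF_lipschitz[OF q_PF] by blast
  then obtain K where K: "\<And>i k. K i k \<ge> 0"
    "\<And>i k x y. nrm n x \<le> 1 \<Longrightarrow> nrm n y \<le> 1 \<Longrightarrow> cmod (q i k x - q i k y) \<le> K i k * nrm n (\<lambda>i. x i - y i)" by metis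
  define T where "T = (\<Sum>i\<in>C. \<Sum>k<n. K i k)"
  have T: "T \<ge> 0" unfolding T_def by (intro sum_nonneg K(1))
  define \<delta> where "\<delta> = 1 / (4 * T + 4)"
  have \<delta>: "\<delta> > 0" "\<delta> \<le> 1" "2 * \<delta> * T \<le> 1/2" unfolding \<delta>_def using T by (auto simp: field_simps)
  have z: "nrm n (\<lambda>i. 0) \<le> 1" by (simp add: nrm_def)
  have "(\<Sum>i\<in>C. cmod (R i x - R i y)) \<le> (1/2) * nrm n (\<lambda>k. x k - y k)" if xy: "nrm n x \<le> \<delta>" "nrm n y \<le> \<delta>" for x y
  proof -
    let ?D = "nrm n (\<lambda>k. x k - y k)"
    have xy1: "nrm n x \<le> 1" "nrm n y \<le> 1" using xy \<delta>(2) by auto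
    have one: "cmod (x k * q i k x - y k * q i k y) \<le> 2 * \<delta> * ?D * K i k" if k: "k < n" for i k
    proof -
      have "cmod (q i k y - q i k (\<lambda>i. 0)) \<le> K i k * nrm n y" using K(2)[OF xy1(2) z] by simp
      also have "\<dots> \<le> K i k * \<delta>" using xy(2) K(1) by (intro mult_left_mono) auto
      finally have qy: "cmod (q i k y) \<le> K i k * \<delta>" by (simp add: q_0)
      have "x k * q i k x - y k * q i k y = x k * (q i k x - q i k y) + (x k - y k) * q i k y"
        by (simp add: algebra_simps)
      then have "cmod (x k * q i k x - y k * q i k y) \<le> cmod (x k) * cmod (q i k x - q i k y) + cmod (x k - y k) * cmod (q i k y)"
        using norm_triangle_ineq norm_mult by metis
      also have "\<dots> \<le> \<delta> * (K i k * ?D) + ?D * (K i k * \<delta>)"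
        by (intro add_mono mult_mono K(2) xy1 qy order.trans[OF nrm_coord[OF k] xy(1)]
            nrm_coord[OF k, of "\<lambda>k. x k - y k"] nrm_nonneg norm_ge_zero) (use \<delta> in auto)
      finally show ?thesis by (simp add: algebra_simps)
    qed
    have "(\<Sum>i\<in>C. cmod (R i x - R i y)) \<le> (\<Sum>i\<in>C. \<Sum>k<n. 2 * \<delta> * ?D * K i k)"
    proof (rule sum_mono)
      fix i
      have "cmod (R i x - R i y) = cmod (\<Sum>k<n. x k * q i k x - y k * q i k y)"
        unfolding R_def by (simp add: sum_subtractf)
      also have "\<dots> \<le> (\<Sum>k<n. 2 * \<delta> * ?D * K i k)"
        by (rule order.trans[OF norm_sum]) (rule sum_mono, use one in auto)
      finally show "cmod (R i x - R i y) \<le> (\<Sum>k<n. 2 * \<delta> * ?D * K i k)" .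
    qed
    also have "\<dots> = (2 * \<delta> * T) * ?D" unfolding T_def by (simp add: sum_distrib_left sum_distrib_right mult_ac)
    also have "\<dots> \<le> (1/2) * ?D" using \<delta>(3) nrm_nonneg by (intro mult_right_mono) auto
    finally show ?thesis .
  qed
  then show ?thesis using \<delta>(1,2) by blast
qed

text \<open>Fixed point iteration for the variables in \<open>C\<close>, with the free ones held at
  \<open>a\<close>. The radius \<open>2 * l\<close> is preserved because a vector of norm at most
  \<open>2 * l\<close> is mapped to one of norm at most \<open>l + (1/2) * (2 * l)\<close>;
  successive differences halve, so the iterates converge.\<close>

lemma ex_local_solution:
  assumes \<delta>: "\<delta> \<le> 1" "\<And>x y. nrm n x \<le> \<delta> \<Longrightarrow> nrm n y \<le> \<delta> \<Longrightarrow>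
     (\<Sum>i\<in>C. cmod (R i x - R i y)) \<le> (1/2) * nrm n (\<lambda>k. x k - y k)"
    and lam: "NS a + (\<Sum>i\<in>C. cmod (\<Sum>s\<in>S. L i s * a s)) \<le> l" and l: "2 * l \<le> \<delta>"
  shows "\<exists>Y. Y \<in> cspace n \<and> (\<forall>i\<in>C. g i Y = 0) \<and> (\<forall>s\<in>S. Y s = a s) \<and> nrm n Y \<le> 2 * l"
proof -
  define \<Phi> where "\<Phi> = (\<lambda>y i. if i \<in> C then (\<Sum>s\<in>S. L i s * a s) + R i y else if i \<in> S then a i else 0)"
  define y where "y = (\<lambda>t. (\<Phi> ^^ t) (\<lambda>i. 0))"
  have y0: "y 0 = (\<lambda>i. 0)" and yS: "y (Suc t) = \<Phi> (y t)" for t unfolding y_def by auto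
  have disj: "s \<notin> C" if "s \<in> S" for s using that S by blast
  have z: "nrm n (\<lambda>i. 0) = 0" by (simp add: nrm_def)
  have l0: "0 \<le> l" using lam NS_nonneg[of a] sum_nonneg[of C "\<lambda>i. cmod (\<Sum>s\<in>S. L i s * a s)"] by simp
  have NS\<Phi>: "NS (\<Phi> v) = NS a" for v
    unfolding NS_def \<Phi>_def by (rule sum.cong) (use disj in auto)
  have bound: "nrm n (\<Phi> v) \<le> l + (1/2) * nrm n v" if "nrm n v \<le> \<delta>" for v
  proof -
    have "(\<Sum>i\<in>C. cmod (\<Phi> v i)) \<le> (\<Sum>i\<in>C. cmod (\<Sum>s\<in>S. L i s * a s) + cmod (R i v - R i (\<lambda>i. 0)))"
      by (rule sum_mono) (simp add: \<Phi>_def R_0 norm_triangle_ineq)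
    also have "\<dots> = (\<Sum>i\<in>C. cmod (\<Sum>s\<in>S. L i s * a s)) + (\<Sum>i\<in>C. cmod (R i v - R i (\<lambda>i. 0)))"
      by (rule sum.distrib)
    also have "(\<Sum>i\<in>C. cmod (R i v - R i (\<lambda>i. 0))) \<le> (1/2) * nrm n v"
      using \<delta>(2)[OF that, of "\<lambda>i. 0"] z l l0 by simp
    finally show ?thesis unfolding nrm_split[of "\<Phi> v"] NS\<Phi> using lam by simp
  qed
  have yb: "nrm n (y t) \<le> 2 * l" for t
  proof (induction t)
    case 0
    then show ?case using l0 by (simp add: y0 z)
  next
    case (Suc t)
    have "nrm n (\<Phi> (y t)) \<le> l + (1/2) * nrm n (y t)" by (rule bound) (use Suc l in simp)
    then show ?case using Suc by (simp add: yS)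
  qed
  have y\<delta>: "nrm n (y t) \<le> \<delta>" for t using yb l order.trans by blast
  define c where "c = nrm n (\<lambda>k. y (Suc 0) k - y 0 k)"
  have step: "nrm n (\<lambda>k. y (Suc t) k - y t k) \<le> (1/2) ^ t * c" for t
  proof (induction t)
    case 0
    show ?case by (simp add: c_def)
  next
    case (Suc t)
    have "nrm n (\<lambda>k. y (Suc (Suc t)) k - y (Suc t) k) = (\<Sum>i\<in>C. cmod (R i (y (Suc t)) - R i (y t)))"
    proof -
      have "NS (\<lambda>k. \<Phi> (y (Suc t)) k - \<Phi> (y t) k) = 0"
        unfolding NS_def by (rule sum.neutral) (use disj in \<open>auto simp: \<Phi>_def\<close>)
      moreover have "(\<Sum>i\<in>C. cmod (\<Phi> (y (Suc t)) i - \<Phi> (y t) i)) = (\<Sum>i\<in>C. cmod (R i (y (Suc t)) - R i (y t)))"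
        by (rule sum.cong) (auto simp: \<Phi>_def)
      ultimately show ?thesis unfolding nrm_split yS[of "Suc t"] yS[of t] by (simp add: yS)
    qed
    also have "\<dots> \<le> (1/2) * nrm n (\<lambda>k. y (Suc t) k - y t k)" by (intro \<delta>(2) y\<delta>)
    also have "\<dots> \<le> (1/2) * ((1/2) ^ t * c)" using Suc by (intro mult_left_mono) auto
    finally show ?case by (simp add: mult_ac)
  qed
  have conv: "\<exists>Z. (\<lambda>t. y t k) \<longlonglongrightarrow> Z" if "k < n" for k
  proof -
    have "summable (\<lambda>t. y (Suc t) k - y t k)"
    proof (rule summable_comparison_test')
      show "summable (\<lambda>t. (1/2) ^ t * c)" by (intro summable_mult2 summable_geometric) simp
      show "norm (y (Suc t) k - y t k) \<le> (1/2) ^ t * c" if "t \<ge> 0" for t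
        using nrm_coord[OF \<open>k < n\<close>, of "\<lambda>k. y (Suc t) k - y t k"] step[of t] by simp
    qed
    from summable_LIMSEQ[OF this] have "(\<lambda>t. y t k) \<longlonglongrightarrow> suminf (\<lambda>t. y (Suc t) k - y t k)"
      unfolding sum_lessThan_telescope[of "\<lambda>t. y t k"] by (simp add: y0)
    then show ?thesis by blast
  qed
  define Y where "Y = (\<lambda>k. if k < n then lim (\<lambda>t. y t k) else 0)"
  have Yl: "(\<lambda>t. y t k) \<longlonglongrightarrow> Y k" if "k < n" for k
    using conv[OF that] that unfolding Y_def by (auto simp: limI)
  have YS: "Y s = a s" if "s \<in> S" for s
  proof -
    have sn: "s < n" using that S by auto
    have "(\<lambda>t. y (Suc t) s) \<longlonglongrightarrow> Y s" using LIMSEQ_Suc[OF Yl[OF sn]] .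
    moreover have "y (Suc t) s = a s" for t using that disj by (simp add: yS \<Phi>_def)
    ultimately have "(\<lambda>t. a s) \<longlonglongrightarrow> Y s" by simp
    then show ?thesis using LIMSEQ_unique[OF tendsto_const] by metis
  qed
  have gY: "g i Y = 0" if "i \<in> C" for i
  proof -
    have "i < n" using that C by auto
    have 1: "(\<lambda>t. y (Suc t) i) \<longlonglongrightarrow> Y i" using LIMSEQ_Suc[OF Yl[OF \<open>i < n\<close>]] .
    have "(\<lambda>t. (\<Sum>s\<in>S. L i s * a s) + R i (y t)) \<longlonglongrightarrow> (\<Sum>s\<in>S. L i s * a s) + R i Y"
      by (intro tendsto_add tendsto_const PF_tendsto[OF R_PF] Yl)
    moreover have "y (Suc t) i = (\<Sum>s\<in>S. L i s * a s) + R i (y t)" for t using that by (simp add: yS \<Phi>_def)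
    ultimately have "(\<lambda>t. y (Suc t) i) \<longlonglongrightarrow> (\<Sum>s\<in>S. L i s * a s) + R i Y" by simp
    from LIMSEQ_unique[OF 1 this] have "Y i = (\<Sum>s\<in>S. L i s * a s) + R i Y" .
    moreover have "(\<Sum>s\<in>S. L i s * Y s) = (\<Sum>s\<in>S. L i s * a s)" by (rule sum.cong) (auto simp: YS)
    ultimately show ?thesis unfolding g[OF that] R_def by simp
  qed
  have "nrm n Y \<le> 2 * l"
  proof (rule LIMSEQ_le_const2)
    show "(\<lambda>t. nrm n (y t)) \<longlonglongrightarrow> nrm n Y" unfolding nrm_def
      by (intro tendsto_sum tendsto_norm Yl) auto
  qed (use yb in blast)
  moreover have "Y \<in> cspace n" unfolding Y_def cspace_def by auto
  ultimately show ?thesis using gY YS by blast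
qed

lemma local_unique:
  assumes \<delta>: "\<And>x y. nrm n x \<le> \<delta> \<Longrightarrow> nrm n y \<le> \<delta> \<Longrightarrow>
     (\<Sum>i\<in>C. cmod (R i x - R i y)) \<le> (1/2) * nrm n (\<lambda>k. x k - y k)"
    and xy: "nrm n x \<le> \<delta>" "nrm n y \<le> \<delta>" "\<And>i. i \<in> C \<Longrightarrow> g i x = 0" "\<And>i. i \<in> C \<Longrightarrow> g i y = 0"
      "\<And>s. s \<in> S \<Longrightarrow> x s = y s" and k: "k < n"
  shows "x k = y k"
proof -
  have d: "x i - y i = R i x - R i y" if "i \<in> C" for i
  proof -
    have "(\<Sum>s\<in>S. L i s * x s) = (\<Sum>s\<in>S. L i s * y s)" by (rule sum.cong) (auto simp: xy(5))
    then show ?thesis using xy(3,4)[OF that] unfolding g[OF that] R_def[symmetric] by (simp add: algebra_simps)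
  qed
  have "nrm n (\<lambda>k. x k - y k) = (\<Sum>i\<in>C. cmod (R i x - R i y))"
    unfolding nrm_split using d xy(5) by (simp add: NS_def)
  also have "\<dots> \<le> (1/2) * nrm n (\<lambda>k. x k - y k)" by (rule \<delta>[OF xy(1,2)])
  finally have "nrm n (\<lambda>k. x k - y k) \<le> 0" by simp
  then have "cmod (x k - y k) \<le> 0" by (rule order.trans[OF nrm_coord[OF k, of "\<lambda>k. x k - y k"]])
  then show ?thesis by simp
qed

end

text \<open>\<open>Y a\<close> is the solution with free coordinates \<open>a\<close>, available
  when \<open>a\<close> has size less than \<open>\<epsilon>\<close>; \<open>\<delta>\<close> is the
  radius of uniqueness, and \<open>\<Lambda>\<close> bounds \<open>Y\<close> linearly, so that the
  solution over a ray shrinks like the parameter of the ray.\<close>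

locale core_solution = core +
  fixes \<delta> \<epsilon> \<Lambda> :: real and Y :: "(nat \<Rightarrow> complex) \<Rightarrow> nat \<Rightarrow> complex"
  assumes pos: "\<delta> > 0" "\<delta> \<le> 1" "\<epsilon> > 0" "\<Lambda> \<ge> 0"
    and unique: "\<And>x y k. nrm n x \<le> \<delta> \<Longrightarrow> nrm n y \<le> \<delta> \<Longrightarrow> (\<And>i. i \<in> C \<Longrightarrow> g i x = 0) \<Longrightarrow>
      (\<And>i. i \<in> C \<Longrightarrow> g i y = 0) \<Longrightarrow> (\<And>s. s \<in> S \<Longrightarrow> x s = y s) \<Longrightarrow> k < n \<Longrightarrow> x k = y k"
    and Y: "\<And>a. NS a < \<epsilon> \<Longrightarrow> Y a \<in> cspace n" "\<And>a i. NS a < \<epsilon> \<Longrightarrow> i \<in> C \<Longrightarrow> g i (Y a) = 0"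
      "\<And>a s. NS a < \<epsilon> \<Longrightarrow> s \<in> S \<Longrightarrow> Y a s = a s" "\<And>a. NS a < \<epsilon> \<Longrightarrow> nrm n (Y a) \<le> \<Lambda> * NS a"
      "\<And>a. NS a < \<epsilon> \<Longrightarrow> nrm n (Y a) \<le> \<delta>"

lemma (in core) ex_core_solution: "\<exists>\<delta> \<epsilon> \<Lambda> Y. core_solution n C g L q S \<delta> \<epsilon> \<Lambda> Y"
proof -
  obtain \<delta> where \<delta>: "\<delta> > 0" "\<delta> \<le> 1" "\<And>x y. nrm n x \<le> \<delta> \<Longrightarrow> nrm n y \<le> \<delta> \<Longrightarrow>
     (\<Sum>i\<in>C. cmod (R i x - R i y)) \<le> (1/2) * nrm n (\<lambda>k. x k - y k)"
    using R_contraction by blast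
  define T where "T = 1 + (\<Sum>i\<in>C. \<Sum>s\<in>S. cmod (L i s))"
  have T: "T \<ge> 1" unfolding T_def by (simp add: sum_nonneg)
  have lam: "NS a + (\<Sum>i\<in>C. cmod (\<Sum>s\<in>S. L i s * a s)) \<le> T * NS a" for a
  proof -
    have "(\<Sum>i\<in>C. cmod (\<Sum>s\<in>S. L i s * a s)) \<le> (\<Sum>i\<in>C. \<Sum>s\<in>S. cmod (L i s) * NS a)"
    proof (rule sum_mono)
      fix i
      have "cmod (\<Sum>s\<in>S. L i s * a s) \<le> (\<Sum>s\<in>S. cmod (L i s * a s))" by (rule norm_sum)
      also have "\<dots> \<le> (\<Sum>s\<in>S. cmod (L i s) * NS a)"
      proof (rule sum_mono)
        fix s assume "s \<in> S"
        then have "cmod (a s) \<le> NS a" unfolding NS_def using finS by (intro member_le_sum) auto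
        then show "cmod (L i s * a s) \<le> cmod (L i s) * NS a" by (simp add: norm_mult mult_left_mono)
      qed
      finally show "cmod (\<Sum>s\<in>S. L i s * a s) \<le> (\<Sum>s\<in>S. cmod (L i s) * NS a)" .
    qed
    also have "\<dots> = (T - 1) * NS a" unfolding T_def by (simp add: sum_distrib_right)
    finally show ?thesis by (simp add: algebra_simps)
  qed
  define \<epsilon> where "\<epsilon> = \<delta> / (2 * T)"
  have small: "2 * (T * NS a) \<le> \<delta>" if "NS a < \<epsilon>" for a
    using that T unfolding \<epsilon>_def by (simp add: field_simps)
  have "\<forall>a. \<exists>Y. NS a < \<epsilon> \<longrightarrow> (Y \<in> cspace n \<and> (\<forall>i\<in>C. g i Y = 0) \<and> (\<forall>s\<in>S. Y s = a s) \<and> nrm n Y \<le> 2 * (T * NS a))"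
    using ex_local_solution[OF \<delta>(2,3) lam small] by blast
  from choice[OF this] obtain Y where "\<forall>a. NS a < \<epsilon> \<longrightarrow> (Y a \<in> cspace n \<and> (\<forall>i\<in>C. g i (Y a) = 0) \<and> (\<forall>s\<in>S. Y a s = a s) \<and> nrm n (Y a) \<le> 2 * (T * NS a))"
    by (elim exE)
  then have Y: "Y a \<in> cspace n" "i \<in> C \<Longrightarrow> g i (Y a) = 0" "s \<in> S \<Longrightarrow> Y a s = a s" "nrm n (Y a) \<le> 2 * (T * NS a)"
    if "NS a < \<epsilon>" for a i s using that by blast+
  have "core_solution n C g L q S \<delta> \<epsilon> (2 * T) Y"
  proof
    show "\<delta> > 0" "\<delta> \<le> 1" "\<epsilon> > 0" "2 * T \<ge> 0" using \<delta> T unfolding \<epsilon>_def by auto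
    show "x k = y k" if "nrm n x \<le> \<delta>" "nrm n y \<le> \<delta>" "\<And>i. i \<in> C \<Longrightarrow> g i x = 0" "\<And>i. i \<in> C \<Longrightarrow> g i y = 0"
      "\<And>s. s \<in> S \<Longrightarrow> x s = y s" "k < n" for x y k
      by (rule local_unique[OF \<delta>(3)]) (use that in auto)
    show "nrm n (Y a) \<le> 2 * T * NS a" if "NS a < \<epsilon>" for a using Y(4)[OF that] by simp
    show "nrm n (Y a) \<le> \<delta>" if "NS a < \<epsilon>" for a using Y(4)[OF that] small[OF that] by simp
  qed (use Y in auto)
  then show ?thesis by blast
qed

section \<open>The prime ideal of the germ of real solutions\<close>

context core_solution
begin

definition realv :: "(nat \<Rightarrow> complex) \<Rightarrow> bool" where
  "realv a \<longleftrightarrow> (\<forall>i. a i \<in> \<real>)"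

text \<open>The radius \<open>e\<close> may depend on \<open>p\<close>, as for germs of functions.
  Only real parameters are tested, because they are the ones that later give real points of
  \<open>V\<close>.\<close>

definition germ :: "((nat \<Rightarrow> complex) \<Rightarrow> complex) set" where
  "germ = {p\<in>PF n. \<exists>e>0. e \<le> \<epsilon> \<and> (\<forall>a. realv a \<longrightarrow> NS a < e \<longrightarrow> p (Y a) = 0)}"

text \<open>Membership in the sum of \<open>I\<close> and the \<open>j\<close>-th power of the
  maximal ideal at the origin.\<close>

definition iflat :: "nat \<Rightarrow> ((nat \<Rightarrow> complex) \<Rightarrow> complex) \<Rightarrow> bool" where
  "iflat j p \<longleftrightarrow> (\<exists>P. Hom n j P \<and> (\<lambda>x. p x - P x x) \<in> I)"

definition ray :: "(nat \<Rightarrow> complex) \<Rightarrow> real \<Rightarrow> nat \<Rightarrow> complex" where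
  "ray a t = (\<lambda>i. complex_of_real t * a i)"

text \<open>Order and leading form of the power series of \<open>p\<close> on the germ, expressed by
  limits along real rays.\<close>

definition has_order :: "((nat \<Rightarrow> complex) \<Rightarrow> complex) \<Rightarrow> nat \<Rightarrow> ((nat \<Rightarrow> complex) \<Rightarrow> complex) \<Rightarrow> bool" where
  "has_order p j r \<longleftrightarrow> r \<in> PF n \<and> (\<exists>x. r x \<noteq> 0) \<and>
     (\<forall>a. realv a \<longrightarrow> ((\<lambda>t. p (Y (ray a t)) / complex_of_real t ^ j) \<longlongrightarrow> r a) (at_right 0))"

lemma I_vanish: "f \<in> I \<Longrightarrow> NS a < \<epsilon> \<Longrightarrow> f (Y a) = 0"
  by (erule pspan_vanish) (use Y(2) in blast)

lemma NS_ray: "t \<ge> 0 \<Longrightarrow> NS (ray a t) = t * NS a"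
  unfolding NS_def ray_def by (simp add: norm_mult sum_distrib_left)

lemma realv_ray: "realv a \<Longrightarrow> realv (ray a t)"
  unfolding realv_def ray_def by auto

lemma eventually_small:
  assumes "e > 0" shows "eventually (\<lambda>t. t > 0 \<and> NS (ray a t) < e) (at_right 0)"
proof -
  have "eventually (\<lambda>t. t \<in> {0<..<e / (NS a + 1)}) (at_right 0)"
    using assms NS_nonneg[of a] by (intro eventually_at_right_real) simp
  then show ?thesis
  proof (rule eventually_mono)
    fix t assume t: "t \<in> {0<..<e / (NS a + 1)}"
    then have "t * (NS a + 1) < e" using NS_nonneg[of a] by (simp add: field_simps)
    then show "t > 0 \<and> NS (ray a t) < e" using t NS_ray[of t a] by (simp add: distrib_left)
  qed
qed

text \<open>At the last degree \<open>i\<close> up to which \<open>p\<close> is flat, its leading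
  part \<open>r\<close> in the free variables cannot be zero, as otherwise \<open>p\<close> would be
  flat to degree \<open>i + 1\<close>. Along a ray the rest is of size \<open>t ^ (i + 1)\<close>
  and disappears in the limit.\<close>

lemma not_flat_order:
  assumes p: "p \<in> PF n" and nf: "\<not> (\<forall>j. iflat j p)"
  shows "\<exists>j r. has_order p j r"
proof -
  define j where "j = (LEAST j. \<not> iflat j p)"
  have "\<exists>j. \<not> iflat j p" using nf by blast
  then have j: "\<not> iflat j p" unfolding j_def by (rule LeastI_ex)
  have "iflat 0 p" unfolding iflat_def
    by (rule exI[of _ "\<lambda>x z. p x"]) (simp add: Hom.Hom_base[OF p] pspan_zero)
  then obtain i where i: "j = Suc i" using j by (cases j) auto
  have "iflat i p" using not_less_Least[of i "\<lambda>j. \<not> iflat j p"] i unfolding j_def[symmetric] by simp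
  then obtain P where P: "Hom n i P" "(\<lambda>x. p x - P x x) \<in> I" unfolding iflat_def by (elim exE conjE)
  obtain r P' where r: "SHom S i r" "Hom n (Suc i) P'" "(\<lambda>x. P x x - r x - P' x x) \<in> I"
    using leading_part[OF P(1)] by (elim exE conjE)
  have "(\<lambda>x. (P x x - r x - P' x x) + (p x - P x x)) \<in> I" by (rule pspan_add[OF P(2) r(3)])
  then have pr: "(\<lambda>x. p x - r x - P' x x) \<in> I" by (simp add: algebra_simps)
  have rP: "r \<in> PF n" by (rule SHom_PF[OF r(1) S_sub])
  have "\<exists>x. r x \<noteq> 0"
  proof (rule ccontr)
    assume "\<not> ?thesis"
    then have "(\<lambda>x. p x - P' x x) \<in> I" using pr by simp
    then have "iflat (Suc i) p" unfolding iflat_def using r(2) by blast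
    then show False using j i by simp
  qed
  moreover have "((\<lambda>t. p (Y (ray a t)) / complex_of_real t ^ i) \<longlongrightarrow> r a) (at_right 0)" if a: "realv a" for a
  proof -
    obtain K where K: "K \<ge> 0" "\<And>x z. nrm n x \<le> 1 \<Longrightarrow> cmod (P' x z) \<le> K * nrm n z ^ Suc i"
      using Hom_bound[OF r(2)] by blast
    define M where "M = K * (\<Lambda> * NS a) ^ Suc i"
    have ev: "eventually (\<lambda>t. norm (p (Y (ray a t)) / complex_of_real t ^ i - r a) \<le> M * t) (at_right 0)"
      using eventually_small[OF pos(3), of a]
    proof (rule eventually_mono)
      fix t assume t: "t > 0 \<and> NS (ray a t) < \<epsilon>"
      let ?y = "Y (ray a t)"
      have "r ?y = r (ray a t)" by (rule SHom_cong[OF r(1)]) (use Y(3) t in blast)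
      also have "\<dots> = complex_of_real t ^ i * r a" unfolding ray_def by (rule SHom_scale[OF r(1)])
      finally have ry: "r ?y = complex_of_real t ^ i * r a" .
      have "p ?y - r ?y - P' ?y ?y = 0" using I_vanish[OF pr] t by blast
      then have "p ?y = complex_of_real t ^ i * r a + P' ?y ?y" using ry by (simp add: algebra_simps)
      then have 1: "p ?y / complex_of_real t ^ i - r a = P' ?y ?y / complex_of_real t ^ i"
        using t by (simp add: field_simps)
      have y1: "nrm n ?y \<le> 1" using Y(5)[of "ray a t"] t pos(2) by simp
      have "cmod (P' ?y ?y) \<le> K * nrm n ?y ^ Suc i" by (rule K(2)[OF y1])
      also have "\<dots> \<le> K * (\<Lambda> * NS (ray a t)) ^ Suc i"
        using Y(4)[of "ray a t"] t K(1) nrm_nonneg by (intro mult_left_mono power_mono) auto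
      also have "\<dots> = K * (\<Lambda> * (t * NS a)) ^ Suc i" using t NS_ray[of t a] by simp
      also have "\<dots> = M * t * t ^ i" unfolding M_def by (simp add: power_mult_distrib mult_ac)
      finally have "cmod (P' ?y ?y) \<le> M * t * t ^ i" .
      then show "norm (p ?y / complex_of_real t ^ i - r a) \<le> M * t"
        unfolding 1 using t by (simp add: norm_divide norm_power divide_le_eq)
    qed
    have lim0: "((\<lambda>t. M * t) \<longlongrightarrow> 0) (at_right 0)"
      by (rule tendsto_eq_intros | simp)+
    have "((\<lambda>t. norm (p (Y (ray a t)) / complex_of_real t ^ i - r a)) \<longlongrightarrow> 0) (at_right 0)"
      by (rule tendsto_sandwich[OF _ ev tendsto_const lim0]) simp
    then have "((\<lambda>t. p (Y (ray a t)) / complex_of_real t ^ i - r a) \<longlongrightarrow> 0) (at_right 0)"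
      by (rule tendsto_norm_zero_cancel)
    then show ?thesis by (rule LIM_zero_cancel)
  qed
  ultimately have "has_order p i r" unfolding has_order_def using rP by blast
  then show ?thesis by blast
qed

lemma ex_realv_nonzero: "r \<in> PF n \<Longrightarrow> r x \<noteq> 0 \<Longrightarrow> \<exists>a. realv a \<and> r a \<noteq> 0"
proof -
  assume "r \<in> PF n" "r x \<noteq> 0"
  then obtain a where "r (\<lambda>i. complex_of_real (a i)) \<noteq> 0" using PF_nonzero_real[of r n x 1 "\<lambda>i. 0"] by auto
  then show ?thesis unfolding realv_def by (intro exI[of _ "\<lambda>i. complex_of_real (a i)"]) auto
qed

text \<open>A nonzero polynomial \<open>r\<close> is nonzero at some real \<open>a\<close>, and the
  limit along the ray through \<open>a\<close> separates \<open>p\<close> from zero.\<close>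

lemma order_not_germ: "has_order p j r \<Longrightarrow> p \<notin> germ"
proof
  assume o: "has_order p j r" and "p \<in> germ"
  then obtain e where e: "e > 0" "e \<le> \<epsilon>" "\<And>a. realv a \<Longrightarrow> NS a < e \<Longrightarrow> p (Y a) = 0" unfolding germ_def by blast
  obtain x where "r x \<noteq> 0" "r \<in> PF n" using o unfolding has_order_def by blast
  then obtain a where a: "realv a" "r a \<noteq> 0" using ex_realv_nonzero by blast
  have "((\<lambda>t. p (Y (ray a t)) / complex_of_real t ^ j) \<longlongrightarrow> r a) (at_right 0)"
    using o a(1) unfolding has_order_def by blast
  moreover have "((\<lambda>t. p (Y (ray a t)) / complex_of_real t ^ j) \<longlongrightarrow> 0) (at_right 0)"
  proof (rule tendsto_eventually)
    show "eventually (\<lambda>t. p (Y (ray a t)) / complex_of_real t ^ j = 0) (at_right 0)"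
      using eventually_small[OF e(1), of a]
      by (rule eventually_mono) (use e(3) realv_ray[OF a(1)] in simp)
  qed
  ultimately show False using a(2) tendsto_unique[OF trivial_limit_at_right_real] by blast
qed

lemma has_order_mult:
  assumes "has_order p i r" "has_order p' i' r'"
  shows "has_order (\<lambda>x. p x * p' x) (i + i') (\<lambda>x. r x * r' x)"
  unfolding has_order_def
proof (intro conjI allI impI)
  have r: "r \<in> PF n" "r' \<in> PF n" "\<exists>x. r x \<noteq> 0" "\<exists>x. r' x \<noteq> 0" using assms unfolding has_order_def by auto
  show "(\<lambda>x. r x * r' x) \<in> PF n" by (rule PF.PF_mult[OF r(1,2)])
  obtain x x' where "r x \<noteq> 0" "r' x' \<noteq> 0" using r(3,4) by blast
  then show "\<exists>x. r x * r' x \<noteq> 0" using PF_mult_nonzero[OF r(1,2)] by auto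
  fix a assume "realv a"
  then have "((\<lambda>t. (p (Y (ray a t)) / complex_of_real t ^ i) * (p' (Y (ray a t)) / complex_of_real t ^ i')) \<longlongrightarrow> r a * r' a) (at_right 0)"
    using assms unfolding has_order_def by (intro tendsto_mult) auto
  then show "((\<lambda>t. p (Y (ray a t)) * p' (Y (ray a t)) / complex_of_real t ^ (i + i')) \<longlongrightarrow> r a * r' a) (at_right 0)"
    by (simp add: power_add)
qed

lemma flat_krull:
  assumes p: "p \<in> PF n" and fl: "\<forall>j. iflat j p"
  shows "\<exists>s\<in>PF n. s (\<lambda>i. 0) = 1 \<and> (\<lambda>x. s x * p x) \<in> I"
proof -
  from fl have "\<forall>j. \<exists>P. Hom n j P \<and> (\<lambda>x. p x - P x x) \<in> I" unfolding iflat_def .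
  from choice[OF this] obtain P where P: "\<forall>j. Hom n j (P j) \<and> (\<lambda>x. p x - P j x x) \<in> I" by (elim exE)
  show ?thesis
    by (rule krull_intersection[OF p, of P]) (use P in auto)
qed

lemma germ_krull:
  assumes "p \<in> germ" shows "\<exists>s\<in>PF n. s (\<lambda>i. 0) = 1 \<and> (\<lambda>x. s x * p x) \<in> I"
proof -
  have p: "p \<in> PF n" using assms unfolding germ_def by blast
  have "\<forall>j. iflat j p" using not_flat_order[OF p] order_not_germ assms by blast
  then show ?thesis using flat_krull[OF p] by blast
qed

text \<open>The factor \<open>s\<close> from Krull's theorem is nonzero near the origin, so
  \<open>s * p\<close> in \<open>I\<close> makes \<open>p\<close> vanish on the germ. With
  \<open>not_flat_order\<close> and \<open>order_not_germ\<close>, the germ ideal consists exactly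
  of the polynomials flat to every order.\<close>

lemma flat_germ:
  assumes p: "p \<in> PF n" and fl: "\<forall>j. iflat j p"
  shows "p \<in> germ"
proof -
  obtain s where s: "s \<in> PF n" "s (\<lambda>i. 0) = 1" "(\<lambda>x. s x * p x) \<in> I" using flat_krull[OF assms] by blast
  obtain K where K: "K \<ge> 0" "\<And>x y. nrm n x \<le> 1 \<Longrightarrow> nrm n y \<le> 1 \<Longrightarrow> cmod (s x - s y) \<le> K * nrm n (\<lambda>i. x i - y i)"
    using PF_lipschitz[OF s(1)] by blast
  \<comment> \<open>Within this radius \<open>s\<close> differs from its value 1 at the origin by at
    most \<open>K * \<Lambda> * NS a\<close>, which is less than 1.\<close>
  define e where "e = min \<epsilon> (1 / (K * \<Lambda> + 1))"
  have KL: "K * \<Lambda> \<ge> 0" using K(1) pos(4) by simp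
  have e: "e > 0" "e \<le> \<epsilon>" unfolding e_def using pos(3) KL by auto
  have "p (Y a) = 0" if a: "NS a < e" for a
  proof -
    have ae: "NS a < \<epsilon>" using a e by simp
    have y1: "nrm n (Y a) \<le> 1" using Y(5)[OF ae] pos(2) by simp
    have "cmod (s (Y a) - s (\<lambda>i. 0)) \<le> K * nrm n (Y a)"
      using K(2)[OF y1, of "\<lambda>i. 0"] by (simp add: nrm_def)
    also have "\<dots> \<le> K * (\<Lambda> * NS a)" using Y(4)[OF ae] K(1) by (intro mult_left_mono) auto
    also have "\<dots> < 1"
    proof -
      have "NS a < 1 / (K * \<Lambda> + 1)" using a unfolding e_def by simp
      then have "NS a * (K * \<Lambda> + 1) < 1" using KL by (simp add: field_simps)
      then show ?thesis using NS_nonneg[of a] by (simp add: algebra_simps)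
    qed
    finally have "s (Y a) \<noteq> 0" using s(2) by auto
    moreover have "s (Y a) * p (Y a) = 0" using I_vanish[OF s(3) ae] by simp
    ultimately show ?thesis by simp
  qed
  then show ?thesis unfolding germ_def using p e by blast
qed

text \<open>Polynomials outside the germ ideal have orders; orders add and nonzero leading
  polynomials multiply to nonzero ones, so the product has an order too and does not vanish on the
  germ.\<close>

lemma germ_prime:
  assumes "p \<in> PF n" "p' \<in> PF n" "(\<lambda>x. p x * p' x) \<in> germ"
  shows "p \<in> germ \<or> p' \<in> germ"
proof (rule ccontr)
  assume "\<not> ?thesis"
  then have "\<not> (\<forall>j. iflat j p)" "\<not> (\<forall>j. iflat j p')" using flat_germ assms(1,2) by blast+
  then obtain i r i' r' where "has_order p i r" "has_order p' i' r'" using not_flat_order assms(1,2) by meson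
  from order_not_germ[OF has_order_mult[OF this]] assms(3) show False by contradiction
qed

lemma pideal_germ: "pideal n germ"
  unfolding pideal_def
proof (intro conjI ballI)
  show "germ \<subseteq> PF n" unfolding germ_def by blast
  show "(\<lambda>x. 0) \<in> germ" unfolding germ_def using pos(3) by (auto intro: PF.PF_const exI[of _ \<epsilon>])
  fix f assume "f \<in> germ"
  then obtain e where e: "f \<in> PF n" "e > 0" "e \<le> \<epsilon>" "\<And>a. realv a \<Longrightarrow> NS a < e \<Longrightarrow> f (Y a) = 0" unfolding germ_def by blast
  show "(\<lambda>x. h x * f x) \<in> germ" if "h \<in> PF n" for h
    unfolding germ_def using PF.PF_mult[OF that e(1)] e by auto
  fix f' assume "f' \<in> germ"
  then obtain e' where e': "f' \<in> PF n" "e' > 0" "e' \<le> \<epsilon>" "\<And>a. realv a \<Longrightarrow> NS a < e' \<Longrightarrow> f' (Y a) = 0" unfolding germ_def by blast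
  show "(\<lambda>x. f x + f' x) \<in> germ" unfolding germ_def
    using PF.PF_add[OF e(1) e'(1)] e e' by (auto intro!: exI[of _ "min e e'"])
qed

text \<open>Finitely many generators admit a common radius. This turns the germ into an actual set
  of points whose closure can be formed.\<close>

lemma germ_uniform:
  "\<exists>e>0. e \<le> \<epsilon> \<and> (\<forall>p\<in>germ. \<forall>a. realv a \<longrightarrow> NS a < e \<longrightarrow> p (Y a) = 0)"
proof -
  obtain B where B: "finite B" "B \<subseteq> germ" "germ \<subseteq> pspan n B"
    using hilbert_basis[OF pideal_germ] by (elim exE conjE)
  from B(1,2) have "\<exists>e>0. e \<le> \<epsilon> \<and> (\<forall>b\<in>B. \<forall>a. realv a \<longrightarrow> NS a < e \<longrightarrow> b (Y a) = 0)"
  proof (induction B)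
    case empty
    then show ?case using pos(3) by (intro exI[of _ \<epsilon>]) auto
  next
    case (insert b B)
    then obtain e where e: "e > 0" "e \<le> \<epsilon>" "\<And>b a. b \<in> B \<Longrightarrow> realv a \<Longrightarrow> NS a < e \<Longrightarrow> b (Y a) = 0" by auto
    obtain e' where e': "e' > 0" "e' \<le> \<epsilon>" "\<And>a. realv a \<Longrightarrow> NS a < e' \<Longrightarrow> b (Y a) = 0"
      using insert.prems unfolding germ_def by blast
    show ?case using e e' by (intro exI[of _ "min e e'"]) auto
  qed
  then obtain e where e: "e > 0" "e \<le> \<epsilon>" "\<And>b a. b \<in> B \<Longrightarrow> realv a \<Longrightarrow> NS a < e \<Longrightarrow> b (Y a) = 0" by auto
  have "p (Y a) = 0" if "p \<in> germ" "realv a" "NS a < e" for p a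
  proof (rule pspan_vanish[of p n B])
    show "p \<in> pspan n B" using that(1) B(3) by blast
    show "b (Y a) = 0" if "b \<in> B" for b by (rule e(3)[OF that]) fact+
  qed
  with e(1,2) show ?thesis by blast
qed

end

subsection \<open>Density of the real points near a smooth real point\<close>

theorem smooth_point_real_dense:
  fixes f :: "nat \<Rightarrow> (nat \<Rightarrow> complex) \<Rightarrow> complex" and \<kappa> :: "nat \<Rightarrow> nat"
  assumes V: "irr n V" and cnjV: "\<And>y. y \<in> V \<Longrightarrow> (\<lambda>i. cnj (y i)) \<in> V"
    and \<xi>: "\<xi> \<in> V" "\<And>i. \<xi> i \<in> \<real>" and c: "c = n - vd n V"
    and f: "\<And>i. i < c \<Longrightarrow> f i \<in> van n V"
    and \<kappa>: "inj_on \<kappa> {..<c}" "\<kappa> ` {..<c} \<subseteq> {..<n}"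
    and det: "det_sq c (\<lambda>i j. pd (\<kappa> j) (f i) \<xi>) \<noteq> 0"
  shows "real_dense n V"
proof -
  have fP: "f i \<in> PF n" and f0: "\<And>y. y \<in> V \<Longrightarrow> f i y = 0" if "i < c" for i
    using f[OF that] unfolding van_def by auto
  \<comment> \<open>Inverting the Jacobian minor gives combinations \<open>g\<close> of the
    equations whose derivatives by the variables in \<open>C\<close> form the identity matrix at the
    origin.\<close>
  have "det_sq c (\<lambda>j t. pd (\<kappa> j) (f t) \<xi>) \<noteq> 0"
    using det unfolding det_sq_transpose[of c "\<lambda>i j. pd (\<kappa> j) (f i) \<xi>"] .
  then have "\<forall>i. \<exists>b. \<forall>j<c. (\<Sum>t<c. pd (\<kappa> j) (f t) \<xi> * b t) = (if \<kappa> j = i then 1 else 0)"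
    by (intro allI inhomogeneous_solution)
  from choice[OF this] obtain b where b: "\<forall>i. \<forall>j<c. (\<Sum>t<c. pd (\<kappa> j) (f t) \<xi> * b i t) = (if \<kappa> j = i then 1 else 0)"
    by (elim exE)
  define C where "C = \<kappa> ` {..<c}"
  define S where "S = {..<n} - C"
  define g where "g = (\<lambda>i x. \<Sum>t<c. b i t * f t (\<lambda>k. \<xi> k + x k))"
  have shiftP: "(\<lambda>x. p (\<lambda>k. \<xi> k + x k)) \<in> PF n" if "p \<in> PF n" for p
    by (rule PF_subst[OF that]) (intro PF.PF_add PF.PF_const PF.PF_var)
  have shiftP': "(\<lambda>x. p (\<lambda>k. x k - \<xi> k)) \<in> PF n" if "p \<in> PF n" for p
    by (rule PF_subst[OF that]) (intro PF_diff PF.PF_const PF.PF_var)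
  have gP: "g i \<in> PF n" for i
    unfolding g_def by (intro PF_sum PF.PF_mult PF.PF_const shiftP fP) simp
  have gV: "g i x = 0" if "(\<lambda>k. \<xi> k + x k) \<in> V" for i x
    unfolding g_def using f0[OF _ that] by simp
  have g0: "g i (\<lambda>k. 0) = 0" for i by (rule gV) (simp add: \<xi>(1))
  have "\<forall>i. \<exists>G. (\<forall>k. G k \<in> PF n) \<and> (\<forall>x. g i x = (\<Sum>k<n. x k * G k x))"
  proof
    fix i
    show "\<exists>G. (\<forall>k. G k \<in> PF n) \<and> (\<forall>x. g i x = (\<Sum>k<n. x k * G k x))"
      using expand_at_0[OF gP[of i]] unfolding g0 add_0_left .
  qed
  from choice[OF this] obtain G where G': "\<forall>i. (\<forall>k. G i k \<in> PF n) \<and> (\<forall>x. g i x = (\<Sum>k<n. x k * G i k x))"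
    by (elim exE)
  have GP: "G i k \<in> PF n" and Gx: "g i x = (\<Sum>k<n. x k * G i k x)" for i k x using G' by blast+
  let ?e = "\<lambda>k l::nat. if l = k then 1 else 0 :: complex"
  let ?z = "\<lambda>k::nat. 0 :: complex"
  \<comment> \<open>The coefficient \<open>G i k\<close> at the origin is the partial derivative of
    \<open>g i\<close> by variable \<open>k\<close>.\<close>
  have dg: "((\<lambda>s. g i (\<lambda>l. s * ?e k l)) has_field_derivative G i k ?z) (at 0)" if k: "k < n" for i k
  proof -
    have "g i (\<lambda>l. s * ?e k l) = s * G i k (\<lambda>l. ?z l + s * ?e k l)" for s
    proof -
      have "g i (\<lambda>l. s * ?e k l) = (\<Sum>l<n. if l = k then s * G i l (\<lambda>l. s * ?e k l) else 0)"
        unfolding Gx by (rule sum.cong) auto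
      then show ?thesis using k by simp
    qed
    moreover have "((\<lambda>s. s * G i k (\<lambda>l. ?z l + s * ?e k l)) has_field_derivative
        1 * G i k (\<lambda>l. ?z l + 0 * ?e k l) + (\<Sum>l<n. ?e k l * pd l (G i k) ?z) * 0) (at 0)"
      by (rule DERIV_mult[OF DERIV_ident PF_directional[OF GP]])
    ultimately show ?thesis by simp
  qed
  have G0: "G i k ?z = ?e i k" if k: "k \<in> C" for i k
  proof -
    obtain j where j: "j < c" "k = \<kappa> j" using k unfolding C_def by auto
    then have kn: "k < n" using \<kappa>(2) by auto
    have "((\<lambda>s. \<Sum>t<c. b i t * f t (\<lambda>l. \<xi> l + s * ?e k l)) has_field_derivative
        (\<Sum>t<c. b i t * (\<Sum>l<n. ?e k l * pd l (f t) \<xi>))) (at 0)"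
      by (intro DERIV_sum DERIV_cmult PF_directional fP) simp
    moreover have "(\<Sum>l<n. ?e k l * pd l (f t) \<xi>) = pd k (f t) \<xi>" for t
    proof -
      have "(\<Sum>l<n. ?e k l * pd l (f t) \<xi>) = (\<Sum>l<n. if l = k then pd l (f t) \<xi> else 0)" by (rule sum.cong) auto
      then show ?thesis using kn by simp
    qed
    ultimately have "((\<lambda>s. g i (\<lambda>l. s * ?e k l)) has_field_derivative (\<Sum>t<c. b i t * pd k (f t) \<xi>)) (at 0)"
      unfolding g_def by simp
    from DERIV_unique[OF dg[OF kn] this] have "G i k ?z = (\<Sum>t<c. pd (\<kappa> j) (f t) \<xi> * b i t)"
      unfolding j(2) by (simp add: mult.commute)
    also have "\<dots> = (if \<kappa> j = i then 1 else 0)" using b j(1) by blast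
    finally show ?thesis unfolding j(2) .
  qed
  \<comment> \<open>Up to sign, \<open>L\<close> collects the linear coefficients of the free
    variables and \<open>q\<close> is the deviation of \<open>G\<close> from its value at the
    origin, which makes the remainder quadratic.\<close>
  define L where "L = (\<lambda>i s. - G i s ?z)"
  define q where "q = (\<lambda>i k x. G i k ?z - G i k x)"
  have Cn: "C \<subseteq> {..<n}" using \<kappa>(2) unfolding C_def .
  interpret core n C g L q S
  proof
    show "C \<subseteq> {..<n}" by (rule Cn)
    show "S = {..<n} - C" by (rule S_def)
    show "q i k \<in> PF n" for i k unfolding q_def by (intro PF_diff PF.PF_const GP)
    show "q i k (\<lambda>i. 0) = 0" for i k unfolding q_def by simp
    fix i x assume i: "i \<in> C"
    have "(\<Sum>k<n. x k * G i k ?z) = (\<Sum>k\<in>S. x k * G i k ?z) + (\<Sum>k\<in>C. x k * G i k ?z)"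
      unfolding S_def by (rule sum.subset_diff[OF Cn]) simp
    also have "(\<Sum>k\<in>C. x k * G i k ?z) = (\<Sum>k\<in>C. if k = i then x k else 0)"
      by (rule sum.cong) (auto simp: G0)
    also have "\<dots> = x i" using i finite_subset[OF Cn] by simp
    finally have 1: "(\<Sum>k<n. x k * G i k ?z) = (\<Sum>k\<in>S. x k * G i k ?z) + x i" .
    have 2: "(\<Sum>s\<in>S. L i s * x s) = - (\<Sum>k\<in>S. x k * G i k ?z)"
      unfolding L_def by (simp add: sum_negf mult.commute)
    have 3: "(\<Sum>k<n. x k * q i k x) = (\<Sum>k<n. x k * G i k ?z) - (\<Sum>k<n. x k * G i k x)"
      unfolding q_def by (simp add: right_diff_distrib sum_subtractf)
    show "g i x = x i - (\<Sum>s\<in>S. L i s * x s) - (\<Sum>k<n. x k * q i k x)"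
      unfolding 2 3 1 Gx by simp
  qed
  obtain \<delta> \<epsilon> \<Lambda> Y where "core_solution n C g L q S \<delta> \<epsilon> \<Lambda> Y" using ex_core_solution by blast
  then interpret core_solution n C g L q S \<delta> \<epsilon> \<Lambda> Y .
  obtain e where e: "e > 0" "e \<le> \<epsilon>" "\<And>p a. p \<in> germ \<Longrightarrow> realv a \<Longrightarrow> NS a < e \<Longrightarrow> p (Y a) = 0"
    using germ_uniform by blast
  define sh where "sh = (\<lambda>a k. \<xi> k + Y a k)"
  define M where "M = sh ` {a. realv a \<and> NS a < e}"
  have \<xi>c: "\<xi> \<in> cspace n" using \<xi>(1) irr.V_cspace[OF V] by blast
  have Mc: "M \<subseteq> cspace n"
  proof
    fix y assume "y \<in> M"
    then obtain a where a: "NS a < e" "y = sh a" unfolding M_def by blast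
    then have "Y a \<in> cspace n" using Y(1) e(2) by simp
    then show "y \<in> cspace n" using \<xi>c unfolding a(2) sh_def cspace_def by simp
  qed
  have vanM: "p \<in> van n M \<longleftrightarrow> p \<in> PF n \<and> (\<lambda>x. p (\<lambda>k. \<xi> k + x k)) \<in> germ" for p
  proof
    assume p: "p \<in> van n M"
    then have pP: "p \<in> PF n" unfolding van_def by blast
    have "p (\<lambda>k. \<xi> k + Y a k) = 0" if "realv a" "NS a < e" for a
    proof -
      have "sh a \<in> M" unfolding M_def using that by blast
      then show ?thesis using p unfolding van_def sh_def by blast
    qed
    then have "(\<lambda>x. p (\<lambda>k. \<xi> k + x k)) \<in> germ" unfolding germ_def using shiftP[OF pP] e(1,2) by blast
    with pP show "p \<in> PF n \<and> (\<lambda>x. p (\<lambda>k. \<xi> k + x k)) \<in> germ" by blast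
  next
    assume p: "p \<in> PF n \<and> (\<lambda>x. p (\<lambda>k. \<xi> k + x k)) \<in> germ"
    have "p y = 0" if y: "y \<in> M" for y
    proof -
      obtain a where a: "realv a" "NS a < e" "y = sh a" using y unfolding M_def by blast
      show ?thesis using e(3)[OF conjunct2[OF p] a(1,2)] unfolding a(3) sh_def .
    qed
    with p show "p \<in> van n M" unfolding van_def by blast
  qed
  define W where "W = zariski_closure n M"
  have MW: "M \<subseteq> W" unfolding W_def by (rule subset_zariski_closure[OF Mc])
  have vanW: "van n W = van n M" unfolding W_def by (rule van_zariski_closure[OF Mc])
  have irrW: "irr n W" unfolding W_def
  proof (rule irr_zariski_closure[OF Mc])
    have "realv ?z" "NS ?z < e" using e(1) unfolding realv_def NS_def by auto
    then show "M \<noteq> {}" unfolding M_def by blast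
    fix p p' assume p: "p \<in> PF n" "p' \<in> PF n" "\<And>y. y \<in> M \<Longrightarrow> p y * p' y = 0"
    have "(\<lambda>y. p y * p' y) \<in> van n M" unfolding van_def using PF.PF_mult[OF p(1,2)] p(3) by simp
    then have "(\<lambda>x. p (\<lambda>k. \<xi> k + x k) * p' (\<lambda>k. \<xi> k + x k)) \<in> germ"
      using vanM[of "\<lambda>y. p y * p' y"] by simp
    from germ_prime[OF shiftP[OF p(1)] shiftP[OF p(2)] this]
    show "p \<in> van n M \<or> p' \<in> van n M" using vanM[of p] vanM[of p'] p(1,2) by simp
  qed
  \<comment> \<open>A polynomial vanishing on the germ is carried into \<open>I\<close> by a factor
    \<open>s\<close> with value 1 at \<open>\<xi>\<close>. The shifted \<open>I\<close> vanishes on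
    the irreducible \<open>V\<close>, and \<open>s\<close> does not, so the polynomial itself
    vanishes on \<open>V\<close>.\<close>
  have VW: "V \<subseteq> W"
  proof
    fix y assume y: "y \<in> V"
    have "p y = 0" if p: "p \<in> van n M" for p
    proof -
      have pP: "p \<in> PF n" and pg: "(\<lambda>x. p (\<lambda>k. \<xi> k + x k)) \<in> germ" using p vanM[of p] by simp_all
      obtain s where s: "s \<in> PF n" "s (\<lambda>i. 0) = 1" "(\<lambda>x. s x * p (\<lambda>k. \<xi> k + x k)) \<in> I"
        using germ_krull[OF pg] by (elim bexE conjE)
      have "s (\<lambda>k. u k - \<xi> k) * p u = 0" if u: "u \<in> V" for u
      proof -
        have "s (\<lambda>k. u k - \<xi> k) * p (\<lambda>k. \<xi> k + (u k - \<xi> k)) = 0"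
          by (rule pspan_vanish[OF s(3)]) (use gV[of "\<lambda>k. u k - \<xi> k"] u in auto)
        then show ?thesis by simp
      qed
      from irr.V_prime[OF V shiftP'[OF s(1)] pP this]
      have "(\<forall>u\<in>V. s (\<lambda>k. u k - \<xi> k) = 0) \<or> (\<forall>u\<in>V. p u = 0)" .
      moreover have "s (\<lambda>k. \<xi> k - \<xi> k) \<noteq> 0" using s(2) by simp
      ultimately show ?thesis using \<xi>(1) y by blast
    qed
    then show "y \<in> W" using y irr.V_cspace[OF V] unfolding W_def zariski_closure_van by blast
  qed
  \<comment> \<open>The \<open>c\<close> equations \<open>g\<close> hold on the germ and have
    independent gradients at \<open>\<xi>\<close>, so the closure \<open>W\<close> is not larger in
    dimension than \<open>V\<close>; being irreducible and containing \<open>V\<close>, it equals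
    \<open>V\<close>.\<close>
  have "c + vd n W \<le> n"
  proof (rule minor_size_le[OF irrW])
    let ?g = "\<lambda>i y. g (\<kappa> i) (\<lambda>k. y k - \<xi> k)"
    show "\<kappa> j < n" if "j < c" for j using \<kappa>(2) that by auto
    show "\<xi> \<in> W" using VW \<xi>(1) by blast
    show "?g i \<in> van n W" if i: "i < c" for i
      unfolding vanW vanM
    proof
      show "?g i \<in> PF n" by (rule shiftP'[OF gP])
      have "\<kappa> i \<in> C" using i unfolding C_def by blast
      then have "g (\<kappa> i) (Y a) = 0" if "NS a < \<epsilon>" for a using Y(2)[OF that] by blast
      then show "(\<lambda>x. g (\<kappa> i) (\<lambda>k. \<xi> k + x k - \<xi> k)) \<in> germ"
        unfolding germ_def using gP pos(3) by (auto intro!: exI[of _ \<epsilon>])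
    qed
    have pdg: "pd (\<kappa> j) (?g i) \<xi> = (if i = j then 1 else 0)" if ij: "i < c" "j < c" for i j
    proof -
      have "\<kappa> j < n" using \<kappa>(2) ij by auto
      have "((\<lambda>s. g (\<kappa> i) (\<lambda>l. (s + - \<xi> (\<kappa> j)) * ?e (\<kappa> j) l)) has_field_derivative G (\<kappa> i) (\<kappa> j) ?z) (at (\<xi> (\<kappa> j)))"
        using dg[OF \<open>\<kappa> j < n\<close>, of "\<kappa> i"] by (subst DERIV_shift[symmetric]) simp
      moreover have "(\<lambda>l. (s + - \<xi> (\<kappa> j)) * ?e (\<kappa> j) l) = (\<lambda>k. (\<xi>(\<kappa> j := s)) k - \<xi> k)" for s by auto
      ultimately have "((\<lambda>s. ?g i (\<xi>(\<kappa> j := s))) has_field_derivative G (\<kappa> i) (\<kappa> j) ?z) (at (\<xi> (\<kappa> j)))" by simp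
      from pd_eqI[OF this] have "pd (\<kappa> j) (?g i) \<xi> = G (\<kappa> i) (\<kappa> j) ?z" .
      also have "\<dots> = (if \<kappa> j = \<kappa> i then 1 else 0)" by (rule G0) (use ij(2) C_def in blast)
      also have "\<dots> = (if i = j then 1 else 0)" using inj_on_eq_iff[OF \<kappa>(1), of j i] ij by auto
      finally show ?thesis .
    qed
    show "det_sq c (\<lambda>i j. pd (\<kappa> j) (?g i) \<xi>) \<noteq> 0"
    proof
      assume "det_sq c (\<lambda>i j. pd (\<kappa> j) (?g i) \<xi>) = 0"
      then obtain v where "(\<exists>j<c. v j \<noteq> 0) \<and> (\<forall>i<c. (\<Sum>j<c. pd (\<kappa> j) (?g i) \<xi> * v j) = 0)"
        unfolding det_sq_eq_0_iff by (elim exE)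
      then have v: "\<exists>j<c. v j \<noteq> 0" "\<forall>i<c. (\<Sum>j<c. pd (\<kappa> j) (?g i) \<xi> * v j) = 0" by simp_all
      have "v i = 0" if i: "i < c" for i
      proof -
        have "(\<Sum>j<c. pd (\<kappa> j) (?g i) \<xi> * v j) = (\<Sum>j<c. if j = i then v j else 0)"
          by (rule sum.cong) (use pdg[OF i] in auto)
        then show ?thesis using v(2) i by simp
      qed
      with v(1) show False by blast
    qed
  qed
  then have "vd n W \<le> vd n V" using c vd_le[of n V] by simp
  then have "V = W" using vd_strict_mono[OF irrW V] VW by (metis not_less psubsetI)
  \<comment> \<open>The conjugate of a germ point lies in \<open>V\<close>, so it satisfies the same
    equations with the same real free coordinates, and uniqueness makes the point real.\<close>
  have Mreal: "y \<in> V \<and> (\<forall>k. y k \<in> \<real>)" if yM: "y \<in> M" for y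
  proof
    show yV: "y \<in> V" using yM MW \<open>V = W\<close> by blast
    obtain a where a: "realv a" "NS a < e" "y = sh a" using yM unfolding M_def by blast
    have a\<epsilon>: "NS a < \<epsilon>" using a(2) e(2) by simp
    have \<xi>r: "cnj (\<xi> k) = \<xi> k" for k using \<xi>(2) by (simp add: Reals_cnj_iff)
    have "(\<lambda>k. cnj (y k)) \<in> V" by (rule cnjV[OF yV])
    moreover have "(\<lambda>k. cnj (y k)) = (\<lambda>k. \<xi> k + cnj (Y a k))" unfolding a(3) sh_def by (simp add: \<xi>r)
    ultimately have cV: "(\<lambda>k. \<xi> k + cnj (Y a k)) \<in> V" by simp
    have eq: "Y a k = cnj (Y a k)" if k: "k < n" for k
    proof (rule unique[of "Y a" "\<lambda>k. cnj (Y a k)", OF _ _ _ _ _ k])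
      show "nrm n (Y a) \<le> \<delta>" by (rule Y(5)[OF a\<epsilon>])
      then show "nrm n (\<lambda>k. cnj (Y a k)) \<le> \<delta>" unfolding nrm_def by simp
      show "g i (Y a) = 0" if "i \<in> C" for i by (rule Y(2)[OF a\<epsilon> that])
      show "g i (\<lambda>k. cnj (Y a k)) = 0" if "i \<in> C" for i by (rule gV[OF cV])
      show "Y a s = cnj (Y a s)" if "s \<in> S" for s
        using Y(3)[OF a\<epsilon> that] a(1) unfolding realv_def by (simp add: Reals_cnj_iff)
    qed
    show "\<forall>k. y k \<in> \<real>"
    proof
      fix k
      have "Y a k \<in> \<real>"
      proof (cases "k < n")
        case True
        then show ?thesis using eq[of k] by (simp add: Reals_cnj_iff)
      next
        case False
        then show ?thesis using Y(1)[OF a\<epsilon>] unfolding cspace_def by simp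
      qed
      then show "y k \<in> \<real>" unfolding a(3) sh_def using \<xi>(2) by simp
    qed
  qed
  show ?thesis unfolding real_dense_def
  proof (intro ballI impI)
    fix p y assume p: "p \<in> PF n" "\<forall>y\<in>V. (\<forall>i. y i \<in> \<real>) \<longrightarrow> p y = 0" and y: "y \<in> V"
    have "p \<in> van n M" using p Mreal unfolding van_def by blast
    then have "p \<in> van n W" using vanW by blast
    then show "p y = 0" using y \<open>V = W\<close> unfolding van_def by blast
  qed
qed

lemma defined_over_R_smooth_real_dense:
  assumes V: "irr n V" and R: "defined_over_R n V" and s: "has_smooth_real_point n V"
  shows "real_dense n V"
proof -
  obtain \<xi> where \<xi>: "smooth_real_point n V \<xi>" using s unfolding has_smooth_real_point_def by blast
  obtain f \<kappa> where f: "\<forall>i<n - vd n V. f i \<in> van n V" "inj_on \<kappa> {..<n - vd n V}" "\<kappa> ` {..<n - vd n V} \<subseteq> {..<n}"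
    "det_sq (n - vd n V) (\<lambda>i j. pd (\<kappa> j) (f i) \<xi>) \<noteq> 0"
    using smooth_real_point_minor[OF V \<xi> refl] by (elim exE conjE)
  have "\<xi> \<in> V" "\<And>i. \<xi> i \<in> \<real>" using \<xi> unfolding smooth_real_point_def by auto
  from smooth_point_real_dense[OF V defined_over_R_cnj[OF V R] this refl f(1)[rule_format] f(2,3,4)]
  show ?thesis .
qed

subsection \<open>Projections\<close>

lemma lin_proj_PF:
  assumes "f \<in> PF q" shows "(\<lambda>x. f (lin_proj n q A x)) \<in> PF n"
proof (rule PF_subst[OF assms])
  fix i assume "i < q"
  then show "(\<lambda>x. lin_proj n q A x i) \<in> PF n" unfolding lin_proj_def
    by (simp) (intro PF_sum PF.PF_mult PF.PF_const PF.PF_var, simp)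
qed

lemma lin_proj_cspace: "lin_proj n q A ` V \<subseteq> cspace q"
  unfolding lin_proj_def cspace_def by auto

lemma irr_projection:
  assumes V: "irr n V" shows "irr q (zariski_closure q (lin_proj n q A ` V))"
proof (rule irr_zariski_closure[OF lin_proj_cspace])
  show "lin_proj n q A ` V \<noteq> {}" using irr.V_nonempty[OF V] by blast
  fix f g assume fg: "f \<in> PF q" "g \<in> PF q" "\<And>y. y \<in> lin_proj n q A ` V \<Longrightarrow> f y * g y = 0"
  have "(\<forall>y\<in>V. f (lin_proj n q A y) = 0) \<or> (\<forall>y\<in>V. g (lin_proj n q A y) = 0)"
    by (rule irr.V_prime[OF V lin_proj_PF[OF fg(1)] lin_proj_PF[OF fg(2)]]) (use fg(3) in blast)
  then show "f \<in> van q (lin_proj n q A ` V) \<or> g \<in> van q (lin_proj n q A ` V)"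
    unfolding van_def using fg(1,2) by blast
qed

text \<open>A real matrix maps real points to real points, so a polynomial vanishing at the real
  points of the closure pulls back to one vanishing at the real points of \<open>V\<close>.\<close>

lemma real_dense_projection:
  assumes dense: "real_dense n V"
  shows "real_dense q (zariski_closure q (lin_proj n q A ` V))"
  unfolding real_dense_def
proof (intro ballI impI)
  let ?T = "lin_proj n q A ` V"
  fix f u assume f: "f \<in> PF q" "\<forall>y\<in>zariski_closure q ?T. (\<forall>i. y i \<in> \<real>) \<longrightarrow> f y = 0" and u: "u \<in> zariski_closure q ?T"
  have "f (lin_proj n q A y) = 0" if "y \<in> V" "\<forall>i. y i \<in> \<real>" for y
  proof -
    have "lin_proj n q A y \<in> zariski_closure q ?T" using subset_zariski_closure[OF lin_proj_cspace] that(1) by blast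
    moreover have "\<forall>i. lin_proj n q A y i \<in> \<real>" unfolding lin_proj_def using that(2) by auto
    ultimately show ?thesis using f(2) by blast
  qed
  then have "\<forall>y\<in>V. f (lin_proj n q A y) = 0"
    using bspec[OF dense[unfolded real_dense_def] lin_proj_PF[OF f(1)]] by blast
  then have "f \<in> van q ?T" unfolding van_def using f(1) by blast
  then show "f u = 0" using u unfolding zariski_closure_van by blast
qed

lemma pd_cjf: "f \<in> PF m \<Longrightarrow> cjf (pd j f) = pd j (cjf f)"
proof (induction rule: PF.induct)
  case (PF_const c)
  have "cjf (\<lambda>x. c) = (\<lambda>x. cnj c)" for c by (simp add: cjf_def fun_eq_iff)
  then show ?case by simp
next
  case (PF_var i)
  have 1: "cjf (\<lambda>x. x i) = (\<lambda>x. x i)" for i by (simp add: cjf_def fun_eq_iff)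
  show ?case unfolding 1 pd_var by (auto simp: cjf_def fun_eq_iff)
next
  case (PF_add f g)
  have 1: "cjf (\<lambda>x. f x + g x) = (\<lambda>x. cjf f x + cjf g x)" for f g by (simp add: cjf_def fun_eq_iff)
  show ?case unfolding 1 pd_add[OF PF_add.hyps] PF_add.IH pd_add[OF cjf_PF[OF PF_add.hyps(1)] cjf_PF[OF PF_add.hyps(2)]] ..
next
  case (PF_mult f g)
  have 1: "cjf (\<lambda>x. f x * g x) = (\<lambda>x. cjf f x * cjf g x)" for f g by (simp add: cjf_def fun_eq_iff)
  have 2: "cjf (\<lambda>x. f x + g x) = (\<lambda>x. cjf f x + cjf g x)" for f g by (simp add: cjf_def fun_eq_iff)
  show ?case unfolding 1 2 pd_mult[OF PF_mult.hyps] PF_mult.IH pd_mult[OF cjf_PF[OF PF_mult.hyps(1)] cjf_PF[OF PF_mult.hyps(2)]] ..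
qed

lemma lowdeg_cjf: "lowdeg m i f \<Longrightarrow> lowdeg m i (cjf f)"
proof -
  assume "lowdeg m i f"
  then obtain e where e: "\<forall>k. e k \<in> PF m" "f = (\<lambda>x. \<Sum>k<i. e k x * x m ^ k)" unfolding lowdeg_def by (elim exE conjE)
  show ?thesis unfolding lowdeg_def
  proof (rule exI[of _ "\<lambda>k. cjf (e k)"], intro conjI allI)
    show "cjf (e k) \<in> PF m" for k using e(1) by (intro cjf_PF) blast
    show "cjf f = (\<lambda>x. \<Sum>k<i. cjf (e k) x * x m ^ k)" unfolding e(2) cjf_def by simp
  qed
qed

section \<open>Lifting density from generic projections\<close>

locale good_projections = irr +
  fixes k l :: nat and \<phi> :: "nat \<Rightarrow> mpoly"
  assumes \<phi>: "\<And>i. i < l \<Longrightarrow> \<phi> i \<noteq> 0" "\<And>i. i < l \<Longrightarrow> poly_in (Suc k * n) (\<phi> i)"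
    and good: "\<And>A. (\<And>i. i < l \<Longrightarrow> eval (\<phi> i) (mat_point n A) \<noteq> 0) \<Longrightarrow>
      real_dense (Suc k) (zariski_closure (Suc k) (lin_proj n (Suc k) A ` V))"
begin

text \<open>Coefficients from \<open>x\<close>, values from \<open>u\<close>: the slice of the space
  of coefficients and values over one projection.\<close>

definition zx :: "(nat \<Rightarrow> complex) \<Rightarrow> (nat \<Rightarrow> complex) \<Rightarrow> nat \<Rightarrow> complex" where
  "zx x u v = (if v mod Suc n = n then u (v div Suc n) else x v)"

text \<open>The closed image of \<open>V\<close> under the projection with coefficients
  \<open>x\<close>. By \<open>J_fiber\<close> it lies in the fibre of the zero set of
  \<open>J\<close> over \<open>x\<close>.\<close>

definition fiber_closure :: "(nat \<Rightarrow> complex) \<Rightarrow> (nat \<Rightarrow> complex) set" where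
  "fiber_closure x = zariski_closure (Suc k) ((\<lambda>y i. if i < Suc k then \<Sum>j<n. x (i * Suc n + j) * y j else 0) ` V)"

lemma zx_PF:
  assumes "f \<in> PF (Suc k * Suc n)" shows "(\<lambda>u. f (zx x u)) \<in> PF (Suc k)"
proof (rule PF_subst[OF assms])
  fix i assume "i < Suc k * Suc n"
  then have "i div Suc n < Suc k" by (rule less_mult_imp_div_less)
  then show "(\<lambda>u. zx x u i) \<in> PF (Suc k)" unfolding zx_def by (intro PF_if PF.PF_var PF.PF_const)
qed

lemma zx_image:
  assumes "f \<in> PF (Suc k * Suc n)"
  shows "f (zx x (\<lambda>i. if i < Suc k then \<Sum>j<n. x (i * Suc n + j) * y j else 0)) = f (gx n x y)"
proof (rule PF_cong[OF assms])
  fix v assume "v < Suc k * Suc n"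
  then show "zx x (\<lambda>i. if i < Suc k then \<Sum>j<n. x (i * Suc n + j) * y j else 0) v = gx n x y v"
  proof (cases rule: block_cases)
    case (1 i j)
    then show ?thesis unfolding 1(3) gx_coeff[OF 1(2)] zx_def
      by (simp add: mod_mult_self3 del: mult_Suc_right)
  next
    case (2 i)
    have "(i * Suc n + n) mod Suc n = n" by (simp add: mod_mult_self3 del: mult_Suc_right)
    moreover have "(i * Suc n + n) div Suc n = i" by (simp add: div_mult_self3 del: mult_Suc_right)
    ultimately show ?thesis unfolding 2(2) gx_value zx_def using 2(1) by (simp del: mult_Suc_right)
  qed
qed

lemma image_cspace: "(\<lambda>y i. if i < Suc k then \<Sum>j<n. x (i * Suc n + j) * y j else 0) ` V \<subseteq> cspace (Suc k)"
  unfolding cspace_def by auto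

lemma image_fiber_closure:
  "y \<in> V \<Longrightarrow> (\<lambda>i. if i < Suc k then \<Sum>j<n. x (i * Suc n + j) * y j else 0) \<in> fiber_closure x"
  using subset_zariski_closure[OF image_cspace] unfolding fiber_closure_def by blast

lemma J_fiber:
  assumes f: "f \<in> J n V (Suc k)" and u: "u \<in> fiber_closure x"
  shows "f (zx x u) = 0"
proof -
  have fP: "f \<in> PF (Suc k * Suc n)" using f unfolding J_def by blast
  have "f (gx n x y) = 0" if "y \<in> V" for y using f that unfolding J_def by blast
  then have "(\<lambda>u. f (zx x u)) \<in> van (Suc k) ((\<lambda>y i. if i < Suc k then \<Sum>j<n. x (i * Suc n + j) * y j else 0) ` V)"
    unfolding van_def using zx_PF[OF fP] zx_image[OF fP] by auto
  then show ?thesis using u unfolding fiber_closure_def zariski_closure_van by auto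
qed

text \<open>The genericity conditions and the condition on \<open>h\<close> multiply to a nonzero
  polynomial in the coefficients, which does not vanish at some real point.\<close>

lemma ex_good:
  assumes h: "h \<in> PF (Suc k * Suc n)" "h x0 \<noteq> 0"
  shows "\<exists>x. (\<forall>i. x i \<in> \<real>) \<and> h x \<noteq> 0 \<and> real_dense (Suc k) (fiber_closure x)"
proof -
  \<comment> \<open>Renumbering: the matrix entry in row \<open>i\<close> and column
    \<open>j\<close> is coordinate \<open>i * n + j\<close> of a matrix point, but coordinate
    \<open>i * Suc n + j\<close> among the blocks.\<close>
  define \<psi> where "\<psi> = (\<lambda>i x. eval (\<phi> i) (\<lambda>v. x ((v div n) * Suc n + v mod n)))"
  have idx: "(v div n) * Suc n + v mod n < Suc k * Suc n" "v mod n < n" "v div n < Suc k" if "v < Suc k * n" for v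
  proof -
    have n: "n > 0" using that by (cases n) auto
    then show a: "v mod n < n" by simp
    show b: "v div n < Suc k" using that by (rule less_mult_imp_div_less)
    have "(v div n) * Suc n + v mod n < (v div n) * Suc n + Suc n" using a by (simp del: mult_Suc_right)
    also have "\<dots> = Suc (v div n) * Suc n" by (simp only: mult_Suc add.commute)
    also have "\<dots> \<le> Suc k * Suc n" using b by (intro mult_le_mono1) simp
    finally show "(v div n) * Suc n + v mod n < Suc k * Suc n" .
  qed
  have \<psi>P: "\<psi> i \<in> PF (Suc k * Suc n)" if "i < l" for i
    unfolding \<psi>_def by (rule PF_subst[OF eval_PF[OF \<phi>(2)[OF that]]]) (intro PF.PF_var idx)
  have \<psi>n: "\<exists>x. \<psi> i x \<noteq> 0" if i: "i < l" for i
  proof -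
    obtain w where w: "eval (\<phi> i) w \<noteq> 0" using eval_eq_zero[OF \<phi>(2)[OF i]] \<phi>(1)[OF i] by blast
    define x where "x = (\<lambda>u. w ((u div Suc n) * n + u mod Suc n))"
    have "\<psi> i x = eval (\<phi> i) w" unfolding \<psi>_def
    proof (rule PF_cong[OF eval_PF[OF \<phi>(2)[OF i]]])
      fix v assume v: "v < Suc k * n"
      have lt: "v mod n < Suc n" using idx(2)[OF v] by simp
      have "((v div n) * Suc n + v mod n) div Suc n = v div n"
        using lt by (simp add: div_mult_self3 del: mult_Suc_right)
      moreover have "((v div n) * Suc n + v mod n) mod Suc n = v mod n"
        using lt by (simp add: mod_mult_self3 del: mult_Suc_right)
      ultimately show "x ((v div n) * Suc n + v mod n) = w v" unfolding x_def by simp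
    qed
    with w show ?thesis by metis
  qed
  define \<Psi> where "\<Psi> = (\<lambda>x. \<Prod>i\<in>{..<l}. \<psi> i x)"
  have \<Psi>P: "\<Psi> \<in> PF (Suc k * Suc n)" unfolding \<Psi>_def by (intro PF_prod \<psi>P) simp
  have "\<exists>x. \<Psi> x \<noteq> 0" unfolding \<Psi>_def
    by (rule PF_prod_nonzero[of _ _ "Suc k * Suc n"]) (use \<psi>P \<psi>n in auto)
  then obtain x1 where "\<Psi> x1 \<noteq> 0" by blast
  from PF_mult_nonzero[OF h(1) \<Psi>P h(2) this] obtain x2 where "h x2 * \<Psi> x2 \<noteq> 0" by auto
  from PF_nonzero_real[OF PF.PF_mult[OF h(1) \<Psi>P] this, of 1 "\<lambda>i. 0"] obtain a where
    a: "h (\<lambda>i. complex_of_real (a i)) * \<Psi> (\<lambda>i. complex_of_real (a i)) \<noteq> 0" by auto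
  define x where "x = (\<lambda>i. complex_of_real (a i))"
  define A where "A = (\<lambda>i j. a (i * Suc n + j))"
  have hx: "h x \<noteq> 0" and \<Psi>x: "\<Psi> x \<noteq> 0" using a unfolding x_def by auto
  have "eval (\<phi> i) (mat_point n A) \<noteq> 0" if "i < l" for i
  proof -
    have "\<psi> i x \<noteq> 0" using \<Psi>x that unfolding \<Psi>_def by auto
    moreover have "\<psi> i x = eval (\<phi> i) (mat_point n A)" unfolding \<psi>_def mat_point_def A_def x_def ..
    ultimately show ?thesis by simp
  qed
  then have "real_dense (Suc k) (zariski_closure (Suc k) (lin_proj n (Suc k) A ` V))" by (rule good)
  moreover have "lin_proj n (Suc k) A = (\<lambda>y i. if i < Suc k then \<Sum>j<n. x (i * Suc n + j) * y j else 0)"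
    unfolding lin_proj_def A_def x_def by (simp add: fun_eq_iff del: mult_Suc_right)
  ultimately have "real_dense (Suc k) (fiber_closure x)" unfolding fiber_closure_def by simp
  moreover have "\<forall>i. x i \<in> \<real>" unfolding x_def by simp
  ultimately show ?thesis using hx by blast
qed

lemma zx_real: "(\<And>i. x i \<in> \<real>) \<Longrightarrow> (\<And>i. u i \<in> \<real>) \<Longrightarrow> zx x u v \<in> \<real>"
  unfolding zx_def by simp

lemma real_denseD:
  assumes "real_dense q W" "f \<in> PF q" "u \<in> W" "f u \<noteq> 0"
  shows "\<exists>w\<in>W. (\<forall>i. w i \<in> \<real>) \<and> f w \<noteq> 0"
  using bspec[OF assms(1)[unfolded real_dense_def] assms(2)] assms(3,4) by blast

text \<open>At real arguments \<open>f + \<i> * h = 0\<close> forces both real polynomials to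
  vanish. If one of them were no relation, it would be nonzero over some real good \<open>x\<close>,
  and by density in that projection at a real point of the closed image, where the whole relation
  vanishes.\<close>

lemma real_parts_J:
  assumes G: "(\<lambda>x. f x + \<i> * h x) \<in> J n V (Suc k)" and f: "f \<in> PF (Suc k * Suc n)" "cjf f = f"
    and h: "h \<in> PF (Suc k * Suc n)" "cjf h = h"
  shows "f \<in> J n V (Suc k) \<and> h \<in> J n V (Suc k)"
proof -
  have main: "r \<in> J n V (Suc k)" if r: "r \<in> PF (Suc k * Suc n)"
    "\<And>z. (\<And>i. z i \<in> \<real>) \<Longrightarrow> f z + \<i> * h z = 0 \<Longrightarrow> r z = 0" for r
  proof (rule ccontr)
    assume "r \<notin> J n V (Suc k)"
    then obtain x0 y where y: "y \<in> V" "r (gx n x0 y) \<noteq> 0" using r(1) unfolding J_def by blast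
    obtain x where x: "\<forall>i. x i \<in> \<real>" "r (gx n x y) \<noteq> 0" "real_dense (Suc k) (fiber_closure x)"
      using ex_good[OF gx_PF1[OF r(1)] y(2)] by (elim exE conjE) (rule that)
    let ?u = "\<lambda>i. if i < Suc k then \<Sum>j<n. x (i * Suc n + j) * y j else 0"
    have "r (zx x ?u) \<noteq> 0" unfolding zx_image[OF r(1)] by (rule x(2))
    from real_denseD[OF x(3) zx_PF[OF r(1)] image_fiber_closure[OF y(1)] this]
    obtain w where w: "w \<in> fiber_closure x" "\<forall>i. w i \<in> \<real>" "r (zx x w) \<noteq> 0" by (elim bexE conjE) (rule that)
    have "f (zx x w) + \<i> * h (zx x w) = 0" using J_fiber[OF G w(1)] .
    moreover have "zx x w i \<in> \<real>" for i by (rule zx_real) (use x(1) w(2) in auto)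
    ultimately show False using r(2) w(3) by blast
  qed
  have parts: "f z = 0 \<and> h z = 0" if "\<And>i. z i \<in> \<real>" "f z + \<i> * h z = 0" for z
    by (rule complex_real_parts) (use real_fun_real_point f(2) h(2) that in auto)
  show ?thesis using main[OF f(1)] main[OF h(1)] parts by blast
qed

lemma real_dense_V:
  assumes k: "k = vd n V"
  shows "real_dense n V"
proof -
  define m where "m = k * Suc n + n"
  have Sm: "Suc k * Suc n = Suc m" unfolding m_def by simp
  obtain F c D where "gen n V k m F c D" using ex_gen unfolding k m_def by blast
  then interpret G: gen n V k m F c D .
  obtain f h where fh: "f \<in> PF (Suc m)" "h \<in> PF (Suc m)" "cjf f = f" "cjf h = h" "F = (\<lambda>x. f x + \<i> * h x)"
    using real_fun_decomp[OF G.F_PF] by (elim bexE conjE) (rule that)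
  have J: "f \<in> J n V (Suc k)" "h \<in> J n V (Suc k)"
    using real_parts_J[of f h] G.F_J fh unfolding Sm by auto
  have cF: "cjf F = (\<lambda>x. f x - \<i> * h x)"
  proof
    fix x
    have "cnj (f (\<lambda>i. cnj (x i))) = f x" "cnj (h (\<lambda>i. cnj (x i))) = h x"
      using fun_cong[OF fh(3), of x] fun_cong[OF fh(4), of x] unfolding cjf_def by auto
    then show "cjf F x = f x - \<i> * h x" unfolding cjf_def fh(5) by simp
  qed
  have Fl: "lowdeg m (Suc D) F" unfolding G.F_eq lowdeg_def lessThan_Suc_atMost using G.c_PF by blast
  have "f = (\<lambda>x. (1/2) * (F x + cjf F x))" by (rule ext) (simp add: fun_cong[OF cF] fun_cong[OF fh(5)])
  then have fl: "lowdeg m (Suc D) f"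
    using lowdeg_mult[OF lowdeg_add[OF Fl lowdeg_cjf[OF Fl]] PF_const[of "1/2"]] by simp
  have "h = (\<lambda>x. (1 / (2 * \<i>)) * (F x - cjf F x))" by (rule ext) (simp add: fun_cong[OF cF] fun_cong[OF fh(5)])
  then have hl: "lowdeg m (Suc D) h"
    using lowdeg_mult[OF lowdeg_diff[OF Fl lowdeg_cjf[OF Fl]] PF_const[of "1 / (2 * \<i>)"]] by simp
  have "pd m F = (\<lambda>x. pd m f x + \<i> * pd m h x)"
    unfolding fh(5) using pd_add[OF fh(1) PF.PF_mult[OF PF_const fh(2)]] pd_mult[OF PF_const fh(2)] by simp
  then have ne: "f \<noteq> (\<lambda>x. 0) \<or> h \<noteq> (\<lambda>x. 0)"
    using G.rho_not_J unfolding G.rho_def J_def by (auto simp: PF.PF_const)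
  \<comment> \<open>Real and imaginary part of \<open>F\<close> are relations within the same degree
    bound, and one of them is nonzero. Used in place of \<open>F\<close>, it makes
    \<open>rho\<close> and \<open>Fd\<close> real.\<close>
  have "\<exists>R. R \<in> J n V (Suc k) \<and> cjf R = R \<and> lowdeg m (Suc D) R \<and> R \<noteq> (\<lambda>x. 0)"
    using ne
  proof
    assume "f \<noteq> (\<lambda>x. 0)"
    then show ?thesis using J(1) fh(3) fl by (intro exI[of _ f]) simp
  next
    assume "h \<noteq> (\<lambda>x. 0)"
    then show ?thesis using J(2) fh(4) hl by (intro exI[of _ h]) simp
  qed
  then obtain R where R: "R \<in> J n V (Suc k)" "cjf R = R" "lowdeg m (Suc D) R" "R \<noteq> (\<lambda>x. 0)"
    by (elim exE conjE)
  obtain cR where cR: "\<forall>i. cR i \<in> PF m" "R = (\<lambda>x. \<Sum>i\<le>D. cR i x * x m ^ i)"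
    using R(3) unfolding lowdeg_def lessThan_Suc_atMost by (elim exE conjE)
  have "\<exists>x. cR D x \<noteq> 0"
  proof (rule ccontr)
    assume "\<not> ?thesis"
    then have "R = (\<lambda>x. \<Sum>i<D. cR i x * x m ^ i)" using cR(2) by (simp flip: lessThan_Suc_atMost)
    then have "lowdeg m D R" unfolding lowdeg_def using cR(1) by blast
    then show False using G.min[OF R(1)] R(4) by blast
  qed
  \<comment> \<open>Minimality of \<open>D\<close> depends only on \<open>J\<close>, so the real
    relation satisfies the same axioms and the lifting formula is available with real
    coefficients.\<close>
  then interpret gen n V k m R cR D
    by unfold_locales (use m_def cR R(1) G.D_pos G.min in auto)
  have real_rho: "cjf rho = rho" "cjf (Fd j) = Fd j" for j
    unfolding rho_def Fd_def pd_cjf[OF F_PF] R(2) by (rule refl)+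
  show ?thesis unfolding real_dense_def
  proof (intro ballI impI, rule ccontr)
    fix f y1 assume f: "f \<in> PF n" "\<forall>y\<in>V. (\<forall>i. y i \<in> \<real>) \<longrightarrow> f y = 0" and y1: "y1 \<in> V" "f y1 \<noteq> 0"
    obtain x0 y where y: "y \<in> V" "f y \<noteq> 0" "rho (gx n x0 y) \<noteq> 0"
      using generic_point[OF f(1) y1] by blast
    have "(\<lambda>x. rho (gx n x y)) \<in> PF (Suc k * Suc n)" unfolding Sm by (rule gx_PF1[OF rho_PF])
    from ex_good[OF this y(3)] obtain x where x: "\<forall>i. x i \<in> \<real>" "rho (gx n x y) \<noteq> 0"
      "real_dense (Suc k) (fiber_closure x)" by (elim exE conjE) (rule that)
    obtain E ft where ft: "ft \<in> PF (Suc m)" "\<And>z y. (\<forall>j<n. Fd j z = - y j * rho z) \<Longrightarrow> ft z = rho z ^ E * f y"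
      using homogenize[OF f(1)] by blast
    let ?u = "\<lambda>i. if i < Suc k then \<Sum>j<n. x (i * Suc n + j) * y j else 0"
    \<comment> \<open>A polynomial \<open>f\<close> violating density is carried to the projection
      by homogenization; the factor \<open>rho\<close> ensures that the real point found there can
      be lifted.\<close>
    have P: "(\<lambda>z. ft z * rho z) \<in> PF (Suc k * Suc n)" unfolding Sm by (rule PF.PF_mult[OF ft(1) rho_PF])
    have "ft (gx n x y) = rho (gx n x y) ^ E * f y"
      by (rule ft(2)) (use gradient_relation[OF y(1)] in blast)
    then have "ft (gx n x y) * rho (gx n x y) \<noteq> 0" using x(2) y(2) by simp
    then have "ft (zx x ?u) * rho (zx x ?u) \<noteq> 0" using zx_image[OF P, of x y] by simp
    from real_denseD[of "Suc k" "fiber_closure x" "\<lambda>u. ft (zx x u) * rho (zx x u)" ?u,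
        OF x(3) zx_PF[OF P] image_fiber_closure[OF y(1)] this]
    obtain w where w: "w \<in> fiber_closure x" "\<forall>i. w i \<in> \<real>" "ft (zx x w) * rho (zx x w) \<noteq> 0" by (elim bexE conjE) (rule that)
    define z where "z = zx x w"
    have rz: "rho z \<noteq> 0" and fz: "ft z \<noteq> 0" using w(3) unfolding z_def by auto
    have zr: "z i \<in> \<real>" for i unfolding z_def by (rule zx_real) (use x(1) w(2) in auto)
    define v where "v = (\<lambda>j. if j < n then - Fd j z / rho z else 0)"
    have vr: "v j \<in> \<real>" for j
    proof -
      have "Fd j z \<in> \<real>" "rho z \<in> \<real>" by (rule real_fun_real_point[OF real_rho(2) zr], rule real_fun_real_point[OF real_rho(1) zr])
      then show ?thesis unfolding v_def by simp
    qed
    have Fv: "\<forall>j<n. Fd j z = - v j * rho z" unfolding v_def using rz by simp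
    \<comment> \<open>All of \<open>J\<close> vanishes at \<open>z\<close>, because \<open>w\<close>
      lies in the closed image for the coefficients \<open>x\<close>; hence every homogenized
      equation of \<open>V\<close> holds at \<open>z\<close>.\<close>
    have "v \<in> V"
    proof (rule V_closed)
      show "v \<in> cspace n" unfolding v_def cspace_def by simp
      fix p assume p: "p \<in> PF n" "\<forall>z\<in>V. p z = 0"
      obtain E' pt where pt: "pt \<in> PF (Suc m)" "\<And>z y. (\<forall>j<n. Fd j z = - y j * rho z) \<Longrightarrow> pt z = rho z ^ E' * p y"
        using homogenize[OF p(1)] by blast
      have "pt \<in> J n V (Suc k)" by (rule homogenize_J[OF pt]) (use p(2) in auto)
      then have "pt z = 0" unfolding z_def by (rule J_fiber[OF _ w(1)])
      then show "p v = 0" using pt(2)[OF Fv] rz by simp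
    qed
    then have "f v = 0" using f(2) vr by blast
    then show False using ft(2)[OF Fv] fz by simp
  qed
qed

end

theorem theorem5p10:
  fixes n k :: nat and V :: "(nat \<Rightarrow> complex) set"
  assumes "irreducible_variety n V" and "var_dim n V = k"
  shows "(defined_over_R n V \<and> has_smooth_real_point n V) \<longleftrightarrow>
         generic_real_proj n (k + 1) (\<lambda>A.
            defined_over_R (k + 1) (zariski_closure (k + 1) (lin_proj n (k + 1) A ` V)) \<and>
            has_smooth_real_point (k + 1) (zariski_closure (k + 1) (lin_proj n (k + 1) A ` V)))"
proof
  have V: "irr n V" using assms(1) by (rule irreducible_variety_irr)
  {
    assume "defined_over_R n V \<and> has_smooth_real_point n V"
    then have dense: "real_dense n V" using defined_over_R_smooth_real_dense[OF V] by blast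
    show "generic_real_proj n (k + 1) (\<lambda>A.
            defined_over_R (k + 1) (zariski_closure (k + 1) (lin_proj n (k + 1) A ` V)) \<and>
            has_smooth_real_point (k + 1) (zariski_closure (k + 1) (lin_proj n (k + 1) A ` V)))"
      unfolding generic_real_proj_def
    \<comment> \<open>The list of genericity conditions is empty: density passes to every real
      projection.\<close>
    proof (intro exI[of _ 0] exI[of _ "\<lambda>i. 0"] conjI allI impI)
      fix A
      have d: "real_dense (k + 1) (zariski_closure (k + 1) (lin_proj n (k + 1) A ` V))"
        by (rule real_dense_projection[OF dense])
      show "defined_over_R (k + 1) (zariski_closure (k + 1) (lin_proj n (k + 1) A ` V))"
        by (rule real_dense_defined_over_R[OF d])
      show "has_smooth_real_point (k + 1) (zariski_closure (k + 1) (lin_proj n (k + 1) A ` V))"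
        by (rule real_dense_smooth_point[OF irr_projection[OF V] d])
    qed auto
  }
  {
    assume "generic_real_proj n (k + 1) (\<lambda>A.
            defined_over_R (k + 1) (zariski_closure (k + 1) (lin_proj n (k + 1) A ` V)) \<and>
            has_smooth_real_point (k + 1) (zariski_closure (k + 1) (lin_proj n (k + 1) A ` V)))"
    then obtain l :: nat and \<phi> where \<phi>: "\<forall>i<l. \<phi> i \<noteq> 0 \<and> poly_in ((k + 1) * n) (\<phi> i)"
      "\<forall>A. (\<forall>i<l. eval (\<phi> i) (mat_point n A) \<noteq> 0) \<longrightarrow>
        defined_over_R (k + 1) (zariski_closure (k + 1) (lin_proj n (k + 1) A ` V)) \<and>
        has_smooth_real_point (k + 1) (zariski_closure (k + 1) (lin_proj n (k + 1) A ` V))"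
      unfolding generic_real_proj_def by (elim exE conjE)
    \<comment> \<open>The closed image is irreducible, so the implication from a smooth real point
      to density applies to each good projection.\<close>
    have "good_projections n V k l \<phi>"
    proof (rule good_projections.intro[OF V], rule good_projections_axioms.intro)
      show "\<phi> i \<noteq> 0" "poly_in (Suc k * n) (\<phi> i)" if "i < l" for i using \<phi>(1) that by auto
      fix A assume "\<And>i. i < l \<Longrightarrow> eval (\<phi> i) (mat_point n A) \<noteq> 0"
      then have "defined_over_R (k + 1) (zariski_closure (k + 1) (lin_proj n (k + 1) A ` V)) \<and>
        has_smooth_real_point (k + 1) (zariski_closure (k + 1) (lin_proj n (k + 1) A ` V))"
        using \<phi>(2) by blast
      then show "real_dense (Suc k) (zariski_closure (Suc k) (lin_proj n (Suc k) A ` V))"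
        using defined_over_R_smooth_real_dense[OF irr_projection[OF V]] by simp
    qed
    \<comment> \<open>The target dimension \<open>k + 1\<close> is the least number of generic forms
      that are dependent on \<open>V\<close>, which is what the relation \<open>F\<close>
      requires.\<close>
    from good_projections.real_dense_V[OF this] have "real_dense n V"
      using assms(2) var_dim_eq_vd[OF V] by simp
    then show "defined_over_R n V \<and> has_smooth_real_point n V"
      using real_dense_defined_over_R real_dense_smooth_point[OF V] by blast
  }
qed

end
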